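(* Let $d$ denote a nonnegative integer, let $\mathcal F$ denote a field, and let $$\theta_0,\theta_1,\ldots,\theta_d;\qquad \theta^*_0,\theta^*_1,\ldots,\theta^*_d;\qquad \varphi_1,\varphi_2,\ldots,\varphi_d;\qquad \phi_1,\phi_2,\ldots,\phi_d$$ denote scalars in $\mathcal F$. Then there exists a Leonard system $\Phi$ over $\mathcal F$ with eigenvalue sequence $\theta_0,\ldots,\theta_d$, dual eigenvalue sequence $\theta^*_0,\ldots,\theta^*_d$, $\varphi$-sequence $\varphi_1,\ldots,\varphi_d$, and $\phi$-sequence $\phi_1,\ldots,\phi_d$ if and only if (i)--(v) hold below. (i) $\varphi_i\neq 0$ and $\phi_i\neq 0$ for $1\le i\le d$. (ii) $\theta_i\neq\theta_j$ and $\theta^*_i\neq\theta^*_j$ if $i\neq j$, for $0\le i,j\le d$. (iii) $\displaystyle \varphi_i=\phi_1\sum_{h=0}^{i-1}\frac{\theta_h-\theta_{d-h}}{\theta_0-\theta_d}+(\theta^*_i-\theta^*_0)(\theta_{i-1}-\theta_d)$ for $1\le i\le d$. (iv) $\displaystyle \phi_i=\varphi_1\sum_{h=0}^{i-1}\frac{\theta_h-\theta_{d-h}}{\theta_0-\theta_d}+(\theta^*_i-\theta^*_0)(\theta_{d-i+1}-\theta_0)$ for $1\le i\le d$. (v) The expressions $$\frac{\theta_{i-2}-\theta_{i+1}}{\theta_{i-1}-\theta_i},\qquad \frac{\theta^*_{i-2}-\theta^*_{i+1}}{\theta^*_{i-1}-\theta^*_i}$$ are equal and independent of $i$, for $2\le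 i\le d-1$. Moreover, if (i)--(v) hold then $\Phi$ is unique up to isomorphism of Leonard systems.
   Context: Rows and columns of matrices in $\mathrm{Mat}_{d+1}(\mathcal F)$ are indexed by $0,1,\ldots,d$. Let $\mathcal A$ be an $\mathcal F$-algebra isomorphic to $\mathrm{Mat}_{d+1}(\mathcal F)$. An element of $\mathcal A$ is multiplicity-free if it has $d+1$ distinct eigenvalues (roots of its minimal polynomial), all in $\mathcal F$. If $A\in\mathcal A$ is multiplicity-free with eigenvalues $\theta_0,\ldots,\theta_d$, the primitive idempotent of $A$ associated with $\theta_i$ is $E_i=\prod_{j\neq i}(A-\theta_jI)/(\theta_i-\theta_j)$. A Leonard system in $\mathcal A$ is a sequence $\Phi=(A;E_0,E_1,\ldots,E_d;A^*;E^*_0,E^*_1,\ldots,E^*_d)$ such that: $A$ and $A^*$ are multiplicity-free elements of $\mathcal A$ ($A^*$ is just another element, not a conjugate-transpose); $E_0,\ldots,E_d$ is an ordering of the primitive idempotents of $A$; $E^*_0,\ldots,E^*_d$ is an ordering of the primitive idempotents of $A^*$; and for $0\le i,j\le d$, both $E_iA^*E_j$ and $E^*_iAE^*_j$ are $0$ if $|i-j|>1$ and are nonzero if $|i-j|=1$. Here $d$ is the diameter of $\Phi$, and $\Phi$ is said to be over $\mathcal F$. The eigenvalue sequence $\theta_0,\ldots,\theta_d$ (resp. dual eigenvalue sequence $\theta^*_0,\ldots,\theta^*_d$) of $\Phi$ is defined by: $\theta_i$ (resp. $\theta^*_i$) is the eigenvalue of $A$ (resp. $A^*$) associated with $E_i$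 (resp. $E^*_i$). For every Leonard system $\Phi$ there exist a unique $\mathcal F$-algebra isomorphism $\flat:\mathcal A\to\mathrm{Mat}_{d+1}(\mathcal F)$ and unique scalars $\varphi_1,\ldots,\varphi_d\in\mathcal F$ such that $A^\flat$ has $(i,i)$ entry $\theta_i$ ($0\le i\le d$), $(i,i-1)$ entry $1$ ($1\le i\le d$) and all other entries $0$, while $A^{*\flat}$ has $(i,i)$ entry $\theta^*_i$ ($0\le i\le d$), $(i-1,i)$ entry $\varphi_i$ ($1\le i\le d$) and all other entries $0$. The sequence $\varphi_1,\ldots,\varphi_d$ is the $\varphi$-sequence of $\Phi$. The $\phi$-sequence of $\Phi$ is the $\varphi$-sequence of the Leonard system $\Phi^{\Downarrow}=(A;E_d,E_{d-1},\ldots,E_0;A^*;E^*_0,E^*_1,\ldots,E^*_d)$. An isomorphism of Leonard systems from $\Phi$ (in $\mathcal A$) to $\Phi'$ (in $\mathcal A'$) is an $\mathcal F$-algebra isomorphism $\sigma:\mathcal A\to\mathcal A'$ that sends each term of the sequence $\Phi$ to the corresponding term of $\Phi'$. *)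

theory Defs
  imports
    "HOL-Algebra.QuotRing"
    "Jordan_Normal_Form.VS_Connect"
begin

text \<open>The locale \<^locale>\<open>Module.algebra\<close> of HOL-Algebra requires a commutative multiplication.\<close>

locale assoc_algebra = Module.module R A + ring A for R and A (structure) +
  assumes smult_mult_left:
      "\<lbrakk>c \<in> carrier R; x \<in> carrier A; y \<in> carrier A\<rbrakk> \<Longrightarrow> (c \<odot> x) \<otimes> y = c \<odot> (x \<otimes> y)"
    and smult_mult_right:
      "\<lbrakk>c \<in> carrier R; x \<in> carrier A; y \<in> carrier A\<rbrakk> \<Longrightarrow> x \<otimes> (c \<odot> y) = c \<odot> (x \<otimes> y)"

text \<open>A field is a type \<open>'f :: field\<close>, seen as a HOL-Algebra ring through
  \<open>class_ring\<close> where needed; an algebra over it is a record with an explicit carrier.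
  Bijectivity and preservation of \<open>\<one>\<close>, \<open>\<oplus>\<close>, \<open>\<otimes>\<close> are part of \<^const>\<open>ring_iso\<close>.\<close>

definition algebra_iso :: "('f::field, 'a) module \<Rightarrow> ('f, 'b) module \<Rightarrow> ('a \<Rightarrow> 'b) set" where
  "algebra_iso A B = {\<sigma> \<in> ring_iso A B. \<forall>c. \<forall>x\<in>carrier A. \<sigma> (c \<odot>\<^bsub>A\<^esub> x) = c \<odot>\<^bsub>B\<^esub> \<sigma> x}"

abbreviation mat_algebra :: "nat \<Rightarrow> ('f::field, 'f mat) module" where
  "mat_algebra n \<equiv> module_mat TYPE('f) n n"

definition is_matrix_algebra :: "nat \<Rightarrow> ('f::field, 'a) module \<Rightarrow> bool" where
  "is_matrix_algebra n A \<longleftrightarrow>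
     assoc_algebra class_ring A \<and> algebra_iso A (mat_algebra n) \<noteq> {}"

definition poly_eval :: "('f::field, 'a) module \<Rightarrow> 'f poly \<Rightarrow> 'a \<Rightarrow> 'a" where
  "poly_eval A p x = (\<Oplus>\<^bsub>A\<^esub>i\<in>{..degree p}. coeff p i \<odot>\<^bsub>A\<^esub> (x [^]\<^bsub>A\<^esub> i))"

definition is_minimal_poly :: "('f::field, 'a) module \<Rightarrow> 'a \<Rightarrow> 'f poly \<Rightarrow> bool" where
  "is_minimal_poly A x p \<longleftrightarrow> lead_coeff p = 1 \<and> poly_eval A p x = \<zero>\<^bsub>A\<^esub> \<and>
     (\<forall>q. q \<noteq> 0 \<and> poly_eval A q x = \<zero>\<^bsub>A\<^esub> \<longrightarrow> degree p \<le> degree q)"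

definition eigenvalues :: "('f::field, 'a) module \<Rightarrow> 'a \<Rightarrow> 'f set" where
  "eigenvalues A x = {c. \<exists>p. is_minimal_poly A x p \<and> poly p c = 0}"

text \<open>\<^const>\<open>eigenvalues\<close> collects the roots lying in the field itself. In an algebra isomorphic to
  the matrices of order \<open>d + 1\<close> the minimal polynomial has degree at most \<open>d + 1\<close>, so \<open>d + 1\<close>
  such roots are all its roots in any extension field.\<close>

definition multiplicity_free :: "('f::field, 'a) module \<Rightarrow> nat \<Rightarrow> 'a \<Rightarrow> bool" where
  "multiplicity_free A d x \<longleftrightarrow> x \<in> carrier A \<and> card (eigenvalues A x) = d + 1"

text \<open>\<^const>\<open>finprod\<close> is usually applied in commutative monoids; here the factors are
  polynomials in \<open>x\<close>, hence commute, and the product is independent of the order even though the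
  algebra is not commutative (see \<open>finprod_linear_factors_insert\<close> below).\<close>

definition linear_factor :: "('f::field, 'a) module \<Rightarrow> 'a \<Rightarrow> 'f \<Rightarrow> 'f \<Rightarrow> 'a" where
  "linear_factor A x c \<mu> = inverse (c - \<mu>) \<odot>\<^bsub>A\<^esub> (x \<ominus>\<^bsub>A\<^esub> \<mu> \<odot>\<^bsub>A\<^esub> \<one>\<^bsub>A\<^esub>)"

definition primitive_idempotent :: "('f::field, 'a) module \<Rightarrow> 'a \<Rightarrow> 'f \<Rightarrow> 'a" where
  "primitive_idempotent A x c =
     (\<Otimes>\<^bsub>A\<^esub>\<mu>\<in>eigenvalues A x - {c}. linear_factor A x c \<mu>)"

lemma finprod_linear_factors_insert:
  fixes A :: "('f::field, 'a) module"
  assumes alg: "assoc_algebra class_ring A" and x: "x \<in> carrier A"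
    and S: "finite S" "\<mu> \<notin> S"
  shows "(\<Otimes>\<^bsub>A\<^esub>\<nu>\<in>insert \<mu> S. linear_factor A x c \<nu>) =
    linear_factor A x c \<mu> \<otimes>\<^bsub>A\<^esub> (\<Otimes>\<^bsub>A\<^esub>\<nu>\<in>S. linear_factor A x c \<nu>)"
proof -
  interpret assoc_algebra "class_ring :: 'f ring" A by (rule alg)
  have sm [simp]: "\<And>a y. y \<in> carrier A \<Longrightarrow> a \<odot>\<^bsub>A\<^esub> y \<in> carrier A"
    using smult_closed by simp
  have cl: "linear_factor A x c \<nu> \<in> carrier A" for \<nu>
    using x by (simp add: linear_factor_def)
  let ?g = "\<lambda>\<nu>. x \<ominus>\<^bsub>A\<^esub> \<nu> \<odot>\<^bsub>A\<^esub> \<one>\<^bsub>A\<^esub>"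
  have g: "?g \<nu> \<in> carrier A" for \<nu> using x by simp
  have sl: "\<And>a y z. y \<in> carrier A \<Longrightarrow> z \<in> carrier A \<Longrightarrow>
      (a \<odot>\<^bsub>A\<^esub> y) \<otimes>\<^bsub>A\<^esub> z = a \<odot>\<^bsub>A\<^esub> (y \<otimes>\<^bsub>A\<^esub> z)"
    using smult_mult_left by simp
  have sr: "\<And>a y z. y \<in> carrier A \<Longrightarrow> z \<in> carrier A \<Longrightarrow>
      y \<otimes>\<^bsub>A\<^esub> (a \<odot>\<^bsub>A\<^esub> z) = a \<odot>\<^bsub>A\<^esub> (y \<otimes>\<^bsub>A\<^esub> z)"
    using smult_mult_right by simp
  have ss: "\<And>a b y. y \<in> carrier A \<Longrightarrow> a \<odot>\<^bsub>A\<^esub> (b \<odot>\<^bsub>A\<^esub> y) = b \<odot>\<^bsub>A\<^esub> (a \<odot>\<^bsub>A\<^esub> y)"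
  proof -
    fix a b :: 'f and y assume y: "y \<in> carrier A"
    have "a \<odot>\<^bsub>A\<^esub> (b \<odot>\<^bsub>A\<^esub> y) = (a * b) \<odot>\<^bsub>A\<^esub> y" using smult_assoc1[of a b y] y by simp
    moreover have "b \<odot>\<^bsub>A\<^esub> (a \<odot>\<^bsub>A\<^esub> y) = (b * a) \<odot>\<^bsub>A\<^esub> y" using smult_assoc1[of b a y] y by simp
    ultimately show "a \<odot>\<^bsub>A\<^esub> (b \<odot>\<^bsub>A\<^esub> y) = b \<odot>\<^bsub>A\<^esub> (a \<odot>\<^bsub>A\<^esub> y)" by (simp add: mult.commute)
  qed
  have xg: "x \<otimes>\<^bsub>A\<^esub> ?g \<nu> = ?g \<nu> \<otimes>\<^bsub>A\<^esub> x" for \<nu>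
    using x by (simp add: a_minus_def l_distr r_distr l_minus r_minus sl sr)
  have gg: "?g \<nu> \<otimes>\<^bsub>A\<^esub> ?g \<rho> = ?g \<rho> \<otimes>\<^bsub>A\<^esub> ?g \<nu>" for \<nu> \<rho>
  proof -
    have "?g \<nu> \<otimes>\<^bsub>A\<^esub> ?g \<rho> = x \<otimes>\<^bsub>A\<^esub> ?g \<rho> \<ominus>\<^bsub>A\<^esub> \<nu> \<odot>\<^bsub>A\<^esub> ?g \<rho>"
      using x g[of \<rho>] by (simp only: a_minus_def l_distr l_minus sl sm a_inv_closed one_closed l_one)
    moreover have "?g \<rho> \<otimes>\<^bsub>A\<^esub> ?g \<nu> = ?g \<rho> \<otimes>\<^bsub>A\<^esub> x \<ominus>\<^bsub>A\<^esub> \<nu> \<odot>\<^bsub>A\<^esub> ?g \<rho>"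
      using x g[of \<rho>] by (simp only: a_minus_def r_distr r_minus sr sm a_inv_closed one_closed r_one)
    ultimately show ?thesis using xg by simp
  qed
  have comm: "linear_factor A x c \<nu> \<otimes>\<^bsub>A\<^esub> linear_factor A x c \<rho> =
      linear_factor A x c \<rho> \<otimes>\<^bsub>A\<^esub> linear_factor A x c \<nu>" for \<nu> \<rho>
    unfolding linear_factor_def using g[of \<nu>] g[of \<rho>] gg[of \<nu> \<rho>]
    by (simp only: sl sr sm m_closed ss)
  interpret L: LCD UNIV "carrier A" "(\<otimes>\<^bsub>A\<^esub>) \<circ> linear_factor A x c"
    by unfold_locales (use cl comm in \<open>auto simp: m_assoc[symmetric]\<close>)
  show ?thesis
    unfolding finprod_def using S by (simp add: L.foldD_insert)
qed

text \<open>Only the values of \<open>idem\<close> and \<open>dual_idem\<close> at \<open>0, \<dots>, d\<close> are part of the system.\<close>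

record 'a leonard =
  elt :: 'a
  idem :: "nat \<Rightarrow> 'a"
  dual_elt :: 'a
  dual_idem :: "nat \<Rightarrow> 'a"

definition idempotent_ordering ::
    "('f::field, 'a) module \<Rightarrow> nat \<Rightarrow> 'a \<Rightarrow> (nat \<Rightarrow> 'a) \<Rightarrow> bool" where
  "idempotent_ordering A d x E \<longleftrightarrow>
     bij_betw E {..d} (primitive_idempotent A x ` eigenvalues A x)"

definition leonard_system :: "('f::field, 'a) module \<Rightarrow> nat \<Rightarrow> 'a leonard \<Rightarrow> bool" where
  "leonard_system A d \<Phi> \<longleftrightarrow>
     is_matrix_algebra (d + 1) A \<and>
     multiplicity_free A d (elt \<Phi>) \<and>
     multiplicity_free A d (dual_elt \<Phi>) \<and>
     idempotent_ordering A d (elt \<Phi>) (idem \<Phi>) \<and>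
     idempotent_ordering A d (dual_elt \<Phi>) (dual_idem \<Phi>) \<and>
     (\<forall>i\<le>d. \<forall>j\<le>d.
        (\<bar>int i - int j\<bar> > 1 \<longrightarrow>
           idem \<Phi> i \<otimes>\<^bsub>A\<^esub> dual_elt \<Phi> \<otimes>\<^bsub>A\<^esub> idem \<Phi> j = \<zero>\<^bsub>A\<^esub> \<and>
           dual_idem \<Phi> i \<otimes>\<^bsub>A\<^esub> elt \<Phi> \<otimes>\<^bsub>A\<^esub> dual_idem \<Phi> j = \<zero>\<^bsub>A\<^esub>) \<and>
        (\<bar>int i - int j\<bar> = 1 \<longrightarrow>
           idem \<Phi> i \<otimes>\<^bsub>A\<^esub> dual_elt \<Phi> \<otimes>\<^bsub>A\<^esub> idem \<Phi> j \<noteq> \<zero>\<^bsub>A\<^esub> \<and>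
           dual_idem \<Phi> i \<otimes>\<^bsub>A\<^esub> elt \<Phi> \<otimes>\<^bsub>A\<^esub> dual_idem \<Phi> j \<noteq> \<zero>\<^bsub>A\<^esub>))"

definition eigenvalue_sequence ::
    "('f::field, 'a) module \<Rightarrow> nat \<Rightarrow> 'a leonard \<Rightarrow> (nat \<Rightarrow> 'f) \<Rightarrow> bool" where
  "eigenvalue_sequence A d \<Phi> \<theta> \<longleftrightarrow>
     (\<forall>i\<le>d. \<theta> i \<in> eigenvalues A (elt \<Phi>) \<and>
        idem \<Phi> i = primitive_idempotent A (elt \<Phi>) (\<theta> i))"

definition dual_eigenvalue_sequence ::
    "('f::field, 'a) module \<Rightarrow> nat \<Rightarrow> 'a leonard \<Rightarrow> (nat \<Rightarrow> 'f) \<Rightarrow> bool" where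
  "dual_eigenvalue_sequence A d \<Phi> \<theta>s \<longleftrightarrow>
     (\<forall>i\<le>d. \<theta>s i \<in> eigenvalues A (dual_elt \<Phi>) \<and>
        dual_idem \<Phi> i = primitive_idempotent A (dual_elt \<Phi>) (\<theta>s i))"

definition lower_bidiagonal :: "nat \<Rightarrow> (nat \<Rightarrow> 'f::field) \<Rightarrow> 'f mat" where
  "lower_bidiagonal d \<theta> = mat (d + 1) (d + 1)
     (\<lambda>(i, j). if i = j then \<theta> i else if i = j + 1 then 1 else 0)"

definition upper_bidiagonal :: "nat \<Rightarrow> (nat \<Rightarrow> 'f::field) \<Rightarrow> (nat \<Rightarrow> 'f) \<Rightarrow> 'f mat" where
  "upper_bidiagonal d \<theta>s \<phi> = mat (d + 1) (d + 1)
     (\<lambda>(i, j). if i = j then \<theta>s i else if i + 1 = j then \<phi> j else 0)"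

text \<open>We write \<open>\<phi>\<close> for the first split sequence (the varphi-sequence) and \<open>\<psi>\<close> for the second one
  (the phi-sequence, that is, the varphi-sequence of the system with the \<open>E\<^sub>i\<close> reversed). The
  scalars with the required isomorphism are unique, so a relation suffices. Both are indexed by
  \<open>1, \<dots>, d\<close>; values elsewhere are irrelevant.\<close>

definition first_split_sequence ::
    "('f::field, 'a) module \<Rightarrow> nat \<Rightarrow> 'a leonard \<Rightarrow> (nat \<Rightarrow> 'f) \<Rightarrow> bool" where
  "first_split_sequence A d \<Phi> \<phi> \<longleftrightarrow>
     (\<exists>\<theta> \<theta>s. eigenvalue_sequence A d \<Phi> \<theta> \<and> dual_eigenvalue_sequence A d \<Phi> \<theta>s \<and>
        (\<exists>\<beta> \<in> algebra_iso A (mat_algebra (d + 1)).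
           \<beta> (elt \<Phi>) = lower_bidiagonal d \<theta> \<and> \<beta> (dual_elt \<Phi>) = upper_bidiagonal d \<theta>s \<phi>))"

definition reverse_idem :: "nat \<Rightarrow> 'a leonard \<Rightarrow> 'a leonard" where
  "reverse_idem d \<Phi> = \<Phi>\<lparr>idem := (\<lambda>i. idem \<Phi> (d - i))\<rparr>"

definition second_split_sequence ::
    "('f::field, 'a) module \<Rightarrow> nat \<Rightarrow> 'a leonard \<Rightarrow> (nat \<Rightarrow> 'f) \<Rightarrow> bool" where
  "second_split_sequence A d \<Phi> \<psi> \<longleftrightarrow> first_split_sequence A d (reverse_idem d \<Phi>) \<psi>"

text \<open>HOL cannot quantify existentially over the type of the carrier. Existence over a field \<open>'f\<close> is
  therefore stated for algebras carried by a set of matrices, which is no restriction up to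
  isomorphism, while statements about all systems use an arbitrary carrier type.\<close>

definition leonard_system_with ::
    "('f::field, 'a) module \<Rightarrow> nat \<Rightarrow> 'a leonard \<Rightarrow>
     (nat \<Rightarrow> 'f) \<Rightarrow> (nat \<Rightarrow> 'f) \<Rightarrow> (nat \<Rightarrow> 'f) \<Rightarrow> (nat \<Rightarrow> 'f) \<Rightarrow> bool" where
  "leonard_system_with A d \<Phi> \<theta> \<theta>s \<phi> \<psi> \<longleftrightarrow>
     leonard_system A d \<Phi> \<and>
     eigenvalue_sequence A d \<Phi> \<theta> \<and> dual_eigenvalue_sequence A d \<Phi> \<theta>s \<and>
     first_split_sequence A d \<Phi> \<phi> \<and> second_split_sequence A d \<Phi> \<psi>"

definition leonard_iso ::
    "nat \<Rightarrow> ('f::field, 'a) module \<Rightarrow> 'a leonard \<Rightarrow> ('f, 'b) module \<Rightarrow> 'b leonard \<Rightarrow> ('a \<Rightarrow> 'b) set" where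
  "leonard_iso d A \<Phi> B \<Psi> = {\<sigma> \<in> algebra_iso A B.
     \<sigma> (elt \<Phi>) = elt \<Psi> \<and> \<sigma> (dual_elt \<Phi>) = dual_elt \<Psi> \<and>
     (\<forall>i\<le>d. \<sigma> (idem \<Phi> i) = idem \<Psi> i \<and> \<sigma> (dual_idem \<Phi> i) = dual_idem \<Psi> i)}"

text \<open>The five conjuncts are conditions (i) to (v) of the classification. All denominators are
  nonzero by the second one.\<close>

definition parameter_conditions ::
    "nat \<Rightarrow> (nat \<Rightarrow> 'f::field) \<Rightarrow> (nat \<Rightarrow> 'f) \<Rightarrow> (nat \<Rightarrow> 'f) \<Rightarrow> (nat \<Rightarrow> 'f) \<Rightarrow> bool" where
  "parameter_conditions d \<theta> \<theta>s \<phi> \<psi> \<longleftrightarrow>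
     (\<forall>i\<in>{1..d}. \<phi> i \<noteq> 0 \<and> \<psi> i \<noteq> 0) \<and>
     (\<forall>i\<le>d. \<forall>j\<le>d. i \<noteq> j \<longrightarrow> \<theta> i \<noteq> \<theta> j \<and> \<theta>s i \<noteq> \<theta>s j) \<and>
     (\<forall>i\<in>{1..d}. \<phi> i = \<psi> 1 * (\<Sum>h=0..i-1. (\<theta> h - \<theta> (d - h)) / (\<theta> 0 - \<theta> d))
                        + (\<theta>s i - \<theta>s 0) * (\<theta> (i - 1) - \<theta> d)) \<and>
     (\<forall>i\<in>{1..d}. \<psi> i = \<phi> 1 * (\<Sum>h=0..i-1. (\<theta> h - \<theta> (d - h)) / (\<theta> 0 - \<theta> d))
                        + (\<theta>s i - \<theta>s 0) * (\<theta> (d - i + 1) - \<theta> 0)) \<and>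
     (\<exists>\<gamma>. \<forall>i\<in>{2..d-1}.
        (\<theta> (i - 2) - \<theta> (i + 1)) / (\<theta> (i - 1) - \<theta> i) = \<gamma> \<and>
        (\<theta>s (i - 2) - \<theta>s (i + 1)) / (\<theta>s (i - 1) - \<theta>s i) = \<gamma>)"

end

(* In an eigenbasis of A, the element A* acts as a tridiagonal matrix X. Reading X as an operator on
   polynomials evaluated on the grid theta_0, ..., theta_d, the split form with respect to A and A*
   says that X maps the Newton polynomial tau_n to theta*_n tau_n + varphi_n tau_{n-1}; reversing the
   grid gives the phi-sequence. So the parameters of a Leonard system are those of a tridiagonal
   operator that does not raise degrees.

   Necessity: by tridiagonality, A^2 A* A - A A* A^2 is a commutator [p(A), A*]; comparing degrees
   bounds deg p by 3, which gives (v). Evaluating X at an end point of the grid, where its row has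
   only two entries, gives (iii) and (iv).

   Sufficiency: each row of X is determined by the images of 1, x, x^2. By (v), the two neighbours of
   a grid point are the roots of a quadratic whose coefficients are polynomials in that point, so
   degree preservation propagates from 1, x, x^2 to all powers. The resulting irreducible tridiagonal
   X is symmetrized by a diagonal matrix; hence A, which is upper Hessenberg in the eigenbasis of A*,
   is tridiagonal and irreducible there. *)

theory Submission
  imports Defs
begin

section \<open>Sequences with a three-term recurrence\<close>

text \<open>The field is arbitrary, and closed forms of \<theta> and \<theta>s would depend on
  \<beta> and on the characteristic; so only the recurrences implied by (v) and antisymmetry under
  reversal of the grid are used.

  The varphi- and phi-sequences come from two unrelated isomorphisms, and an eigenbasis of A is
  fixed only up to scaling of its vectors. The two tridiagonal matrices may thus differ by a
  reversal and a conjugation by a diagonal matrix. What survives is the diagonal: its entries are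
  the scalars c with E_i A* E_i = c E_i, and they already determine a split sequence.

  Conversely, a row of X has at most three unknown entries, hence room for three moments, and for d
  \<ge> 2 the two end rows are overdetermined. The row at \<theta>_0 is consistent because the
  prescribed images come from a split form starting there, the row at \<theta>_d by (iii) for i = 1,
  2. Beyond varphi_1, varphi_2 and phi_1 no term of the split sequences is prescribed; the formulas
  proved for necessity recover the rest.\<close>

definition recurrent :: "nat \<Rightarrow> 'f::field \<Rightarrow> (nat \<Rightarrow> 'f) \<Rightarrow> bool" where
  "recurrent d \<beta> x \<longleftrightarrow> (\<exists>c. \<forall>m. m + 2 \<le> d \<longrightarrow> x (m + 2) + x m = \<beta> * x (m + 1) + c)"

text \<open>Both outer coefficients are 1, so two consecutive zeros propagate in either direction
  without any division.\<close>

lemma homogeneous_recurrence_zero: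
  fixes f :: "nat \<Rightarrow> 'f::field"
  assumes rec: "\<And>m. m + 2 \<le> N \<Longrightarrow> f (m + 2) + f m = \<beta> * f (m + 1)"
    and c: "c + 1 \<le> N" "f c = 0" "f (c + 1) = 0" and m: "m \<le> N"
  shows "f m = 0"
proof -
  \<comment> \<open>Beyond \<open>k = c\<close> truncated subtraction keeps the index at 0, so the
    claim holds without a bound on \<open>k\<close>.\<close>
  have down: "f (c - k) = 0 \<and> f (c - k + 1) = 0" for k
  proof (induction k)
    case (Suc k)
    show ?case
    proof (cases "k < c")
      case True
      then have "c - k = c - Suc k + 1" by simp
      with Suc rec[of "c - Suc k"] c(1) True show ?thesis by simp
    next
      case False
      with Suc show ?thesis by simp
    qed
  qed (use c in simp)
  have up: "c + k + 1 \<le> N \<Longrightarrow> f (c + k) = 0 \<and> f (c + k + 1) = 0" for k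
  proof (induction k)
    case (Suc k)
    with rec[of "c + k"] show ?case by (simp add: eq_neg_iff_add_eq_0)
  qed (use c in simp)
  show ?thesis
  proof (cases "m \<le> c")
    case True
    with down[of "c - m"] show ?thesis by simp
  next
    case False
    with up[of "m - c - 1"] m show ?thesis by simp
  qed
qed

text \<open>For fixed \<open>N\<close> the sequence \<open>x m - x (N - m)\<close> satisfies a homogeneous recurrence and is
  antisymmetric under \<open>m \<mapsto> N - m\<close>, and such sequences form a one-dimensional space.\<close>

lemma recurrent_differences_proportional:
  assumes x: "recurrent d \<beta> x" and y: "recurrent d \<beta> y"
    and N: "N \<le> d" "m \<le> N" "k \<le> N"
  shows "(x m - x (N - m)) * (y k - y (N - k)) = (x k - x (N - k)) * (y m - y (N - m))"
proof (cases "N = 0")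
  case True
  with N show ?thesis by simp
next
  case False
  define e where "e z m = z m - z (N - m)" for z :: "nat \<Rightarrow> 'a" and m
  \<comment> \<open>For odd \<open>N\<close> the reversal swaps \<open>c\<close> and
    \<open>c + 1\<close>; for even \<open>N\<close> it fixes \<open>c + 1\<close>. Antisymmetry thus
    reduces two consecutive zeros to the single one at \<open>c\<close>.\<close>
  define c where "c = (N - 1) div 2"
  have c: "c + 1 \<le> N" using False by (simp add: c_def)
  have rec: "e z (m + 2) + e z m = \<beta> * e z (m + 1)" if z: "recurrent d \<beta> z" and m: "m + 2 \<le> N" for z m
  proof -
    obtain g where g: "\<And>m. m + 2 \<le> d \<Longrightarrow> z (m + 2) + z m = \<beta> * z (m + 1) + g"
      using z by (auto simp: recurrent_def)
    have i: "N - (m + 2) + 2 = N - m" "N - (m + 2) + 1 = N - (m + 1)" using m by auto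
    from g[of m] g[of "N - (m + 2)"] m N(1) show ?thesis
      by (simp only: e_def i) (simp add: algebra_simps)
  qed
  \<comment> \<open>The value at a fixed point of the reversal is assumed to vanish separately: in
    characteristic 2 antisymmetry alone does not give this.\<close>
  have centre: "f c = 0 \<Longrightarrow> f (c + 1) = 0"
    if "\<And>m. m \<le> N \<Longrightarrow> f (N - m) = - f m" "\<And>m. m = N - m \<Longrightarrow> f m = 0" for f :: "nat \<Rightarrow> 'a"
  proof (cases "even N")
    case True
    then have "c + 1 = N - (c + 1)" using False unfolding c_def by presburger
    then show ?thesis by (rule that(2))
  next
    case odd: False
    then have "N - c = c + 1" using c by (auto simp: c_def elim!: oddE)
    then show "f c = 0 \<Longrightarrow> ?thesis" using c that(1)[of c] by simp
  qed
  have cross: "e x m * e y c = e x c * e y m" if "m \<le> N" for m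
  proof -
    \<comment> \<open>The combination that vanishes at \<open>c\<close>; it is antisymmetric too,
      hence identically zero.\<close>
    define f where "f m = e x m * e y c - e x c * e y m" for m
    have "f m = 0"
    proof (rule homogeneous_recurrence_zero[where f = f and N = N and \<beta> = \<beta> and c = c])
      show "f (m + 2) + f m = \<beta> * f (m + 1)" if "m + 2 \<le> N" for m
      proof -
        have "e x (m + 2) = \<beta> * e x (m + 1) - e x m" "e y (m + 2) = \<beta> * e y (m + 1) - e y m"
          using rec[OF x that] rec[OF y that] by (simp_all add: eq_diff_eq)
        then show ?thesis by (simp only: f_def) (simp add: algebra_simps)
      qed
      show fc: "f c = 0" by (simp add: f_def)
      show "f (c + 1) = 0"
        by (rule centre[where f = f, OF _ _ fc]) (auto simp: f_def e_def algebra_simps)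
    qed (use c that in auto)
    then show ?thesis by (simp add: f_def)
  qed
  have "e x m * e y k = e x k * e y m"
  proof (cases "e x c = 0")
    case True
    have "e x m = 0" if "m \<le> N" for m
    proof (rule homogeneous_recurrence_zero[where f = "e x" and N = N and \<beta> = \<beta> and c = c])
      show "e x (c + 1) = 0" by (rule centre[where f = "e x", OF _ _ True]) (auto simp: e_def)
    qed (use c that True rec[OF x] in auto)
    with N show ?thesis by simp
  next
    case False
    have "e y j = e x j * e y c / e x c" if "j \<le> N" for j
      using cross[OF that] False by (simp add: field_simps)
    with N show ?thesis by simp
  qed
  then show ?thesis by (simp add: e_def)
qed

text \<open>The numerator of the sums in (iii) and (iv). Without the denominator it is linear in
  \<theta>, which suits the recurrence.\<close>

definition antisym_sum :: "nat \<Rightarrow> (nat \<Rightarrow> 'f::field) \<Rightarrow> nat \<Rightarrow> 'f" where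
  "antisym_sum d \<theta> n = (\<Sum>h<n. \<theta> h - \<theta> (d - h))"

text \<open>The increments \<open>\<theta> h - \<theta> (d - h)\<close> satisfy the homogeneous
  recurrence, since the constant cancels. Hence the defect of the partial sums from the homogeneous
  recurrence does not change with \<open>m\<close>, and its value at 0 serves as the
  constant.\<close>

lemma recurrent_antisym_sum:
  assumes "recurrent d \<beta> \<theta>"
  shows "recurrent d \<beta> (antisym_sum d \<theta>)"
proof -
  let ?S = "antisym_sum d \<theta>"
  obtain c where c: "\<And>m. m + 2 \<le> d \<Longrightarrow> \<theta> (m + 2) + \<theta> m = \<beta> * \<theta> (m + 1) + c"
    using assms by (auto simp: recurrent_def)
  have "m + 2 \<le> d \<Longrightarrow> ?S (m + 2) + ?S m = \<beta> * ?S (m + 1) + (?S 2 + ?S 0 - \<beta> * ?S 1)" for m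
  proof (induction m)
    case 0
    then show ?case by (simp add: numeral_2_eq_2)
  next
    case (Suc m)
    have step: "?S (Suc k) = ?S k + (\<theta> k - \<theta> (d - k))" for k
      by (simp add: antisym_sum_def)
    have i: "d - (m + 2) + 2 = d - m" "d - (m + 2) + 1 = d - (m + 1)" using Suc.prems by auto
    have e: "(\<theta> (m + 2) - \<theta> (d - (m + 2))) + (\<theta> m - \<theta> (d - m))
        = \<beta> * (\<theta> (m + 1) - \<theta> (d - (m + 1)))"
      using c[of m] c[of "d - (m + 2)"] Suc.prems by (simp only: i) (simp add: algebra_simps)
    have IH: "?S (m + 2) + ?S m = \<beta> * ?S (m + 1) + (?S 2 + ?S 0 - \<beta> * ?S 1)"
      using Suc by simp
    have s1: "?S (Suc m + 2) + ?S (Suc m) = (?S (m + 2) + ?S m)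
        + ((\<theta> (m + 2) - \<theta> (d - (m + 2))) + (\<theta> m - \<theta> (d - m)))"
      using step[of "m + 2"] step[of m] by simp
    have s2: "\<beta> * ?S (Suc m + 1) = \<beta> * ?S (m + 1) + \<beta> * (\<theta> (m + 1) - \<theta> (d - (m + 1)))"
      using step[of "m + 1"] by (simp add: distrib_left)
    show ?case unfolding s1 s2 IH e by (simp only: ac_simps)
  qed
  then show ?thesis unfolding recurrent_def by blast
qed

text \<open>The summands at \<open>h\<close> and \<open>d - h\<close> are opposite. So the sum over
  all of \<open>{..d}\<close> vanishes, and removing the last \<open>m\<close> summands leaves the
  sum of the first \<open>m\<close>.\<close>

lemma antisym_sum_reflect:
  assumes "m \<le> d + 1"
  shows "antisym_sum d \<theta> (d + 1 - m) = antisym_sum d \<theta> m"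
  using assms
proof (induction m)
  case 0
  have "(\<Sum>h<d + 1. \<theta> (d - h)) = (\<Sum>h<d + 1. \<theta> h)"
    using sum.nat_diff_reindex[of \<theta> "d + 1"] by simp
  then show ?case by (simp add: antisym_sum_def sum_subtractf)
next
  case (Suc m)
  have "d + 1 - m = Suc (d - m)" using Suc.prems by simp
  then have "antisym_sum d \<theta> (d + 1 - m) = antisym_sum d \<theta> (d - m) + (\<theta> (d - m) - \<theta> m)"
    using Suc.prems by (simp add: antisym_sum_def)
  then show ?case using Suc by (simp add: antisym_sum_def algebra_simps)
qed

section \<open>Newton polynomials\<close>

definition newton :: "(nat \<Rightarrow> 'f::field) \<Rightarrow> nat \<Rightarrow> 'f poly" where
  "newton \<theta> n = (\<Prod>h<n. [:- \<theta> h, 1:])"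

lemma newton_0 [simp]: "newton \<theta> 0 = 1"
  by (simp add: newton_def)

lemma newton_Suc: "newton \<theta> (Suc n) = newton \<theta> n * [:- \<theta> n, 1:]"
  by (simp add: newton_def)

lemma degree_newton [simp]: "degree (newton \<theta> n) = n"
  unfolding newton_def by (subst degree_prod_sum_eq) auto

lemma lead_coeff_newton: "lead_coeff (newton \<theta> n) = 1"
  by (simp add: newton_def lead_coeff_prod)

lemma coeff_newton_self [simp]: "coeff (newton \<theta> n) n = 1"
  using lead_coeff_newton[of \<theta> n] by simp

lemma poly_newton: "poly (newton \<theta> n) x = (\<Prod>h<n. x - \<theta> h)"
  by (simp add: newton_def poly_prod)

lemma poly_newton_pred:
  assumes "n \<noteq> 0"
  shows "poly (newton \<theta> n) x = poly (newton \<theta> (n - 1)) x * (x - \<theta> (n - 1))"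
  using assms by (cases n) (simp_all add: poly_newton)

lemma poly_newton_eq_0_iff:
  assumes "inj_on \<theta> {..d}" "i \<le> d" "n \<le> d + 1"
  shows "poly (newton \<theta> n) (\<theta> i) = 0 \<longleftrightarrow> i < n"
proof -
  have "\<theta> i \<noteq> \<theta> h" if "h < n" "\<not> i < n" for h
    using inj_onD[OF assms(1), of i h] that assms by auto
  then show ?thesis by (auto simp: poly_newton)
qed

lemma inj_on_grid_neq:
  fixes \<theta> :: "nat \<Rightarrow> 'a"
  assumes "inj_on \<theta> {..d}" "i \<le> d" "j \<le> d" "i \<noteq> j"
  shows "\<theta> i \<noteq> \<theta> j"
  using inj_onD[OF assms(1), of i j] assms by auto

lemma poly_eq_on_grid:
  fixes p q :: "'f::field poly"
  assumes "inj_on \<theta> {..d}" "degree p \<le> d" "degree q \<le> d"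
    and "\<And>i. i \<le> d \<Longrightarrow> poly p (\<theta> i) = poly q (\<theta> i)"
  shows "p = q"
  by (rule poly_eqI_degree[of "\<theta> ` {..d}"]) (use assms card_image[OF assms(1)] in auto)

lemma grid_interpolation:
  fixes \<theta> :: "nat \<Rightarrow> 'f::field"
  assumes inj: "inj_on \<theta> {..d}"
  shows "n \<le> d \<Longrightarrow> \<exists>p. degree p \<le> n \<and> (\<forall>i\<le>n. poly p (\<theta> i) = z i)"
proof (induction n)
  case 0
  show ?case by (rule exI[of _ "[:z 0:]"]) simp
next
  case (Suc n)
  then obtain p where p: "degree p \<le> n" "\<And>i. i \<le> n \<Longrightarrow> poly p (\<theta> i) = z i" by auto
  define c where "c = (z (Suc n) - poly p (\<theta> (Suc n))) / poly (newton \<theta> (Suc n)) (\<theta> (Suc n))"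
  have nz: "poly (newton \<theta> (Suc n)) (\<theta> (Suc n)) \<noteq> 0"
    using poly_newton_eq_0_iff[OF inj, of "Suc n" "Suc n"] Suc.prems by simp
  let ?q = "p + Polynomial.smult c (newton \<theta> (Suc n))"
  have "degree ?q \<le> Suc n" using p by (intro degree_add_le) auto
  moreover have "poly ?q (\<theta> i) = z i" if "i \<le> Suc n" for i
  proof (cases "i = Suc n")
    case True
    then show ?thesis using nz by (simp add: c_def)
  next
    case False
    then show ?thesis using that p poly_newton_eq_0_iff[OF inj, of i "Suc n"] Suc.prems by simp
  qed
  ultimately show ?case by blast
qed

text \<open>The origin of the sum in (iv): row 0 of a tridiagonal operator sees
  \<open>\<eta> n\<close> only at \<open>\<theta> 0\<close> and \<open>\<theta> 1\<close>. The
  induction step comes down to the proportionality of reversal differences, applied to \<theta> and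
  its own \<open>antisym_sum\<close>.\<close>

lemma newton_difference_quotient:
  fixes \<theta> :: "nat \<Rightarrow> 'f::field"
  assumes inj: "inj_on \<theta> {..d}" and rec: "recurrent d \<beta> \<theta>" and n: "1 \<le> n" "n \<le> d"
  defines "\<eta> \<equiv> newton (\<lambda>i. \<theta> (d - i))"
  shows "(poly (\<eta> n) (\<theta> 1) - poly (\<eta> n) (\<theta> 0)) * (\<theta> 0 - \<theta> d)
    = (\<theta> 1 - \<theta> 0) * poly (\<eta> (n - 1)) (\<theta> 0) * antisym_sum d \<theta> n"
  using n
proof (induction n rule: dec_induct)
  case base
  then show ?case by (simp add: \<eta>_def newton_Suc antisym_sum_def)
next
  case (step n)
  let ?S = "antisym_sum d \<theta>" and ?N = "d + 1 - n"
  have S: "?S ?N = ?S n" "?S (d - n) = ?S (Suc n)" "?S 1 = \<theta> 0 - \<theta> d" "?S 0 = 0"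
    using antisym_sum_reflect[of n d \<theta>] antisym_sum_reflect[of "Suc n" d \<theta>] step
    by (simp_all add: antisym_sum_def)
  have N: "?N \<le> d" "0 \<le> ?N" "1 \<le> ?N" "?N - 1 = d - n" using step by auto
  \<comment> \<open>The reversal is chosen so that \<open>\<theta> ?N\<close> is the last node of
    \<open>\<eta> n\<close> and \<open>\<theta> (?N - 1)\<close> the one added next;
    \<open>antisym_sum_reflect\<close> turns the indices \<open>?N\<close> and \<open>?N - 1\<close>
    of the sum into \<open>n\<close> and \<open>Suc n\<close>.\<close>
  have "(\<theta> 0 - \<theta> ?N) * (?S 1 - ?S (?N - 1)) = (\<theta> 1 - \<theta> (?N - 1)) * (?S 0 - ?S ?N)"
    using recurrent_differences_proportional[OF rec recurrent_antisym_sum[OF rec] N(1-3)] by simp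
  then have key: "(\<theta> 0 - \<theta> ?N) * (?S (Suc n) - (\<theta> 0 - \<theta> d)) = (\<theta> 1 - \<theta> (d - n)) * ?S n"
    using S by (simp only: N(4)) (simp add: algebra_simps)
  have i: "d - (n - 1) = ?N" using step by simp
  have e: "poly (\<eta> n) x = poly (\<eta> (n - 1)) x * (x - \<theta> ?N)" for x
    using poly_newton_pred[of n "\<lambda>i. \<theta> (d - i)" x] step unfolding \<eta>_def i by simp
  have s: "poly (\<eta> (Suc n)) x = poly (\<eta> n) x * (x - \<theta> (d - n))" for x
    using poly_newton_pred[of "Suc n" "\<lambda>i. \<theta> (d - i)" x] unfolding \<eta>_def by simp
  have IH: "(poly (\<eta> n) (\<theta> 1) - poly (\<eta> n) (\<theta> 0)) * (\<theta> 0 - \<theta> d)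
    = (\<theta> 1 - \<theta> 0) * poly (\<eta> (n - 1)) (\<theta> 0) * ?S n" using step by simp
  have "(poly (\<eta> (Suc n)) (\<theta> 1) - poly (\<eta> (Suc n)) (\<theta> 0)) * (\<theta> 0 - \<theta> d)
    = (poly (\<eta> n) (\<theta> 1) - poly (\<eta> n) (\<theta> 0)) * (\<theta> 0 - \<theta> d) * (\<theta> 1 - \<theta> (d - n))
      + poly (\<eta> n) (\<theta> 0) * (\<theta> 1 - \<theta> 0) * (\<theta> 0 - \<theta> d)"
    unfolding s by (simp add: algebra_simps)
  also have "\<dots> = (\<theta> 1 - \<theta> 0) * poly (\<eta> (n - 1)) (\<theta> 0) * ((\<theta> 1 - \<theta> (d - n)) * ?S n
      + (\<theta> 0 - \<theta> ?N) * (\<theta> 0 - \<theta> d))"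
    unfolding IH unfolding e[of "\<theta> 0"] by (simp add: algebra_simps)
  also have "\<dots> = (\<theta> 1 - \<theta> 0) * (poly (\<eta> (n - 1)) (\<theta> 0) * (\<theta> 0 - \<theta> ?N)) * ?S (Suc n)"
    unfolding key[symmetric] by (simp add: algebra_simps)
  finally show ?case by (simp add: e)
qed

section \<open>Tridiagonal operators on a grid\<close>

definition tridiagonal :: "nat \<Rightarrow> (nat \<Rightarrow> nat \<Rightarrow> 'f::field) \<Rightarrow> bool" where
  "tridiagonal d X \<longleftrightarrow> (\<forall>i\<le>d. \<forall>j\<le>d. 1 < \<bar>int i - int j\<bar> \<longrightarrow> X i j = 0)"

text \<open>The guards matter at the ends: for \<open>i = 0\<close> the index \<open>i - 1\<close>
  is again 0, and column \<open>d + 1\<close> of \<open>X\<close> is unconstrained.\<close>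

lemma tridiagonal_row_sum:
  assumes X: "tridiagonal d X" and i: "i \<le> d"
  shows "(\<Sum>j\<le>d. X i j * f j) = (if i = 0 then 0 else X i (i - 1) * f (i - 1))
    + X i i * f i + (if i < d then X i (i + 1) * f (i + 1) else 0)"
proof -
  let ?S = "(if i = 0 then {} else {i - 1}) \<union> {i} \<union> (if i < d then {i + 1} else {})"
  have "(\<Sum>j\<le>d. X i j * f j) = (\<Sum>j\<in>?S. X i j * f j)"
  proof (rule sum.mono_neutral_right)
    show "\<forall>j\<in>{..d} - ?S. X i j * f j = 0"
    proof
      fix j assume j: "j \<in> {..d} - ?S"
      then have "j \<le> d" "j \<noteq> i" "j \<noteq> i + 1" "i \<noteq> j + 1" by (auto split: if_splits)
      then have "1 < \<bar>int i - int j\<bar>" by linarith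
      with X i \<open>j \<le> d\<close> show "X i j * f j = 0" by (simp add: tridiagonal_def)
    qed
  qed (use i in auto)
  also have "\<dots> = (if i = 0 then 0 else X i (i - 1) * f (i - 1))
    + X i i * f i + (if i < d then X i (i + 1) * f (i + 1) else 0)"
    by (cases "i = 0"; cases "i < d") (auto simp: add.commute add.left_commute)
  finally show ?thesis .
qed

lemma sum_reflect:
  fixes f :: "nat \<Rightarrow> 'a::comm_monoid_add"
  shows "(\<Sum>j\<le>d. f (d - j)) = (\<Sum>j\<le>d. f j)"
  by (rule sum.reindex_bij_witness[of _ "\<lambda>j. d - j" "\<lambda>j. d - j"]) auto

lemma inj_on_reflect:
  fixes \<theta> :: "nat \<Rightarrow> 'a"
  assumes "inj_on \<theta> {..d}" shows "inj_on (\<lambda>i. \<theta> (d - i)) {..d}"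
proof (rule inj_onI)
  fix i j assume ij: "i \<in> {..d}" "j \<in> {..d}" "\<theta> (d - i) = \<theta> (d - j)"
  then have "d - i = d - j" by (intro inj_onD[OF assms]) auto
  with ij show "i = j" by auto
qed

text \<open>\<open>X\<close> acts on functions on the grid \<open>\<theta> 0, \<dots>, \<theta> d\<close>; the coefficients \<open>\<theta>s n\<close>, \<open>\<phi> n\<close> are the entries
  of the upper bidiagonal matrix that represents \<open>X\<close> in the Newton basis.\<close>

definition split_form ::
    "nat \<Rightarrow> (nat \<Rightarrow> 'f::field) \<Rightarrow> (nat \<Rightarrow> 'f) \<Rightarrow> (nat \<Rightarrow> 'f) \<Rightarrow> (nat \<Rightarrow> nat \<Rightarrow> 'f) \<Rightarrow> bool" where
  "split_form d \<theta> \<theta>s \<phi> X \<longleftrightarrow> (\<forall>i\<le>d. \<forall>n\<le>d.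
     (\<Sum>j\<le>d. X i j * poly (newton \<theta> n) (\<theta> j)) = \<theta>s n * poly (newton \<theta> n) (\<theta> i)
       + (if n = 0 then 0 else \<phi> n * poly (newton \<theta> (n - 1)) (\<theta> i)))"

text \<open>The Newton polynomial of degree \<open>i + 1\<close> vanishes at
  \<open>\<theta> i\<close> and at \<open>\<theta> (i - 1)\<close>, so a single entry of row
  \<open>i\<close> contributes.\<close>

lemma split_form_superdiagonal:
  assumes inj: "inj_on \<theta> {..d}" and X: "tridiagonal d X" and s: "split_form d \<theta> \<theta>s \<phi> X" and i: "i < d"
  shows "X i (i + 1) * poly (newton \<theta> (i + 1)) (\<theta> (i + 1)) = \<phi> (i + 1) * poly (newton \<theta> i) (\<theta> i)"
proof -
  have z: "poly (newton \<theta> (i + 1)) (\<theta> i) = 0" "i \<noteq> 0 \<Longrightarrow> poly (newton \<theta> (i + 1)) (\<theta> (i - 1)) = 0"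
    using poly_newton_eq_0_iff[OF inj] i by auto
  have "(\<Sum>j\<le>d. X i j * poly (newton \<theta> (i + 1)) (\<theta> j)) = X i (i + 1) * poly (newton \<theta> (i + 1)) (\<theta> (i + 1))"
    using z i by (subst tridiagonal_row_sum[OF X]) auto
  then show ?thesis using s i z unfolding split_form_def by auto
qed

lemma split_form_superdiagonal_nonzero_iff:
  assumes "inj_on \<theta> {..d}" "tridiagonal d X" "split_form d \<theta> \<theta>s \<phi> X" "i < d"
  shows "X i (i + 1) \<noteq> 0 \<longleftrightarrow> \<phi> (i + 1) \<noteq> 0"
  using split_form_superdiagonal[OF assms] poly_newton_eq_0_iff[OF assms(1), of "i + 1" "i + 1"]
    poly_newton_eq_0_iff[OF assms(1), of i i] assms(4) by auto

text \<open>In row \<open>i\<close>, applied to the Newton polynomial of degree \<open>i\<close>,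
  the left entry drops out and the right one is known from \<open>split_form_superdiagonal\<close>.
  No off-diagonal entry is left in the formula, so it is insensitive to conjugation by diagonal
  matrices.\<close>

lemma split_form_diagonal:
  assumes inj: "inj_on \<theta> {..d}" and X: "tridiagonal d X" and s: "split_form d \<theta> \<theta>s \<phi> X" and i: "i \<le> d"
  shows "X i i = \<theta>s i + (if i = 0 then 0 else \<phi> i / (\<theta> i - \<theta> (i - 1)))
    - (if i < d then \<phi> (i + 1) / (\<theta> (i + 1) - \<theta> i) else 0)"
proof -
  let ?t = "\<lambda>n j. poly (newton \<theta> n) (\<theta> j)"
  have nz: "?t i i \<noteq> 0" using poly_newton_eq_0_iff[OF inj, of i i] i by simp
  have "i \<noteq> 0 \<Longrightarrow> ?t i (i - 1) = 0" using poly_newton_eq_0_iff[OF inj, of "i - 1" i] i by auto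
  then have "X i i * ?t i i + (if i < d then X i (i + 1) * ?t i (i + 1) else 0)
      = \<theta>s i * ?t i i + (if i = 0 then 0 else \<phi> i * ?t (i - 1) i)"
    using s[unfolded split_form_def, rule_format, OF i i] by (subst (asm) tridiagonal_row_sum[OF X i]) auto
  moreover have "i < d \<Longrightarrow> X i (i + 1) * ?t i (i + 1) = ?t i i * (\<phi> (i + 1) / (\<theta> (i + 1) - \<theta> i))"
  proof -
    assume id: "i < d"
    then have "\<theta> (i + 1) \<noteq> \<theta> i" using inj_onD[OF inj, of "i + 1" i] by auto
    with split_form_superdiagonal[OF inj X s id] show ?thesis by (simp add: newton_Suc field_simps)
  qed
  moreover have "i \<noteq> 0 \<Longrightarrow> \<phi> i * ?t (i - 1) i = ?t i i * (\<phi> i / (\<theta> i - \<theta> (i - 1)))"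
  proof -
    assume i0: "i \<noteq> 0"
    then have "\<theta> i \<noteq> \<theta> (i - 1)" using inj_on_grid_neq[OF inj, of i "i - 1"] i by auto
    then show ?thesis by (subst poly_newton_pred[OF i0]) simp
  qed
  ultimately have "?t i i * X i i = ?t i i * (\<theta>s i + (if i = 0 then 0 else \<phi> i / (\<theta> i - \<theta> (i - 1)))
    - (if i < d then \<phi> (i + 1) / (\<theta> (i + 1) - \<theta> i) else 0))"
    by (cases "i < d"; cases "i = 0") (auto simp: algebra_simps)
  with nz show ?thesis by simp
qed

text \<open>The diagonal entry at \<open>n\<close> determines \<open>\<phi> (n + 1)\<close> from
  \<open>\<phi> n\<close>. The off-diagonal entries of \<open>X\<close> and \<open>Y\<close> may
  differ, as they do for differently scaled eigenbases.\<close>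

lemma split_form_unique:
  assumes inj: "inj_on \<theta> {..d}" and X: "tridiagonal d X" "tridiagonal d Y"
    and s: "split_form d \<theta> \<theta>s \<phi> X" "split_form d \<theta> \<theta>s \<phi>' Y"
    and diag: "\<And>i. i \<le> d \<Longrightarrow> X i i = Y i i" and n: "1 \<le> n" "n \<le> d"
  shows "\<phi> n = \<phi>' n"
proof -
  have "n \<noteq> 0 \<Longrightarrow> n \<le> d \<Longrightarrow> \<phi> n = \<phi>' n" for n
  proof (induction n)
    case (Suc n)
    have "\<theta> (n + 1) \<noteq> \<theta> n" using inj_onD[OF inj, of "n + 1" n] Suc.prems by auto
    with split_form_diagonal[OF inj X(1) s(1), of n] split_form_diagonal[OF inj X(2) s(2), of n]
      diag[of n] Suc show ?case by (cases "n = 0") auto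
  qed simp
  with n show ?thesis by simp
qed

section \<open>Degree-preserving tridiagonal operators\<close>

text \<open>The condition is put on powers rather than on Newton polynomials because it then ignores
  the order of the grid: the reversed operator qualifies too, and a single \<open>X\<close> has both
  a first and a second split form.\<close>

locale tridiagonal_grid =
  fixes d :: nat and \<theta> \<theta>s :: "nat \<Rightarrow> 'f::field" and X :: "nat \<Rightarrow> nat \<Rightarrow> 'f"
  assumes inj: "inj_on \<theta> {..d}"
    and tri: "tridiagonal d X"
    and preserve: "n \<le> d \<Longrightarrow> \<exists>g. degree g \<le> n \<and> coeff g n = \<theta>s n \<and>
      (\<forall>i\<le>d. (\<Sum>j\<le>d. X i j * \<theta> j ^ n) = poly g (\<theta> i))"
begin

lemma preserve_degree:
  assumes "n \<le> d" "degree f \<le> n"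
  shows "\<exists>g. degree g \<le> n \<and> coeff g n = \<theta>s n * coeff f n \<and>
    (\<forall>i\<le>d. (\<Sum>j\<le>d. X i j * poly f (\<theta> j)) = poly g (\<theta> i))"
  using assms
proof (induction n arbitrary: f)
  case 0
  then obtain a where f: "f = [:a:]" by (auto elim: degree_eq_zeroE)
  obtain g where g: "degree g \<le> 0" "coeff g 0 = \<theta>s 0"
    "\<forall>i\<le>d. (\<Sum>j\<le>d. X i j * \<theta> j ^ 0) = poly g (\<theta> i)" using preserve[of 0] by blast
  have "(\<Sum>j\<le>d. X i j * poly f (\<theta> j)) = a * (\<Sum>j\<le>d. X i j * \<theta> j ^ 0)" for i
    by (simp add: f sum_distrib_left mult.commute)
  with g show ?case by (intro exI[of _ "Polynomial.smult a g"]) (simp add: f)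
next
  case (Suc n)
  define a where "a = coeff f (Suc n)"
  define h where "h = f - monom a (Suc n)"
  have "degree h \<le> Suc n"
    unfolding h_def by (rule degree_diff_le) (use Suc.prems in \<open>auto simp: degree_monom_le\<close>)
  moreover have "coeff h (Suc n) = 0" by (simp add: h_def a_def)
  ultimately have "degree h \<le> n"
    by (metis eq_zero_or_degree_less less_Suc_eq_le degree_0 le0)
  with Suc obtain g where g: "degree g \<le> n"
    "\<And>i. i \<le> d \<Longrightarrow> (\<Sum>j\<le>d. X i j * poly h (\<theta> j)) = poly g (\<theta> i)" by fastforce
  obtain k where k: "degree k \<le> Suc n" "coeff k (Suc n) = \<theta>s (Suc n)"
    "\<And>i. i \<le> d \<Longrightarrow> (\<Sum>j\<le>d. X i j * \<theta> j ^ Suc n) = poly k (\<theta> i)" using preserve[of "Suc n"] Suc.prems by blast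
  have "(\<Sum>j\<le>d. X i j * poly f (\<theta> j)) = poly (g + Polynomial.smult a k) (\<theta> i)" if "i \<le> d" for i
  proof -
    have "(\<Sum>j\<le>d. X i j * poly f (\<theta> j)) = (\<Sum>j\<le>d. X i j * poly h (\<theta> j) + a * (X i j * \<theta> j ^ Suc n))"
      by (rule sum.cong) (auto simp: h_def poly_monom algebra_simps)
    also have "\<dots> = poly (g + Polynomial.smult a k) (\<theta> i)"
      by (simp only: sum.distrib sum_distrib_left[symmetric] g(2)[OF that] k(3)[OF that]) simp
    finally show ?thesis .
  qed
  moreover have "degree (g + Polynomial.smult a k) \<le> Suc n"
    using g(1) k(1) by (intro degree_add_le) (auto intro: order_trans[OF degree_smult_le])
  moreover have "coeff g (Suc n) = 0" using g(1) by (intro coeff_eq_0) simp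
  ultimately show ?case using k(2)
    by (intro exI[of _ "g + Polynomial.smult a k"]) (simp add: a_def mult.commute)
qed

lemma reflect: "tridiagonal_grid d (\<lambda>i. \<theta> (d - i)) \<theta>s (\<lambda>i j. X (d - i) (d - j))"
proof
  show "inj_on (\<lambda>i. \<theta> (d - i)) {..d}" by (rule inj_on_reflect[OF inj])
  show "tridiagonal d (\<lambda>i j. X (d - i) (d - j))"
    using tri unfolding tridiagonal_def by auto
  fix n assume "n \<le> d"
  from preserve[OF this] obtain g where g: "degree g \<le> n" "coeff g n = \<theta>s n"
    "\<forall>i\<le>d. (\<Sum>j\<le>d. X i j * \<theta> j ^ n) = poly g (\<theta> i)" by blast
  then show "\<exists>g. degree g \<le> n \<and> coeff g n = \<theta>s n \<and>
    (\<forall>i\<le>d. (\<Sum>j\<le>d. X (d - i) (d - j) * \<theta> (d - j) ^ n) = poly g (\<theta> (d - i)))"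
    by (intro exI[of _ g]) (simp add: sum_reflect[of "\<lambda>j. X (d - _) j * \<theta> j ^ n"])
qed

text \<open>\<open>X\<close> maps the Newton polynomial of degree \<open>n\<close> to a polynomial of degree at most \<open>n\<close> which, by
  tridiagonality, still vanishes at the first \<open>n - 1\<close> grid points.\<close>

lemma split_form_exists: "\<exists>\<phi>. split_form d \<theta> \<theta>s \<phi> X"
proof -
  let ?t = "newton \<theta>"
  have "\<exists>c. \<forall>i\<le>d. (\<Sum>j\<le>d. X i j * poly (?t n) (\<theta> j)) = \<theta>s n * poly (?t n) (\<theta> i)
      + (if n = 0 then 0 else c * poly (?t (n - 1)) (\<theta> i))" if n: "n \<le> d" for n
  proof -
    obtain g where g: "degree g \<le> n" "coeff g n = \<theta>s n"
      "\<And>i. i \<le> d \<Longrightarrow> (\<Sum>j\<le>d. X i j * poly (?t n) (\<theta> j)) = poly g (\<theta> i)"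
      using preserve_degree[OF n, of "?t n"] by auto
    show ?thesis
    proof (cases n)
      case 0
      with g(1) obtain a where "g = [:a:]" by (auto elim: degree_eq_zeroE)
      with 0 g(2,3) show ?thesis by simp
    next
      case (Suc m)
      define h where "h = g - Polynomial.smult (\<theta>s n) (?t n)"
      have "degree h \<le> n" unfolding h_def
        by (rule degree_diff_le) (use g(1) in \<open>auto intro: order_trans[OF degree_smult_le]\<close>)
      moreover have "coeff h n = 0" by (simp add: h_def g(2))
      ultimately have dh: "degree h \<le> m" using Suc by (metis eq_zero_or_degree_less less_Suc_eq_le degree_0 le0)
      \<comment> \<open>With both leading terms removed, \<open>k\<close> is zero or of degree below
        \<open>m\<close>, while the \<open>m\<close> points
        \<open>\<theta> 0, ..., \<theta> (m - 1)\<close> remain zeros.\<close>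
      define k where "k = h - Polynomial.smult (coeff h m) (?t m)"
      have dk: "degree k \<le> m" unfolding k_def
        by (rule degree_diff_le) (use dh in \<open>auto intro: order_trans[OF degree_smult_le]\<close>)
      have ck: "coeff k m = 0" by (simp add: k_def)
      have "k = 0"
      proof (rule ccontr)
        assume k0: "k \<noteq> 0"
        then have dk': "degree k < m" using dk ck by (metis eq_zero_or_degree_less)
        have "poly k (\<theta> i) = 0" if i: "i < m" for i
        proof -
          have id: "i \<le> d" using i n Suc by simp
          have z: "\<And>j. j \<le> i + 1 \<Longrightarrow> poly (?t n) (\<theta> j) = 0"
            using poly_newton_eq_0_iff[OF inj] i n Suc by auto
          then have "poly g (\<theta> i) = 0"
            using g(3)[OF id] tridiagonal_row_sum[OF tri id, of "\<lambda>j. poly (?t n) (\<theta> j)"]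
            by (cases "i = 0"; cases "i < d") auto
          then have "poly h (\<theta> i) = 0" using z[of i] by (simp add: h_def)
          then show ?thesis using poly_newton_eq_0_iff[OF inj, of i m] i n Suc by (simp add: k_def)
        qed
        then have "\<theta> ` {..<m} \<subseteq> {x. poly k x = 0}" by auto
        then have "card (\<theta> ` {..<m}) \<le> card {x. poly k x = 0}"
          using poly_roots_finite[OF k0] by (rule card_mono[rotated])
        moreover have "{..<m} \<subseteq> {..d}" using n Suc by auto
        then have "card (\<theta> ` {..<m}) = m" using card_image[OF inj_on_subset[OF inj]] by simp
        ultimately show False using card_poly_roots_bound[OF k0] dk' by simp
      qed
      then have "g = Polynomial.smult (\<theta>s n) (?t n) + Polynomial.smult (coeff h m) (?t m)"
        by (simp add: k_def h_def algebra_simps)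
      with g(3) Suc show ?thesis by (intro exI[of _ "coeff h m"]) simp
    qed
  qed
  then have "\<exists>\<phi>. \<forall>n\<le>d. \<forall>i\<le>d. (\<Sum>j\<le>d. X i j * poly (?t n) (\<theta> j)) = \<theta>s n * poly (?t n) (\<theta> i)
      + (if n = 0 then 0 else \<phi> n * poly (?t (n - 1)) (\<theta> i))"
    by (intro choice) blast
  then show ?thesis unfolding split_form_def by blast
qed

text \<open>Row 0 of \<open>X\<close> is determined by the images of \<open>1\<close> and
  \<open>x - \<theta> 0\<close>, that is, by \<open>\<theta>s 0\<close> and \<open>\<phi> 1\<close>.
  At \<open>\<theta> 0\<close> the split form of the reversed grid then has \<open>\<psi> n\<close>
  as its only unknown, and \<open>newton_difference_quotient\<close> evaluates the rest.\<close>

lemma second_split_formula: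
  assumes rec: "recurrent d \<beta> \<theta>" and \<phi>: "split_form d \<theta> \<theta>s \<phi> X"
    and \<psi>: "split_form d (\<lambda>i. \<theta> (d - i)) \<theta>s \<psi> (\<lambda>i j. X (d - i) (d - j))"
    and n: "1 \<le> n" "n \<le> d"
  shows "\<psi> n = \<phi> 1 * (antisym_sum d \<theta> n / (\<theta> 0 - \<theta> d)) + (\<theta>s n - \<theta>s 0) * (\<theta> (d - n + 1) - \<theta> 0)"
proof -
  let ?e = "\<lambda>n i. poly (newton (\<lambda>i. \<theta> (d - i)) n) (\<theta> i)"
  have row: "(\<Sum>j\<le>d. X 0 j * f j) = X 0 0 * f 0 + X 0 1 * f 1" for f
    using tridiagonal_row_sum[OF tri, of 0 f] n by simp
  have b: "X 0 1 * (\<theta> 1 - \<theta> 0) = \<phi> 1"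
    using split_form_superdiagonal[OF inj tri \<phi>, of 0] n by (simp add: newton_Suc)
  have "(\<Sum>j\<le>d. X 0 j) = \<theta>s 0"
    using \<phi>[unfolded split_form_def, rule_format, of 0 0] by simp
  then have a: "X 0 0 = \<theta>s 0 - X 0 1" using row[of "\<lambda>_. 1"] by (simp add: eq_diff_eq)
  \<comment> \<open>The point \<open>\<theta> 0\<close> has index \<open>d\<close> in the reversed
    grid.\<close>
  have "(\<Sum>j\<le>d. X 0 (d - j) * ?e n (d - j)) = \<theta>s n * ?e n 0 + \<psi> n * ?e (n - 1) 0"
    using \<psi>[unfolded split_form_def, rule_format, of d n] n by simp
  then have "X 0 0 * ?e n 0 + X 0 1 * ?e n 1 = \<theta>s n * ?e n 0 + \<psi> n * ?e (n - 1) 0"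
    using sum_reflect[of "\<lambda>j. X 0 j * ?e n j" d] row by simp
  then have 1: "\<psi> n * ?e (n - 1) 0 = (\<theta>s 0 - \<theta>s n) * ?e n 0 + X 0 1 * (?e n 1 - ?e n 0)"
    unfolding a by (simp add: algebra_simps)
  have t: "\<theta> 0 - \<theta> d \<noteq> 0" "\<theta> 1 - \<theta> 0 \<noteq> 0"
    using inj_onD[OF inj, of 0 d] inj_onD[OF inj, of 1 0] n by auto
  have "?e n 1 - ?e n 0 = (\<theta> 1 - \<theta> 0) * ?e (n - 1) 0 * antisym_sum d \<theta> n / (\<theta> 0 - \<theta> d)"
    using newton_difference_quotient[OF inj rec n] t by (simp add: eq_divide_eq)
  then have 2: "X 0 1 * (?e n 1 - ?e n 0) = \<phi> 1 * ?e (n - 1) 0 * (antisym_sum d \<theta> n / (\<theta> 0 - \<theta> d))"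
    using b by (simp add: mult.assoc[symmetric])
  have "d - (n - 1) = d - n + 1" using n by simp
  then have 3: "?e n 0 = ?e (n - 1) 0 * (\<theta> 0 - \<theta> (d - n + 1))"
    using poly_newton_pred[of n "\<lambda>i. \<theta> (d - i)" "\<theta> 0"] n by (metis not_one_le_zero)
  have nz: "?e (n - 1) 0 \<noteq> 0"
    using poly_newton_eq_0_iff[OF inj_on_reflect[OF inj], of d "n - 1"] n by simp
  have "?e (n - 1) 0 * \<psi> n = ?e (n - 1) 0 *
      (\<phi> 1 * (antisym_sum d \<theta> n / (\<theta> 0 - \<theta> d)) + (\<theta>s n - \<theta>s 0) * (\<theta> (d - n + 1) - \<theta> 0))"
    using 1[unfolded 2] unfolding 3 by (simp add: algebra_simps)
  with nz show ?thesis by simp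
qed

end

section \<open>Necessity of condition (v)\<close>

definition common_ratio :: "nat \<Rightarrow> (nat \<Rightarrow> 'f::field) \<Rightarrow> 'f \<Rightarrow> bool" where
  "common_ratio d \<theta> \<gamma> \<longleftrightarrow> (\<forall>i\<in>{2..d-1}. (\<theta> (i - 2) - \<theta> (i + 1)) / (\<theta> (i - 1) - \<theta> i) = \<gamma>)"

text \<open>With denominators cleared, the ratio condition says that \<open>\<theta> (m + 2) +
  \<theta> m - (\<gamma> - 1) * \<theta> (m + 1)\<close> does not depend on \<open>m\<close>; hence
  the shift from \<gamma> to \<open>\<gamma> - 1\<close>.\<close>

lemma recurrent_if_common_ratio:
  assumes inj: "inj_on \<theta> {..d}" and r: "common_ratio d \<theta> \<gamma>"
  shows "recurrent d (\<gamma> - 1) \<theta>"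
proof -
  let ?\<beta> = "\<gamma> - 1"
  let ?c = "\<theta> 2 + \<theta> 0 - ?\<beta> * \<theta> 1"
  have "m + 2 \<le> d \<Longrightarrow> \<theta> (m + 2) + \<theta> m = ?\<beta> * \<theta> (m + 1) + ?c" for m
  proof (induction m)
    case 0
    then show ?case by (simp add: numeral_2_eq_2)
  next
    case (Suc m)
    have "\<theta> (m + 1) \<noteq> \<theta> (m + 2)"
      using Suc.prems by (intro inj_on_grid_neq[OF inj]) auto
    moreover have "(\<theta> m - \<theta> (m + 3)) / (\<theta> (m + 1) - \<theta> (m + 2)) = \<gamma>"
      using r[unfolded common_ratio_def, rule_format, of "m + 2"] Suc.prems by (simp add: numeral_3_eq_3)
    ultimately have step: "\<theta> m - \<theta> (m + 3) = \<gamma> * (\<theta> (m + 1) - \<theta> (m + 2))" by (simp add: divide_eq_eq)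
    have IH: "\<theta> (m + 2) + \<theta> m = ?\<beta> * \<theta> (m + 1) + ?c" using Suc by simp
    have "\<theta> (m + 3) + \<theta> (m + 1)
        = (\<theta> (m + 2) + \<theta> m) - (\<theta> m - \<theta> (m + 3)) - \<theta> (m + 2) + \<theta> (m + 1)" by simp
    also have "\<dots> = ?\<beta> * \<theta> (m + 2) + ?c" unfolding IH step by (simp add: algebra_simps)
    finally show ?case by (simp add: numeral_3_eq_3)
  qed
  then show ?thesis unfolding recurrent_def by blast
qed

lemma coeff_mult_degree_le:
  fixes p q :: "'f::comm_semiring_0 poly"
  assumes "degree p \<le> m" "degree q \<le> n"
  shows "coeff (p * q) (m + n) = coeff p m * coeff q n"
proof -
  have "(\<Sum>i\<le>m + n. coeff p i * coeff q (m + n - i)) = (\<Sum>i\<in>{m}. coeff p i * coeff q (m + n - i))"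
  proof (rule sum.mono_neutral_right)
    show "\<forall>i\<in>{..m + n} - {m}. coeff p i * coeff q (m + n - i) = 0"
    proof
      fix i assume "i \<in> {..m + n} - {m}"
      then have "degree p < i \<or> degree q < m + n - i" using assms by auto
      then show "coeff p i * coeff q (m + n - i) = 0" by (auto simp: coeff_eq_0)
    qed
  qed auto
  then show ?thesis by (simp add: coeff_mult)
qed

context tridiagonal_grid
begin

text \<open>Writing \<open>A\<close> for multiplication by the grid point, tridiagonality makes
  \<open>A\<^sup>2 X A - A X A\<^sup>2\<close> a commutator \<open>[p(A), X]\<close>, where \<open>p\<close> interpolates the values \<open>z\<close> below.
  Applied to powers, a comparison of degrees bounds the degree of \<open>p\<close> by 3, and the leading
  coefficients give the recurrence of \<open>\<theta>s\<close>; that of \<open>\<theta>\<close> comes from the values of \<open>p\<close>.\<close>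

lemma cubic_commutator:
  obtains p where "degree p \<le> d"
    and "\<And>i. i < d \<Longrightarrow> poly p (\<theta> i) - poly p (\<theta> (i + 1)) = \<theta> i * \<theta> (i + 1) * (\<theta> i - \<theta> (i + 1))"
    and "\<And>i f. i \<le> d \<Longrightarrow>
      \<theta> i ^ 2 * (\<Sum>j\<le>d. X i j * poly (monom 1 1 * f) (\<theta> j)) - \<theta> i * (\<Sum>j\<le>d. X i j * poly (monom 1 2 * f) (\<theta> j))
      = poly p (\<theta> i) * (\<Sum>j\<le>d. X i j * poly f (\<theta> j)) - (\<Sum>j\<le>d. X i j * poly (p * f) (\<theta> j))"
proof -
  \<comment> \<open>The factor
    \<open>\<theta> i ^ 2 * \<theta> j - \<theta> i * \<theta> j ^ 2\<close> is antisymmetric in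
    \<open>i\<close> and \<open>j\<close>, so one function can have it as its difference on both
    off-diagonals. \<open>w\<close> is the required jump and \<open>z\<close> its antiderivative,
    normalized to 0 at the first point.\<close>
  define w where "w i = \<theta> i * \<theta> (i + 1) * (\<theta> i - \<theta> (i + 1))" for i
  define z where "z i = - (\<Sum>h<i. w h)" for i
  obtain p where p: "degree p \<le> d" "\<And>i. i \<le> d \<Longrightarrow> poly p (\<theta> i) = z i"
    using grid_interpolation[OF inj, of d z] by auto
  have diff: "poly p (\<theta> i) - poly p (\<theta> (i + 1)) = w i" if "i < d" for i
    using that p(2) by (simp add: z_def)
  have entry: "X i j * (\<theta> i ^ 2 * \<theta> j - \<theta> i * \<theta> j ^ 2) = X i j * (poly p (\<theta> i) - poly p (\<theta> j))"
    if ij: "i \<le> d" "j \<le> d" for i j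
  proof -
    consider "1 < \<bar>int i - int j\<bar>" | "i = j" | "j = i + 1" | "i = j + 1" by linarith
    then show ?thesis
    proof cases
      case 1
      with tri ij show ?thesis by (simp add: tridiagonal_def)
    next
      case 3
      with diff[of i] ij have "poly p (\<theta> i) - poly p (\<theta> j) = w i" by simp
      with 3 show ?thesis by (simp only:) (simp add: w_def algebra_simps power2_eq_square)
    next
      case 4
      with diff[of j] ij have "poly p (\<theta> i) - poly p (\<theta> j) = - w j" by (simp add: algebra_simps)
      with 4 show ?thesis by (simp only:) (simp add: w_def algebra_simps power2_eq_square)
    qed (simp add: algebra_simps power2_eq_square)
  qed
  have "\<theta> i ^ 2 * (\<Sum>j\<le>d. X i j * poly (monom 1 1 * f) (\<theta> j)) - \<theta> i * (\<Sum>j\<le>d. X i j * poly (monom 1 2 * f) (\<theta> j))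
      = poly p (\<theta> i) * (\<Sum>j\<le>d. X i j * poly f (\<theta> j)) - (\<Sum>j\<le>d. X i j * poly (p * f) (\<theta> j))"
    if i: "i \<le> d" for i f
  proof -
    have "\<theta> i ^ 2 * (\<Sum>j\<le>d. X i j * poly (monom 1 1 * f) (\<theta> j)) - \<theta> i * (\<Sum>j\<le>d. X i j * poly (monom 1 2 * f) (\<theta> j))
        = (\<Sum>j\<le>d. X i j * (\<theta> i ^ 2 * \<theta> j - \<theta> i * \<theta> j ^ 2) * poly f (\<theta> j))"
      unfolding sum_distrib_left sum_subtractf[symmetric]
      by (rule sum.cong) (auto simp: poly_monom algebra_simps)
    also have "\<dots> = (\<Sum>j\<le>d. X i j * (poly p (\<theta> i) - poly p (\<theta> j)) * poly f (\<theta> j))"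
      using i entry by (intro sum.cong) auto
    also have "\<dots> = poly p (\<theta> i) * (\<Sum>j\<le>d. X i j * poly f (\<theta> j)) - (\<Sum>j\<le>d. X i j * poly (p * f) (\<theta> j))"
      unfolding sum_distrib_left sum_subtractf[symmetric]
      by (rule sum.cong) (auto simp: algebra_simps)
    finally show ?thesis .
  qed
  with p(1) diff show ?thesis by (intro that) (auto simp: w_def)
qed

lemma monom_mult_on_grid:
  assumes "n \<le> d"
  obtains g where "degree g \<le> n" "coeff g n = \<theta>s n"
    "\<And>i. i \<le> d \<Longrightarrow> (\<Sum>j\<le>d. X i j * poly (monom 1 n) (\<theta> j)) = poly g (\<theta> i)"
  using preserve_degree[OF assms, of "monom 1 n"] by (auto simp: degree_monom_eq)

lemma common_ratio:
  assumes injs: "inj_on \<theta>s {..d}"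
  shows "\<exists>\<gamma>. common_ratio d \<theta> \<gamma> \<and> common_ratio d \<theta>s \<gamma>"
proof (cases "3 \<le> d")
  case False
  then have "common_ratio d \<theta> 0" "common_ratio d \<theta>s 0" by (auto simp: common_ratio_def)
  then show ?thesis by blast
next
  case d: True
  obtain p where dp: "degree p \<le> d"
    and p: "\<And>i. i < d \<Longrightarrow> poly p (\<theta> i) - poly p (\<theta> (i + 1)) = \<theta> i * \<theta> (i + 1) * (\<theta> i - \<theta> (i + 1))"
    and com: "\<And>i f. i \<le> d \<Longrightarrow>
      \<theta> i ^ 2 * (\<Sum>j\<le>d. X i j * poly (monom 1 1 * f) (\<theta> j)) - \<theta> i * (\<Sum>j\<le>d. X i j * poly (monom 1 2 * f) (\<theta> j))
      = poly p (\<theta> i) * (\<Sum>j\<le>d. X i j * poly f (\<theta> j)) - (\<Sum>j\<le>d. X i j * poly (p * f) (\<theta> j))"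
    by (rule cubic_commutator) blast
  \<comment> \<open>The commutator applied to \<open>x ^ k\<close>, read as an identity of
    polynomials: both sides have degree at most \<open>d\<close>, so the \<open>d + 1\<close> grid
    points decide. Here \<open>m\<close> is any bound on the degree of \<open>p\<close>.\<close>
  have ident: "\<exists>g\<^sub>0 g\<^sub>1 g\<^sub>2 g. degree g\<^sub>0 \<le> k \<and> coeff g\<^sub>0 k = \<theta>s k \<and> degree g\<^sub>1 \<le> k + 1 \<and> coeff g\<^sub>1 (k + 1) = \<theta>s (k + 1)
      \<and> degree g\<^sub>2 \<le> k + 2 \<and> coeff g\<^sub>2 (k + 2) = \<theta>s (k + 2)
      \<and> degree g \<le> k + m \<and> coeff g (k + m) = \<theta>s (k + m) * coeff p m
      \<and> monom 1 2 * g\<^sub>1 - monom 1 1 * g\<^sub>2 = p * g\<^sub>0 - g"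
    if k: "k + 3 \<le> d" "k + m \<le> d" "degree p \<le> m" for k m
  proof -
    obtain g\<^sub>0 where g0: "degree g\<^sub>0 \<le> k" "coeff g\<^sub>0 k = \<theta>s k"
      "\<And>i. i \<le> d \<Longrightarrow> (\<Sum>j\<le>d. X i j * poly (monom 1 k) (\<theta> j)) = poly g\<^sub>0 (\<theta> i)"
      by (rule monom_mult_on_grid[of k]) (use k in auto)
    obtain g\<^sub>1 where g1: "degree g\<^sub>1 \<le> k + 1" "coeff g\<^sub>1 (k + 1) = \<theta>s (k + 1)"
      "\<And>i. i \<le> d \<Longrightarrow> (\<Sum>j\<le>d. X i j * poly (monom 1 (k + 1)) (\<theta> j)) = poly g\<^sub>1 (\<theta> i)"
      by (rule monom_mult_on_grid[of "k + 1"]) (use k in auto)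
    obtain g\<^sub>2 where g2: "degree g\<^sub>2 \<le> k + 2" "coeff g\<^sub>2 (k + 2) = \<theta>s (k + 2)"
      "\<And>i. i \<le> d \<Longrightarrow> (\<Sum>j\<le>d. X i j * poly (monom 1 (k + 2)) (\<theta> j)) = poly g\<^sub>2 (\<theta> i)"
      by (rule monom_mult_on_grid[of "k + 2"]) (use k in auto)
    have dpk: "degree (p * monom 1 k) \<le> k + m"
      using degree_mult_le[of p "monom 1 k"] k by (simp add: degree_monom_eq)
    have cpk: "coeff (p * monom 1 k) (k + m) = coeff p m"
      by (subst mult.commute) (simp add: coeff_monom_mult)
    obtain g where g: "degree g \<le> k + m" "coeff g (k + m) = \<theta>s (k + m) * coeff p m"
      "\<And>i. i \<le> d \<Longrightarrow> (\<Sum>j\<le>d. X i j * poly (p * monom 1 k) (\<theta> j)) = poly g (\<theta> i)"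
      using preserve_degree[OF k(2) dpk] unfolding cpk by blast
    have mm: "monom 1 1 * monom 1 k = monom (1 :: 'f) (k + 1)" "monom 1 2 * monom 1 k = monom (1 :: 'f) (k + 2)"
      by (simp_all add: mult_monom add.commute)
    have ev: "poly (monom 1 2 * g\<^sub>1 - monom 1 1 * g\<^sub>2) (\<theta> i) = poly (p * g\<^sub>0 - g) (\<theta> i)" if "i \<le> d" for i
      using com[OF that, of "monom 1 k"] unfolding mm g0(3)[OF that] g1(3)[OF that] g2(3)[OF that] g(3)[OF that]
      by (simp add: poly_monom)
    have d0: "degree (p * g\<^sub>0) \<le> d"
      using degree_mult_le[of p "g\<^sub>0"] k g0(1) by linarith
    have d1: "degree (monom 1 2 * g\<^sub>1) \<le> d"
      using degree_mult_le[of "monom 1 2" "g\<^sub>1"] k g1(1) by (simp add: degree_monom_eq)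
    have d2: "degree (monom 1 1 * g\<^sub>2) \<le> d"
      using degree_mult_le[of "monom 1 1" "g\<^sub>2"] k g2(1) by (simp add: degree_monom_eq)
    have "monom 1 2 * g\<^sub>1 - monom 1 1 * g\<^sub>2 = p * g\<^sub>0 - g"
      by (rule poly_eq_on_grid[OF inj]) (use d0 d1 d2 g(1) k ev in \<open>auto intro!: degree_diff_le\<close>)
    with g0(1,2) g1(1,2) g2(1,2) g(1,2) show ?thesis
      by (intro exI[of _ "g\<^sub>0"] exI[of _ "g\<^sub>1"] exI[of _ "g\<^sub>2"] exI[of _ g] conjI)
  qed
  have p3: "degree p \<le> 3"
  proof (rule ccontr)
    assume "\<not> degree p \<le> 3"
    then have m: "3 < degree p" by simp
    \<comment> \<open>For \<open>k = 0\<close> the left side has degree at most 3, whereas the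
      coefficient of the right side at \<open>degree p\<close> is
      \<open>(\<theta>s 0 - \<theta>s (degree p)) * lead_coeff p\<close>.\<close>
    from ident[of 0 "degree p", unfolded add_0, OF d dp order_refl] obtain g\<^sub>0 g\<^sub>1 g\<^sub>2 g where
      g: "degree g\<^sub>0 \<le> 0" "coeff g\<^sub>0 0 = \<theta>s 0" "degree g\<^sub>1 \<le> 1" "degree g\<^sub>2 \<le> 2"
      "coeff g (degree p) = \<theta>s (degree p) * lead_coeff p"
      "monom 1 2 * g\<^sub>1 - monom 1 1 * g\<^sub>2 = p * g\<^sub>0 - g" by blast
    obtain a where a: "g\<^sub>0 = [:a:]" using g(1) by (auto elim: degree_eq_zeroE)
    have "coeff (monom 1 2 * g\<^sub>1 - monom 1 1 * g\<^sub>2) (degree p) = 0"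
      using m g(3,4) by (simp add: coeff_monom_mult coeff_eq_0)
    then have "coeff (p * g\<^sub>0 - g) (degree p) = 0" unfolding g(6) .
    then have "\<theta>s 0 * lead_coeff p = \<theta>s (degree p) * lead_coeff p"
      using g(2,5) by (simp add: a)
    moreover have "\<theta>s 0 \<noteq> \<theta>s (degree p)" using inj_on_grid_neq[OF injs, of 0 "degree p"] dp m by auto
    moreover have "p \<noteq> 0" using m by auto
    ultimately show False by simp
  qed
  \<comment> \<open>This is the inverse of the common ratio. The relations are kept in the form
    multiplied by \<alpha> until \<alpha> is known to be nonzero.\<close>
  define \<alpha> where "\<alpha> = coeff p 3"
  \<comment> \<open>Comparison of coefficients at degree \<open>k + 3\<close>, the top degree on
    both sides.\<close>
  have dual: "\<theta>s (k + 1) - \<theta>s (k + 2) = \<alpha> * (\<theta>s k - \<theta>s (k + 3))" if k: "k + 3 \<le> d" for k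
  proof -
    from ident[OF k k p3] obtain g\<^sub>0 g\<^sub>1 g\<^sub>2 g where
      g: "degree g\<^sub>0 \<le> k" "coeff g\<^sub>0 k = \<theta>s k" "coeff g\<^sub>1 (k + 1) = \<theta>s (k + 1)" "coeff g\<^sub>2 (k + 2) = \<theta>s (k + 2)"
      "coeff g (k + 3) = \<theta>s (k + 3) * coeff p 3"
      "monom 1 2 * g\<^sub>1 - monom 1 1 * g\<^sub>2 = p * g\<^sub>0 - g" by blast
    have "coeff (monom 1 2 * g\<^sub>1 - monom 1 1 * g\<^sub>2) (k + 3) = \<theta>s (k + 1) - \<theta>s (k + 2)"
      using g(3,4) by (simp add: coeff_monom_mult numeral_3_eq_3 numeral_2_eq_2)
    moreover have "coeff (p * g\<^sub>0) (3 + k) = coeff p 3 * coeff g\<^sub>0 k"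
      using p3 g(1) by (rule coeff_mult_degree_le)
    moreover have "coeff (p * g\<^sub>0 - g) (k + 3) = \<theta>s (k + 1) - \<theta>s (k + 2)"
      using \<open>coeff (monom 1 2 * g\<^sub>1 - monom 1 1 * g\<^sub>2) (k + 3) = _\<close> unfolding g(6) .
    ultimately show ?thesis using g(2,5)
      by (simp only: coeff_diff add.commute[of 3 k] \<alpha>_def right_diff_distrib mult.commute[of _ "coeff p 3"])
  qed
  have primal: "\<theta> (k + 1) - \<theta> (k + 2) = \<alpha> * (\<theta> k - \<theta> (k + 3))" if k: "k + 3 \<le> d" for k
  proof -
    \<comment> \<open>The first divided difference of the cubic \<open>p\<close>. The second one,
      taken in \<open>node\<close>, is affine in the grid points, and subtracting two consecutive
      instances removes its constant.\<close>
    have chord: "\<theta> i * \<theta> (i + 1) = coeff p 1 + coeff p 2 * (\<theta> i + \<theta> (i + 1))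
        + \<alpha> * (\<theta> i ^ 2 + \<theta> i * \<theta> (i + 1) + \<theta> (i + 1) ^ 2)" if "i < d" for i
    proof -
      have ev: "poly p x = coeff p 0 + coeff p 1 * x + coeff p 2 * x ^ 2 + \<alpha> * x ^ 3" for x
      proof -
        have "poly p x = (\<Sum>i\<le>3. coeff p i * x ^ i)"
          unfolding poly_altdef using p3 by (intro sum.mono_neutral_left) (auto simp: coeff_eq_0)
        then show ?thesis by (simp add: \<alpha>_def numeral_3_eq_3 numeral_2_eq_2)
      qed
      have "(\<theta> i - \<theta> (i + 1)) * (coeff p 1
          + coeff p 2 * (\<theta> i + \<theta> (i + 1)) + \<alpha> * (\<theta> i ^ 2 + \<theta> i * \<theta> (i + 1) + \<theta> (i + 1) ^ 2))
          = poly p (\<theta> i) - poly p (\<theta> (i + 1))"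
        unfolding ev by (simp add: algebra_simps power2_eq_square power3_eq_cube)
      also have "\<dots> = (\<theta> i - \<theta> (i + 1)) * (\<theta> i * \<theta> (i + 1))"
        using p[OF that] by (simp only: mult.commute)
      finally show ?thesis
        using inj_on_grid_neq[OF inj, of i "i + 1"] that by (simp only: mult_cancel_left) auto
    qed
    have node: "\<theta> (i + 1) = coeff p 2 + \<alpha> * (\<theta> i + \<theta> (i + 1) + \<theta> (i + 2))" if "i + 2 \<le> d" for i
    proof -
      have i: "i + 1 + 1 = i + 2" by simp
      have "(\<theta> (i + 2) - \<theta> i) * \<theta> (i + 1) = \<theta> (i + 1) * \<theta> (i + 2) - \<theta> i * \<theta> (i + 1)"
        by (simp add: algebra_simps)
      also have "\<dots> = (coeff p 1 + coeff p 2 * (\<theta> (i + 1) + \<theta> (i + 2))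
            + \<alpha> * (\<theta> (i + 1) ^ 2 + \<theta> (i + 1) * \<theta> (i + 2) + \<theta> (i + 2) ^ 2))
          - (coeff p 1 + coeff p 2 * (\<theta> i + \<theta> (i + 1)) + \<alpha> * (\<theta> i ^ 2 + \<theta> i * \<theta> (i + 1) + \<theta> (i + 1) ^ 2))"
        using chord[of i] chord[of "i + 1", unfolded i] that by simp
      also have "\<dots> = (\<theta> (i + 2) - \<theta> i) * (coeff p 2 + \<alpha> * (\<theta> i + \<theta> (i + 1) + \<theta> (i + 2)))"
        by (simp add: algebra_simps power2_eq_square)
      finally have "(\<theta> (i + 2) - \<theta> i) * \<theta> (i + 1)
          = (\<theta> (i + 2) - \<theta> i) * (coeff p 2 + \<alpha> * (\<theta> i + \<theta> (i + 1) + \<theta> (i + 2)))" .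
      then show ?thesis
        using inj_on_grid_neq[OF inj, of "i + 2" i] that by (simp only: mult_cancel_left) auto
    qed
    have i: "k + 1 + 1 = k + 2" "k + 1 + 2 = k + 3" by auto
    have "\<theta> (k + 1) - \<theta> (k + 2) = (coeff p 2 + \<alpha> * (\<theta> k + \<theta> (k + 1) + \<theta> (k + 2)))
        - (coeff p 2 + \<alpha> * (\<theta> (k + 1) + \<theta> (k + 2) + \<theta> (k + 3)))"
      using node[of k] node[of "k + 1", unfolded i] k by simp
    then show ?thesis by (simp add: algebra_simps)
  qed
  have \<alpha>: "\<alpha> \<noteq> 0"
    using dual[of 0, unfolded add_0, OF d] inj_on_grid_neq[OF injs, of 1 2] d by auto
  have ratio: "common_ratio d x (1 / \<alpha>)"
    if x: "\<And>k. k + 3 \<le> d \<Longrightarrow> x (k + 1) - x (k + 2) = \<alpha> * (x k - x (k + 3))" and ix: "inj_on x {..d}" for x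
    unfolding common_ratio_def
  proof
    fix i assume i: "i \<in> {2..d - 1}"
    define k where "k = i - 2"
    have k: "k + 3 \<le> d" "i - 2 = k" "i - 1 = k + 1" "i = k + 2" "i + 1 = k + 3" using i d by (auto simp: k_def)
    have "x k - x (k + 3) \<noteq> 0" using inj_on_grid_neq[OF ix, of k "k + 3"] k(1) by simp
    moreover have "(x (i - 2) - x (i + 1)) / (x (i - 1) - x i) = (x k - x (k + 3)) / (\<alpha> * (x k - x (k + 3)))"
      unfolding k(2) k(3) k(5) unfolding k(4) x[OF k(1)] ..
    ultimately show "(x (i - 2) - x (i + 1)) / (x (i - 1) - x i) = 1 / \<alpha>" using \<alpha> by simp
  qed
  show ?thesis using ratio[OF primal inj] ratio[OF dual injs] by blast
qed

end

section \<open>Formula (iii) by reversal of the grid\<close>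

lemma recurrent_reflect:
  assumes "recurrent d \<beta> x"
  shows "recurrent d \<beta> (\<lambda>i. x (d - i))"
proof -
  obtain c where c: "\<And>m. m + 2 \<le> d \<Longrightarrow> x (m + 2) + x m = \<beta> * x (m + 1) + c"
    using assms by (auto simp: recurrent_def)
  have "x (d - (m + 2)) + x (d - m) = \<beta> * x (d - (m + 1)) + c" if m: "m + 2 \<le> d" for m
  proof -
    have i: "d - (m + 2) + 2 = d - m" "d - (m + 2) + 1 = d - (m + 1)" using m by auto
    show ?thesis using c[of "d - (m + 2)", unfolded i] m by (simp add: add.commute)
  qed
  then show ?thesis unfolding recurrent_def by blast
qed

lemma antisym_sum_negate:
  assumes "n \<le> d + 1"
  shows "antisym_sum d (\<lambda>i. \<theta> (d - i)) n = - antisym_sum d \<theta> n"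
  unfolding antisym_sum_def sum_negf[symmetric] by (rule sum.cong) (use assms in auto)

text \<open>\<open>d - (d - i)\<close> equals \<open>i\<close> only for \<open>i \<le> d\<close>, so
  the grid reversed twice agrees with the original one merely on the relevant indices.\<close>

lemma split_form_reflect_twice:
  assumes "split_form d \<theta> \<theta>s \<phi> X"
  shows "split_form d (\<lambda>i. \<theta> (d - (d - i))) \<theta>s \<phi> (\<lambda>i j. X (d - (d - i)) (d - (d - j)))"
proof -
  have "newton (\<lambda>i. \<theta> (d - (d - i))) n = newton \<theta> n" if "n \<le> d" for n
    unfolding newton_def by (rule prod.cong) (use that in auto)
  with assms show ?thesis unfolding split_form_def by simp
qed

text \<open>Reversal of the grid exchanges \<phi> and \<psi>; numerator and denominator of the sum
  both change sign.\<close>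

lemma (in tridiagonal_grid) first_split_formula:
  assumes rec: "recurrent d \<beta> \<theta>" and \<phi>: "split_form d \<theta> \<theta>s \<phi> X"
    and \<psi>: "split_form d (\<lambda>i. \<theta> (d - i)) \<theta>s \<psi> (\<lambda>i j. X (d - i) (d - j))"
    and n: "1 \<le> n" "n \<le> d"
  shows "\<phi> n = \<psi> 1 * (antisym_sum d \<theta> n / (\<theta> 0 - \<theta> d)) + (\<theta>s n - \<theta>s 0) * (\<theta> (n - 1) - \<theta> d)"
proof -
  interpret R: tridiagonal_grid d "\<lambda>i. \<theta> (d - i)" \<theta>s "\<lambda>i j. X (d - i) (d - j)" by (rule reflect)
  have "d - (d - n + 1) = n - 1" using n by simp
  moreover have "- antisym_sum d \<theta> n / (\<theta> d - \<theta> 0) = antisym_sum d \<theta> n / (\<theta> 0 - \<theta> d)"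
    by (metis minus_diff_eq minus_divide_divide)
  ultimately show ?thesis
    using R.second_split_formula[OF recurrent_reflect[OF rec] \<psi> split_form_reflect_twice[OF \<phi>] n] n
    by (simp add: antisym_sum_negate)
qed

section \<open>Construction of the operator from its parameters\<close>

text \<open>A Vandermonde system. \<open>w\<^sub>1\<close> and \<open>w\<^sub>2\<close> are moments
  weighted by the distance to \<open>y\<close>, which eliminates the middle node and leaves a system
  in the two outer ones.\<close>

lemma quadrature_three_nodes:
  fixes x y z :: "'f::field"
  assumes "x \<noteq> y" "y \<noteq> z" "x \<noteq> z"
  shows "\<exists>c a b. c + a + b = v\<^sub>0 \<and> c * x + a * y + b * z = v\<^sub>1 \<and> c * x ^ 2 + a * y ^ 2 + b * z ^ 2 = v\<^sub>2"
proof -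
  define w\<^sub>1 w\<^sub>2 where w: "w\<^sub>1 = v\<^sub>1 - y * v\<^sub>0" "w\<^sub>2 = v\<^sub>2 - y * v\<^sub>1"
  define B where "B = (w\<^sub>2 - x * w\<^sub>1) / (z - x)"
  define C where "C = w\<^sub>1 - B"
  define b c where bc: "b = B / (z - y)" "c = C / (x - y)"
  define a where "a = v\<^sub>0 - c - b"
  have b: "b * (z - y) = B" and c: "c * (x - y) = C" using assms by (auto simp: bc)
  have "B * (z - x) = w\<^sub>2 - x * w\<^sub>1" using assms by (auto simp: B_def)
  then have CB: "C + B = w\<^sub>1" "x * C + z * B = w\<^sub>2" by (simp_all add: C_def algebra_simps)
  have "c * x + a * y + b * z = y * v\<^sub>0 + (c * (x - y) + b * (z - y))"
    by (simp add: a_def algebra_simps)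
  then have 1: "c * x + a * y + b * z = v\<^sub>1" unfolding b c CB by (simp add: w)
  have "c * x ^ 2 + a * y ^ 2 + b * z ^ 2 = y * (c * x + a * y + b * z) + (x * (c * (x - y)) + z * (b * (z - y)))"
    by (simp add: algebra_simps power2_eq_square)
  then have 2: "c * x ^ 2 + a * y ^ 2 + b * z ^ 2 = v\<^sub>2" unfolding b c CB 1 by (simp add: w)
  have "c + a + b = v\<^sub>0" by (simp add: a_def)
  with 1 2 show ?thesis by blast
qed

text \<open>Neighbouring grid points are the roots of a quadratic whose coefficients are polynomials in the
  middle point. Hence the moments of a tridiagonal row satisfy a three-term recurrence with
  polynomial coefficients, and polynomiality of the first three moments propagates to all of them.\<close>

lemma tridiagonal_grid_if_moments:
  fixes \<theta> \<theta>s :: "nat \<Rightarrow> 'f::field"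
  assumes inj: "inj_on \<theta> {..d}" and tri: "tridiagonal d X"
    and rec: "recurrent d \<beta> \<theta>" and recs: "recurrent d \<beta> \<theta>s"
    and moments: "\<And>n. n \<le> 2 \<Longrightarrow> n \<le> d \<Longrightarrow> \<exists>g. degree g \<le> n \<and> coeff g n = \<theta>s n \<and>
      (\<forall>i\<le>d. (\<Sum>j\<le>d. X i j * \<theta> j ^ n) = poly g (\<theta> i))"
  shows "tridiagonal_grid d \<theta> \<theta>s X"
proof
  obtain \<gamma> where \<gamma>: "\<And>m. m + 2 \<le> d \<Longrightarrow> \<theta> (m + 2) + \<theta> m = \<beta> * \<theta> (m + 1) + \<gamma>"
    using rec by (auto simp: recurrent_def)
  obtain c where c: "\<And>m. m + 2 \<le> d \<Longrightarrow> \<theta>s (m + 2) + \<theta>s m = \<beta> * \<theta>s (m + 1) + c"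
    using recs by (auto simp: recurrent_def)
  \<comment> \<open>An invariant of the recurrence: \<open>P\<close> takes the same value \<rho> at
    all pairs of neighbours. So \<open>P (\<theta> i) y - \<rho>\<close> is the quadratic in
    \<open>y\<close> that vanishes at the neighbours of \<open>\<theta> i\<close>.\<close>
  define P where "P x y = x ^ 2 + y ^ 2 - \<beta> * x * y - \<gamma> * (x + y)" for x y
  define \<rho> where "\<rho> = P (\<theta> 0) (\<theta> 1)"
  have P_sym: "P x y = P y x" for x y by (simp add: P_def algebra_simps)
  have P_next: "i < d \<Longrightarrow> P (\<theta> i) (\<theta> (i + 1)) = \<rho>" for i
  proof (induction i)
    case (Suc i)
    have "P (\<theta> (i + 1)) (\<theta> (i + 2)) - P (\<theta> i) (\<theta> (i + 1))
        = (\<theta> (i + 2) - \<theta> i) * (\<theta> (i + 2) + \<theta> i - (\<beta> * \<theta> (i + 1) + \<gamma>))"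
      by (simp add: P_def algebra_simps power2_eq_square)
    also have "\<dots> = 0" using \<gamma>[of i] Suc.prems by simp
    finally show ?case using Suc by simp
  qed (simp add: \<rho>_def)
  \<comment> \<open>Weighting a row by this quadratic kills its off-diagonal entries.\<close>
  have weighted: "(\<Sum>j\<le>d. X i j * (P (\<theta> i) (\<theta> j) - \<rho>) * \<theta> j ^ n)
      = X i i * (P (\<theta> i) (\<theta> i) - \<rho>) * \<theta> i ^ n" if i: "i \<le> d" for i n
  proof -
    have "X i j * (P (\<theta> i) (\<theta> j) - \<rho>) * \<theta> j ^ n = 0" if j: "j \<le> d" "j \<noteq> i" for j
    proof -
      consider "1 < \<bar>int i - int j\<bar>" | "j = i + 1" | "i = j + 1" using j by linarith
      then show ?thesis
      proof cases
        case 1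
        with tri i j show ?thesis by (simp add: tridiagonal_def)
      next
        case 2
        with P_next[of i] j show ?thesis by simp
      next
        case 3
        with P_next[of j] P_sym[of "\<theta> i"] i show ?thesis by simp
      qed
    qed
    then have "(\<Sum>j\<le>d. X i j * (P (\<theta> i) (\<theta> j) - \<rho>) * \<theta> j ^ n)
        = (\<Sum>j\<in>{i}. X i j * (P (\<theta> i) (\<theta> j) - \<rho>) * \<theta> j ^ n)"
      using i by (intro sum.mono_neutral_right) auto
    then show ?thesis by simp
  qed
  define M where "M n i = (\<Sum>j\<le>d. X i j * \<theta> j ^ n)" for n i
  have M_rec: "M (n + 2) i = (\<beta> * \<theta> i + \<gamma>) * M (n + 1) i - (\<theta> i ^ 2 - \<gamma> * \<theta> i - \<rho>) * M n i
      + X i i * (P (\<theta> i) (\<theta> i) - \<rho>) * \<theta> i ^ n" if i: "i \<le> d" for n i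
  proof -
    have "M (n + 2) i - (\<beta> * \<theta> i + \<gamma>) * M (n + 1) i + (\<theta> i ^ 2 - \<gamma> * \<theta> i - \<rho>) * M n i
        = (\<Sum>j\<le>d. X i j * (P (\<theta> i) (\<theta> j) - \<rho>) * \<theta> j ^ n)"
      unfolding M_def sum_distrib_left sum_subtractf[symmetric] sum.distrib[symmetric]
      by (rule sum.cong) (auto simp: P_def algebra_simps power2_eq_square)
    also have "\<dots> = X i i * (P (\<theta> i) (\<theta> i) - \<rho>) * \<theta> i ^ n" by (rule weighted[OF i])
    finally show ?thesis by (simp add: algebra_simps)
  qed
  fix n
  show "n \<le> d \<Longrightarrow> \<exists>g. degree g \<le> n \<and> coeff g n = \<theta>s n \<and>
    (\<forall>i\<le>d. (\<Sum>j\<le>d. X i j * \<theta> j ^ n) = poly g (\<theta> i))"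
  proof (induction n rule: less_induct)
    case (less n)
    show ?case
    proof (cases "n \<le> 2")
      case True
      with moments less.prems show ?thesis by blast
    next
      case False
      define m where "m = n - 2"
      have n: "n = m + 2" using False by (simp add: m_def)
      define A where "A = [:\<gamma>, \<beta>:]"
      define B where "B = [:- \<rho>, - \<gamma>, 1:]"
      have moment: "\<exists>g. degree g \<le> k \<and> coeff g k = \<theta>s k \<and> (\<forall>i\<le>d. M k i = poly g (\<theta> i))" if "k < n" for k
        unfolding M_def using less.IH[OF that] less.prems that by simp
      obtain G\<^sub>0 where G0: "degree G\<^sub>0 \<le> 0" "coeff G\<^sub>0 0 = \<theta>s 0" "\<And>i. i \<le> d \<Longrightarrow> M 0 i = poly G\<^sub>0 (\<theta> i)"
        using moment[of 0] False by auto
      obtain G\<^sub>1 where G1: "degree G\<^sub>1 \<le> 1" "coeff G\<^sub>1 1 = \<theta>s 1" "\<And>i. i \<le> d \<Longrightarrow> M 1 i = poly G\<^sub>1 (\<theta> i)"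
        using moment[of 1] False by auto
      obtain G\<^sub>2 where G2: "degree G\<^sub>2 \<le> 2" "coeff G\<^sub>2 2 = \<theta>s 2" "\<And>i. i \<le> d \<Longrightarrow> M 2 i = poly G\<^sub>2 (\<theta> i)"
        using moment[of 2] False by auto
      obtain g\<^sub>0 where g0: "degree g\<^sub>0 \<le> m" "coeff g\<^sub>0 m = \<theta>s m" "\<And>i. i \<le> d \<Longrightarrow> M m i = poly g\<^sub>0 (\<theta> i)"
        using moment[of m] n by auto
      obtain g\<^sub>1 where g1: "degree g\<^sub>1 \<le> m + 1" "coeff g\<^sub>1 (m + 1) = \<theta>s (m + 1)"
          "\<And>i. i \<le> d \<Longrightarrow> M (m + 1) i = poly g\<^sub>1 (\<theta> i)"
        using moment[of "m + 1"] n by auto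
      \<comment> \<open>At exponent 0 the recurrence of the moments expresses the diagonal term
        \<open>X i i * (P (\<theta> i) (\<theta> i) - \<rho>)\<close> by the first three moments,
        hence as a polynomial of degree at most 2 in \<open>\<theta> i\<close>.\<close>
      define Q where "Q = G\<^sub>2 - A * G\<^sub>1 + B * G\<^sub>0"
      have dA: "degree A \<le> 1" and dB: "degree B \<le> 2" by (auto simp: A_def B_def)
      have cA: "coeff A 1 = \<beta>" and cB: "coeff B 2 = 1" by (auto simp: A_def B_def numeral_2_eq_2)
      have Q: "X i i * (P (\<theta> i) (\<theta> i) - \<rho>) = poly Q (\<theta> i)" if i: "i \<le> d" for i
        using M_rec[OF i, of 0, unfolded add_0] unfolding G0(3)[OF i] G1(3)[OF i] G2(3)[OF i]
        by (simp add: Q_def A_def B_def algebra_simps power2_eq_square)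
      have "degree (A * G\<^sub>1) \<le> 2" using degree_mult_le[of A "G\<^sub>1"] dA G1(1) by linarith
      moreover have "degree (B * G\<^sub>0) \<le> 2" using degree_mult_le[of B "G\<^sub>0"] dB G0(1) by linarith
      ultimately have dQ: "degree Q \<le> 2"
        unfolding Q_def using G2(1) by (intro degree_add_le degree_diff_le) auto
      have "coeff (A * G\<^sub>1) (1 + 1) = \<beta> * \<theta>s 1" "coeff (B * G\<^sub>0) (2 + 0) = \<theta>s 0"
        using coeff_mult_degree_le[OF dA G1(1)] coeff_mult_degree_le[OF dB G0(1)] cA cB G1(2) G0(2) by simp_all
      then have "coeff Q 2 = \<theta>s 2 - \<beta> * \<theta>s 1 + \<theta>s 0"
        using G2(2) unfolding Q_def coeff_add coeff_diff by (simp add: numeral_2_eq_2)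
      \<comment> \<open>The top coefficient of \<open>Q\<close> is the constant in the recurrence of
        \<theta>s. Because \<theta> and \<theta>s share \<beta>, the leading coefficients of all
        further moments follow that same recurrence.\<close>
      then have cQ: "coeff Q 2 = c" using c[of 0] less.prems n by (simp add: numeral_2_eq_2 algebra_simps)
      define g where "g = A * g\<^sub>1 - B * g\<^sub>0 + Q * monom 1 m"
      have d1: "degree (A * g\<^sub>1) \<le> n" using degree_mult_le[of A "g\<^sub>1"] dA g1(1) n by linarith
      have d2: "degree (B * g\<^sub>0) \<le> n" using degree_mult_le[of B "g\<^sub>0"] dB g0(1) n by linarith
      have d3: "degree (Q * monom 1 m) \<le> n"
        using degree_mult_le[of Q "monom 1 m"] dQ n by (simp add: degree_monom_eq)
      have "degree g \<le> n" unfolding g_def using d1 d2 d3 by (intro degree_add_le degree_diff_le) auto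
      moreover have "coeff g n = \<theta>s n"
      proof -
        have "coeff (A * g\<^sub>1) (1 + (m + 1)) = \<beta> * \<theta>s (m + 1)"
          "coeff (B * g\<^sub>0) (2 + m) = \<theta>s m" "coeff (Q * monom 1 m) (2 + m) = c"
          using coeff_mult_degree_le[OF dA g1(1)] coeff_mult_degree_le[OF dB g0(1)]
            coeff_mult_degree_le[OF dQ degree_monom_le[of 1 m]] cA cB cQ g0(2) g1(2) by simp_all
        moreover have "1 + (m + 1) = n" "2 + m = n" using n by auto
        ultimately have "coeff g n = \<beta> * \<theta>s (m + 1) - \<theta>s m + c" by (simp add: g_def)
        moreover have "\<theta>s n = \<beta> * \<theta>s (m + 1) + c - \<theta>s m"
          using c[of m] less.prems n by (simp add: eq_diff_eq)
        ultimately show ?thesis by simp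
      qed
      moreover have "M n i = poly g (\<theta> i)" if i: "i \<le> d" for i
        unfolding n M_rec[OF i] Q[OF i] g0(3)[OF i] g1(3)[OF i] g_def
        by (simp add: A_def B_def poly_monom algebra_simps power2_eq_square)
      ultimately show ?thesis unfolding M_def by blast
    qed
  qed
qed (rule inj tri)+

lemma tridiagonal_grid_exists:
  fixes \<theta> \<theta>s \<phi> \<psi> :: "nat \<Rightarrow> 'f::field"
  assumes inj: "inj_on \<theta> {..d}" and rec: "recurrent d \<beta> \<theta>" and recs: "recurrent d \<beta> \<theta>s"
    and \<phi>: "\<And>n. 1 \<le> n \<Longrightarrow> n \<le> d \<Longrightarrow>
      \<phi> n = \<psi> 1 * (antisym_sum d \<theta> n / (\<theta> 0 - \<theta> d)) + (\<theta>s n - \<theta>s 0) * (\<theta> (n - 1) - \<theta> d)"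
    and \<psi>: "\<And>n. 1 \<le> n \<Longrightarrow> n \<le> d \<Longrightarrow>
      \<psi> n = \<phi> 1 * (antisym_sum d \<theta> n / (\<theta> 0 - \<theta> d)) + (\<theta>s n - \<theta>s 0) * (\<theta> (d - n + 1) - \<theta> 0)"
  obtains X where "tridiagonal_grid d \<theta> \<theta>s X" "split_form d \<theta> \<theta>s \<phi> X"
    "split_form d (\<lambda>i. \<theta> (d - i)) \<theta>s \<psi> (\<lambda>i j. X (d - i) (d - j))"
proof -
  \<comment> \<open>The images of \<open>1\<close>, \<open>x\<close>, \<open>x ^ 2\<close> dictated
    by the split form, where \<open>x ^ 2 = newton \<theta> 2 + (\<theta> 0 + \<theta> 1) * x -
    \<theta> 0 * \<theta> 1\<close>. For \<open>d < 2\<close> some of the parameters in them are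
    arbitrary values, but moments above \<open>d\<close> are never asked for.\<close>
  define G\<^sub>0 G\<^sub>1 where "G\<^sub>0 = [:\<theta>s 0:]" and "G\<^sub>1 = [:\<theta>s 0 * \<theta> 0 - \<theta>s 1 * \<theta> 0 + \<phi> 1, \<theta>s 1:]"
  define G\<^sub>2 where "G\<^sub>2 = Polynomial.smult (\<theta>s 2) (newton \<theta> 2) + Polynomial.smult (\<phi> 2) (newton \<theta> 1)
    + Polynomial.smult (\<theta> 0 + \<theta> 1) G\<^sub>1 - Polynomial.smult (\<theta> 0 * \<theta> 1) G\<^sub>0"
  define G where "G n = (if n = 0 then G\<^sub>0 else if n = 1 then G\<^sub>1 else G\<^sub>2)" for n :: nat
  have G: "degree (G n) \<le> n \<and> coeff (G n) n = \<theta>s n" if "n \<le> 2" for n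
  proof -
    have "degree G\<^sub>1 \<le> 1" by (simp add: G\<^sub>1_def)
    moreover have "degree G\<^sub>2 \<le> 2" unfolding G\<^sub>2_def
      by (intro degree_add_le degree_diff_le)
        (auto simp: G\<^sub>0_def G\<^sub>1_def intro!: order_trans[OF degree_smult_le])
    moreover have "coeff (newton \<theta> (Suc 0)) 2 = 0" by (rule coeff_eq_0) simp
    then have "coeff G\<^sub>2 2 = \<theta>s 2" by (simp add: G\<^sub>2_def G\<^sub>0_def G\<^sub>1_def numeral_2_eq_2)
    moreover have "n = 0 \<or> n = 1 \<or> n = 2" using that by auto
    ultimately show ?thesis by (auto simp: G_def G\<^sub>0_def G\<^sub>1_def)
  qed
  have G_eval: "poly (G 0) x = \<theta>s 0" "poly (G 1) x = \<theta>s 0 * \<theta> 0 + \<theta>s 1 * (x - \<theta> 0) + \<phi> 1"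
    "poly (G 2) x = \<theta>s 2 * (x - \<theta> 0) * (x - \<theta> 1) + \<phi> 2 * (x - \<theta> 0)
      + (\<theta> 0 + \<theta> 1) * (\<theta>s 0 * \<theta> 0 + \<theta>s 1 * (x - \<theta> 0) + \<phi> 1) - \<theta> 0 * \<theta> 1 * \<theta>s 0" for x
    by (simp_all add: G_def G\<^sub>0_def G\<^sub>1_def G\<^sub>2_def poly_newton numeral_2_eq_2 algebra_simps)
  \<comment> \<open>\<open>c\<close>, \<open>a\<close>, \<open>b\<close> are the entries left of, on
    and right of the diagonal. A missing entry of an end row is forced to be zero, so the values
    \<open>\<theta> (0 - 1)\<close> and \<open>\<theta> (d + 1)\<close> do no harm.\<close>
  define R where "R i c a b \<longleftrightarrow> (i = 0 \<longrightarrow> c = 0) \<and> (i = d \<longrightarrow> b = 0) \<and>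
      (\<forall>n\<le>2. n \<le> d \<longrightarrow> c * \<theta> (i - 1) ^ n + a * \<theta> i ^ n + b * \<theta> (i + 1) ^ n = poly (G n) (\<theta> i))" for i c a b
  have row: "\<exists>c a b. R i c a b"
    if i: "i \<le> d" for i
  proof -
    have n012: "(\<forall>n\<le>2. n \<le> d \<longrightarrow> R n) \<longleftrightarrow> R 0 \<and> (1 \<le> d \<longrightarrow> R 1) \<and> (2 \<le> d \<longrightarrow> R 2)" for R :: "nat \<Rightarrow> bool"
      by (auto simp: le_Suc_eq numeral_2_eq_2)
    consider "i = 0" | "i = d" "d \<noteq> 0" | "0 < i" "i < d" using i by linarith
    then show ?thesis
    proof cases
      case 1
      show ?thesis
      proof (cases "d = 0")
        case True
        with 1 have "R i 0 (\<theta>s 0) 0" unfolding R_def n012 G_eval(1) by simp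
        then show ?thesis by blast
      next
        case False
        \<comment> \<open>Forced by moments 0 and 1. Moment 2 then holds because
          \<open>newton \<theta> 2\<close> vanishes at both points that this row sees, and
          \<open>newton \<theta> 1\<close> at \<open>\<theta> 0\<close>.\<close>
        define b where "b = \<phi> 1 / (\<theta> 1 - \<theta> 0)"
        have b: "\<phi> 1 = b * (\<theta> 1 - \<theta> 0)" using inj_on_grid_neq[OF inj, of 1 0] False by (simp add: b_def)
        have "R i 0 (\<theta>s 0 - b) b"
          unfolding R_def n012 G_eval b using 1 False by (simp add: algebra_simps power2_eq_square)
        then show ?thesis by blast
      qed
    next
      case 2
      \<comment> \<open>The mirror image of \<open>b\<close>: the second split form prescribes
        \<open>\<psi> 1\<close> at \<open>\<theta> d\<close>. Moments 1 and 2 then hold by (iii) for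
        \<open>i = 1\<close> and \<open>i = 2\<close>.\<close>
      define c where "c = \<psi> 1 / (\<theta> (d - 1) - \<theta> d)"
      have c: "c * (\<theta> (d - 1) - \<theta> d) = \<psi> 1"
        using inj_on_grid_neq[OF inj, of "d - 1" d] 2 by (simp add: c_def)
      have t: "\<theta> 0 - \<theta> d \<noteq> 0" using inj_on_grid_neq[OF inj, of 0 d] 2 by simp
      have \<phi>1: "\<phi> 1 = \<psi> 1 + (\<theta>s 1 - \<theta>s 0) * (\<theta> 0 - \<theta> d)"
        using \<phi>[of 1] 2 t by (simp add: antisym_sum_def)
      have m1: "c * \<theta> (d - 1) + (\<theta>s 0 - c) * \<theta> d = poly (G 1) (\<theta> d)"
      proof -
        have "c * \<theta> (d - 1) + (\<theta>s 0 - c) * \<theta> d = c * (\<theta> (d - 1) - \<theta> d) + \<theta>s 0 * \<theta> d"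
          by (simp add: algebra_simps)
        then show ?thesis unfolding c G_eval \<phi>1 by (simp add: algebra_simps)
      qed
      have m2: "c * \<theta> (d - 1) ^ 2 + (\<theta>s 0 - c) * \<theta> d ^ 2 = poly (G 2) (\<theta> d)" if d2: "2 \<le> d"
      proof -
        have S: "antisym_sum d \<theta> 2 = \<theta> 0 - \<theta> d + (\<theta> 1 - \<theta> (d - 1))"
          by (simp add: antisym_sum_def numeral_2_eq_2)
        have \<phi>2: "\<phi> 2 * (\<theta> d - \<theta> 0) = \<psi> 1 * (\<theta> d - \<theta> 0 + \<theta> (d - 1) - \<theta> 1)
            + (\<theta>s 2 - \<theta>s 0) * (\<theta> 1 - \<theta> d) * (\<theta> d - \<theta> 0)"
        proof -
          have "\<phi> 2 * (\<theta> 0 - \<theta> d) = \<psi> 1 * antisym_sum d \<theta> 2 + (\<theta>s 2 - \<theta>s 0) * (\<theta> 1 - \<theta> d) * (\<theta> 0 - \<theta> d)"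
            using \<phi>[of 2] d2 t by (simp add: distrib_right)
          then have "- (\<phi> 2 * (\<theta> 0 - \<theta> d))
              = - (\<psi> 1 * antisym_sum d \<theta> 2 + (\<theta>s 2 - \<theta>s 0) * (\<theta> 1 - \<theta> d) * (\<theta> 0 - \<theta> d))" by (rule arg_cong)
          then show ?thesis unfolding S by (simp add: algebra_simps)
        qed
        have "c * \<theta> (d - 1) ^ 2 + (\<theta>s 0 - c) * \<theta> d ^ 2
            = c * (\<theta> (d - 1) - \<theta> d) * (\<theta> (d - 1) + \<theta> d) + \<theta>s 0 * \<theta> d ^ 2"
          by (simp add: algebra_simps power2_eq_square)
        then show ?thesis unfolding c G_eval \<phi>2 \<phi>1 by (simp add: algebra_simps power2_eq_square)
      qed
      have "R i c (\<theta>s 0 - c) 0" unfolding R_def n012 G_eval(1) using 2 m1 m2 by simp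
      then show ?thesis by blast
    next
      case 3
      have "\<theta> (i - 1) \<noteq> \<theta> i" "\<theta> i \<noteq> \<theta> (i + 1)" "\<theta> (i - 1) \<noteq> \<theta> (i + 1)"
        by (rule inj_on_grid_neq[OF inj]; use 3 in simp)+
      from quadrature_three_nodes[OF this, of "poly (G 0) (\<theta> i)" "poly (G 1) (\<theta> i)" "poly (G 2) (\<theta> i)"]
      obtain c a b where "c + a + b = poly (G 0) (\<theta> i)"
        "c * \<theta> (i - 1) + a * \<theta> i + b * \<theta> (i + 1) = poly (G 1) (\<theta> i)"
        "c * \<theta> (i - 1) ^ 2 + a * \<theta> i ^ 2 + b * \<theta> (i + 1) ^ 2 = poly (G 2) (\<theta> i)" by blast
      with 3 have "R i c a b" unfolding R_def n012 by simp
      then show ?thesis by blast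
    qed
  qed
  then have "\<forall>i\<in>{..d}. \<exists>c a b. R i c a b" by simp
  from bchoice[OF this] obtain c where "\<forall>i\<in>{..d}. \<exists>a b. R i (c i) a b" by blast
  from bchoice[OF this] obtain a where "\<forall>i\<in>{..d}. \<exists>b. R i (c i) (a i) b" by blast
  from bchoice[OF this] obtain b where R: "\<forall>i\<in>{..d}. R i (c i) (a i) (b i)" by blast
  define X where "X i j = (if j = i then a i else if j = i + 1 then b i else if i = j + 1 then c i else 0)" for i j :: nat
  have tri: "tridiagonal d X" by (auto simp: tridiagonal_def X_def)
  have moment: "(\<Sum>j\<le>d. X i j * \<theta> j ^ n) = poly (G n) (\<theta> i)" if "i \<le> d" "n \<le> 2" "n \<le> d" for i n
  proof -
    have Ri: "R i (c i) (a i) (b i)" using R that by simp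
    have X: "X i i = a i" "X i (i + 1) = b i" "i \<noteq> 0 \<Longrightarrow> X i (i - 1) = c i" by (auto simp: X_def)
    have bc: "i = 0 \<Longrightarrow> c i = 0" "\<not> i < d \<Longrightarrow> b i = 0" using Ri that(1) by (auto simp: R_def)
    have "(if i = 0 then 0 else X i (i - 1) * \<theta> (i - 1) ^ n) = c i * \<theta> (i - 1) ^ n"
      using X(3) bc(1) by simp
    moreover have "(if i < d then b i * \<theta> (i + 1) ^ n else 0) = b i * \<theta> (i + 1) ^ n"
      using bc(2) by simp
    ultimately have "(\<Sum>j\<le>d. X i j * \<theta> j ^ n) = c i * \<theta> (i - 1) ^ n + a i * \<theta> i ^ n + b i * \<theta> (i + 1) ^ n"
      unfolding tridiagonal_row_sum[OF tri that(1)] X(1,2) by (simp only:)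
    also have "\<dots> = poly (G n) (\<theta> i)" using Ri that unfolding R_def by blast
    finally show ?thesis .
  qed
  interpret tridiagonal_grid d \<theta> \<theta>s X
    by (rule tridiagonal_grid_if_moments[OF inj tri rec recs]) (use G moment in blast)
  interpret R: tridiagonal_grid d "\<lambda>i. \<theta> (d - i)" \<theta>s "\<lambda>i j. X (d - i) (d - j)" by (rule reflect)
  obtain \<phi>' where \<phi>': "split_form d \<theta> \<theta>s \<phi>' X" using split_form_exists by blast
  obtain \<psi>' where \<psi>': "split_form d (\<lambda>i. \<theta> (d - i)) \<theta>s \<psi>' (\<lambda>i j. X (d - i) (d - j))"
    using R.split_form_exists by blast
  have linear: "(\<Sum>j\<le>d. X 0 j * (\<theta> j - t)) = poly (G 1) (\<theta> 0) - t * \<theta>s 0" if "1 \<le> d" for t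
  proof -
    have "(\<Sum>j\<le>d. X 0 j * (\<theta> j - t)) = (\<Sum>j\<le>d. X 0 j * \<theta> j ^ 1) - t * (\<Sum>j\<le>d. X 0 j * \<theta> j ^ 0)"
      by (simp add: sum_distrib_left sum_subtractf algebra_simps)
    also have "\<dots> = poly (G 1) (\<theta> 0) - t * \<theta>s 0"
      using moment[of 0 1] moment[of 0 0] that G_eval(1) by simp
    finally show ?thesis .
  qed
  \<comment> \<open>The split sequences of the constructed \<open>X\<close> are compared at index 1
    only; (iii) and (iv) determine all other terms from these.\<close>
  have \<phi>'1: "\<phi>' 1 = \<phi> 1" and \<psi>'1: "\<psi>' 1 = \<psi> 1" if d: "1 \<le> d"
  proof -
    have "(\<Sum>j\<le>d. X 0 j * (\<theta> j - \<theta> 0)) = \<phi>' 1"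
      using \<phi>'[unfolded split_form_def, rule_format, of 0 1] d by (simp add: poly_newton)
    then show "\<phi>' 1 = \<phi> 1" using linear[OF d, of "\<theta> 0"] unfolding G_eval by (simp add: algebra_simps)
    have "(\<Sum>j\<le>d. X 0 (d - j) * (\<theta> (d - j) - \<theta> d)) = \<theta>s 1 * (\<theta> 0 - \<theta> d) + \<psi>' 1"
      using \<psi>'[unfolded split_form_def, rule_format, of d 1] d by (simp add: poly_newton)
    then have "poly (G 1) (\<theta> 0) - \<theta> d * \<theta>s 0 = \<theta>s 1 * (\<theta> 0 - \<theta> d) + \<psi>' 1"
      using linear[OF d, of "\<theta> d"] sum_reflect[of "\<lambda>j. X 0 j * (\<theta> j - \<theta> d)" d] by simp
    moreover have "\<phi> 1 = \<psi> 1 + (\<theta>s 1 - \<theta>s 0) * (\<theta> 0 - \<theta> d)"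
      using \<phi>[of 1] d inj_on_grid_neq[OF inj, of 0 d] by (simp add: antisym_sum_def)
    ultimately show "\<psi>' 1 = \<psi> 1" unfolding G_eval by (simp add: algebra_simps)
  qed
  have "\<phi>' n = \<phi> n \<and> \<psi>' n = \<psi> n" if "1 \<le> n" "n \<le> d" for n
    using first_split_formula[OF rec \<phi>' \<psi>' that] second_split_formula[OF rec \<phi>' \<psi>' that]
      \<phi>[OF that] \<psi>[OF that] \<phi>'1 \<psi>'1 that by simp
  then have "split_form d \<theta> \<theta>s \<phi> X" "split_form d (\<lambda>i. \<theta> (d - i)) \<theta>s \<psi> (\<lambda>i j. X (d - i) (d - j))"
    using \<phi>' \<psi>' unfolding split_form_def by auto
  with tridiagonal_grid_axioms show ?thesis by (rule that)
qed

section \<open>Parameter conditions from the two split forms\<close>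

text \<open>Newton polynomials are monic, one of each degree, so an action that is triangular on
  them is triangular on powers, with the same diagonal \<theta>s.\<close>

lemma tridiagonal_grid_if_split_form:
  assumes inj: "inj_on \<theta> {..d}" and tri: "tridiagonal d X" and s: "split_form d \<theta> \<theta>s \<phi> X"
  shows "tridiagonal_grid d \<theta> \<theta>s X"
proof
  have image: "\<exists>g. degree g \<le> n \<and> coeff g n = \<theta>s n * coeff f n \<and>
      (\<forall>i\<le>d. (\<Sum>j\<le>d. X i j * poly f (\<theta> j)) = poly g (\<theta> i))" if "n \<le> d" "degree f \<le> n" for n f
    using that
  proof (induction n arbitrary: f)
    case 0
    then obtain a where f: "f = [:a:]" by (auto elim: degree_eq_zeroE)
    have "(\<Sum>j\<le>d. X i j * poly f (\<theta> j)) = a * \<theta>s 0" if "i \<le> d" for i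
      using s[unfolded split_form_def, rule_format, OF that, of 0]
      by (simp add: f sum_distrib_left[symmetric] mult.commute[of _ a])
    then show ?case by (intro exI[of _ "[:a * \<theta>s 0:]"]) (simp add: f mult.commute)
  next
    case (Suc n)
    define a where "a = coeff f (Suc n)"
    define t where "t = newton \<theta> (Suc n)"
    define h where "h = f - Polynomial.smult a t"
    have dt: "degree t \<le> Suc n" and ct: "coeff t (Suc n) = 1" by (auto simp: t_def)
    have "degree h \<le> Suc n" unfolding h_def
      by (rule degree_diff_le) (use Suc.prems dt in \<open>auto intro: order_trans[OF degree_smult_le]\<close>)
    moreover have "coeff h (Suc n) = 0" by (simp add: h_def a_def ct)
    ultimately have "degree h \<le> n"
      by (metis eq_zero_or_degree_less less_Suc_eq_le degree_0 le0)
    with Suc obtain g where g: "degree g \<le> n"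
      "\<And>i. i \<le> d \<Longrightarrow> (\<Sum>j\<le>d. X i j * poly h (\<theta> j)) = poly g (\<theta> i)" by fastforce
    define k where "k = g + Polynomial.smult a (Polynomial.smult (\<theta>s (Suc n)) t + Polynomial.smult (\<phi> (Suc n)) (newton \<theta> n))"
    have "(\<Sum>j\<le>d. X i j * poly f (\<theta> j)) = poly k (\<theta> i)" if i: "i \<le> d" for i
    proof -
      have "(\<Sum>j\<le>d. X i j * poly f (\<theta> j)) = (\<Sum>j\<le>d. X i j * poly h (\<theta> j)) + a * (\<Sum>j\<le>d. X i j * poly t (\<theta> j))"
        unfolding sum_distrib_left sum.distrib[symmetric]
        by (rule sum.cong) (auto simp: h_def algebra_simps)
      moreover have "(\<Sum>j\<le>d. X i j * poly t (\<theta> j)) = \<theta>s (Suc n) * poly t (\<theta> i) + \<phi> (Suc n) * poly (newton \<theta> n) (\<theta> i)"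
        using s[unfolded split_form_def, rule_format, OF i Suc.prems(1)] by (simp add: t_def)
      ultimately show ?thesis using g(2)[OF i] by (simp add: k_def)
    qed
    moreover have "degree k \<le> Suc n" unfolding k_def
      using g(1) dt by (intro degree_add_le) (auto intro!: order_trans[OF degree_smult_le] degree_add_le)
    moreover have "coeff g (Suc n) = 0" "coeff (newton \<theta> n) (Suc n) = 0"
      using g(1) by (auto intro: coeff_eq_0)
    then have "coeff k (Suc n) = \<theta>s (Suc n) * coeff f (Suc n)"
      by (simp add: k_def ct a_def)
    ultimately show ?case by blast
  qed
  show "\<exists>g. degree g \<le> n \<and> coeff g n = \<theta>s n \<and> (\<forall>i\<le>d. (\<Sum>j\<le>d. X i j * \<theta> j ^ n) = poly g (\<theta> i))"
    if "n \<le> d" for n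
    using image[OF that, of "monom 1 n"] by (simp add: degree_monom_eq poly_monom)
qed (rule inj tri)+

lemma split_form_subdiagonal_nonzero_iff:
  assumes inj: "inj_on \<theta> {..d}" and tri: "tridiagonal d X"
    and \<psi>: "split_form d (\<lambda>i. \<theta> (d - i)) \<theta>s \<psi> (\<lambda>i j. X (d - i) (d - j))" and i: "i < d"
  shows "X (i + 1) i \<noteq> 0 \<longleftrightarrow> \<psi> (d - i) \<noteq> 0"
proof -
  have "tridiagonal d (\<lambda>i j. X (d - i) (d - j))" using tri unfolding tridiagonal_def by auto
  moreover have "d - (d - (i + 1)) = i + 1" "d - (d - (i + 1) + 1) = i" "d - (i + 1) + 1 = d - i" "d - (i + 1) < d"
    using i by auto
  ultimately show ?thesis
    using split_form_superdiagonal_nonzero_iff[OF inj_on_reflect[OF inj] _ \<psi>, of "d - (i + 1)"] by simp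
qed

lemma sum_eq_antisym_sum:
  assumes "1 \<le> i"
  shows "(\<Sum>h=0..i-1. (\<theta> h - \<theta> (d - h)) / (\<theta> 0 - \<theta> d)) = antisym_sum d \<theta> i / (\<theta> 0 - \<theta> d)"
proof -
  have "{0..i - 1} = {..<i}" using assms by auto
  then show ?thesis by (simp add: antisym_sum_def sum_divide_distrib)
qed

lemma parameter_conditions_iff:
  "parameter_conditions d \<theta> \<theta>s \<phi> \<psi> \<longleftrightarrow>
     (\<forall>i. 1 \<le> i \<longrightarrow> i \<le> d \<longrightarrow> \<phi> i \<noteq> 0 \<and> \<psi> i \<noteq> 0) \<and> inj_on \<theta> {..d} \<and> inj_on \<theta>s {..d} \<and>
     (\<forall>i. 1 \<le> i \<longrightarrow> i \<le> d \<longrightarrow> \<phi> i = \<psi> 1 * (antisym_sum d \<theta> i / (\<theta> 0 - \<theta> d)) + (\<theta>s i - \<theta>s 0) * (\<theta> (i - 1) - \<theta> d)) \<and>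
     (\<forall>i. 1 \<le> i \<longrightarrow> i \<le> d \<longrightarrow> \<psi> i = \<phi> 1 * (antisym_sum d \<theta> i / (\<theta> 0 - \<theta> d)) + (\<theta>s i - \<theta>s 0) * (\<theta> (d - i + 1) - \<theta> 0)) \<and>
     (\<exists>\<gamma>. common_ratio d \<theta> \<gamma> \<and> common_ratio d \<theta>s \<gamma>)"
proof -
  have "(\<forall>i\<le>d. \<forall>j\<le>d. i \<noteq> j \<longrightarrow> \<theta> i \<noteq> \<theta> j \<and> \<theta>s i \<noteq> \<theta>s j) \<longleftrightarrow> inj_on \<theta> {..d} \<and> inj_on \<theta>s {..d}"
    unfolding inj_on_def by auto
  moreover have "(\<forall>i\<in>{1..d}. P i) \<longleftrightarrow> (\<forall>i. 1 \<le> i \<longrightarrow> i \<le> d \<longrightarrow> P i)" for P by auto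
  moreover have "(\<exists>\<gamma>. \<forall>i\<in>{2..d-1}.
        (\<theta> (i - 2) - \<theta> (i + 1)) / (\<theta> (i - 1) - \<theta> i) = \<gamma> \<and>
        (\<theta>s (i - 2) - \<theta>s (i + 1)) / (\<theta>s (i - 1) - \<theta>s i) = \<gamma>)
      \<longleftrightarrow> (\<exists>\<gamma>. common_ratio d \<theta> \<gamma> \<and> common_ratio d \<theta>s \<gamma>)"
    unfolding common_ratio_def by (rule arg_cong[of _ _ Ex]) auto
  ultimately show ?thesis
    unfolding parameter_conditions_def by (simp only: sum_eq_antisym_sum conj_assoc cong: imp_cong)
qed

text \<open>\<open>X\<close> and \<open>Y\<close> belong to the two isomorphisms and are linked only
  by their diagonals. The reversed \<open>X\<close> has a second split sequence
  \<open>\<psi>'\<close> of its own, and the diagonals identify it with \<psi>.\<close>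

theorem parameter_conditions_if_split_forms:
  assumes inj: "inj_on \<theta> {..d}" and injs: "inj_on \<theta>s {..d}"
    and tri: "tridiagonal d X" and super: "\<And>i. i < d \<Longrightarrow> X i (i + 1) \<noteq> 0" and sub: "\<And>i. i < d \<Longrightarrow> X (i + 1) i \<noteq> 0"
    and \<phi>: "split_form d \<theta> \<theta>s \<phi> X"
    and Y: "tridiagonal d Y" "split_form d (\<lambda>i. \<theta> (d - i)) \<theta>s \<psi> Y"
    and diag: "\<And>i. i \<le> d \<Longrightarrow> Y i i = X (d - i) (d - i)"
  shows "parameter_conditions d \<theta> \<theta>s \<phi> \<psi>"
proof -
  interpret tridiagonal_grid d \<theta> \<theta>s X by (rule tridiagonal_grid_if_split_form[OF inj tri \<phi>])
  interpret R: tridiagonal_grid d "\<lambda>i. \<theta> (d - i)" \<theta>s "\<lambda>i j. X (d - i) (d - j)" by (rule reflect)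
  obtain \<psi>' where \<psi>': "split_form d (\<lambda>i. \<theta> (d - i)) \<theta>s \<psi>' (\<lambda>i j. X (d - i) (d - j))"
    using R.split_form_exists by blast
  have eq: "\<psi>' n = \<psi> n" if "1 \<le> n" "n \<le> d" for n
    by (rule split_form_unique[OF R.inj R.tri Y(1) \<psi>' Y(2) _ that]) (simp add: diag)
  then have \<psi>: "split_form d (\<lambda>i. \<theta> (d - i)) \<theta>s \<psi> (\<lambda>i j. X (d - i) (d - j))"
    using \<psi>' unfolding split_form_def by auto
  obtain \<gamma> where \<gamma>: "common_ratio d \<theta> \<gamma>" "common_ratio d \<theta>s \<gamma>" using common_ratio[OF injs] by blast
  have rec: "recurrent d (\<gamma> - 1) \<theta>" by (rule recurrent_if_common_ratio[OF inj \<gamma>(1)])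
  have "\<phi> i \<noteq> 0 \<and> \<psi> i \<noteq> 0" if i: "1 \<le> i" "i \<le> d" for i
    using split_form_superdiagonal_nonzero_iff[OF inj tri \<phi>, of "i - 1"] super[of "i - 1"]
      split_form_subdiagonal_nonzero_iff[OF inj tri \<psi>, of "d - i"] sub[of "d - i"] i by auto
  with inj injs \<gamma> first_split_formula[OF rec \<phi> \<psi>] second_split_formula[OF rec \<phi> \<psi>]
  show ?thesis unfolding parameter_conditions_iff by blast
qed

text \<open>Detailed balance: only neighbours impose a condition, so \<open>k\<close> is found by
  multiplying up the ratios along the path \<open>0, ..., d\<close>.\<close>

lemma tridiagonal_symmetrizer:
  assumes tri: "tridiagonal d X" and super: "\<And>i. i < d \<Longrightarrow> X i (i + 1) \<noteq> 0" and sub: "\<And>i. i < d \<Longrightarrow> X (i + 1) i \<noteq> 0"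
  obtains k where "\<And>i. i \<le> d \<Longrightarrow> k i \<noteq> 0" "\<And>i j. i \<le> d \<Longrightarrow> j \<le> d \<Longrightarrow> k i * X i j = k j * X j i"
proof -
  define k where "k i = (\<Prod>h<i. X h (h + 1) / X (h + 1) h)" for i
  have "k i \<noteq> 0" if "i \<le> d" for i using that super sub by (auto simp: k_def)
  moreover have next_eq: "k i * X i (i + 1) = k (i + 1) * X (i + 1) i" if "i < d" for i
    using sub[OF that] by (simp add: k_def)
  have "k i * X i j = k j * X j i" if "i \<le> d" "j \<le> d" for i j
  proof -
    consider "1 < \<bar>int i - int j\<bar>" | "i = j" | "j = i + 1" | "i = j + 1" by linarith
    then show ?thesis
    proof cases
      case 1
      with tri that show ?thesis by (simp add: tridiagonal_def)
    qed (use next_eq[of i] next_eq[of j] that in simp_all)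
  qed
  ultimately show ?thesis by (rule that)
qed

section \<open>Algebra isomorphisms\<close>

locale algebra_isomorphism =
  A: assoc_algebra "class_ring :: 'f::field ring" A + B: assoc_algebra "class_ring :: 'f ring" B
  for A :: "('f::field, 'a) module" and B :: "('f, 'b) module" +
  fixes \<sigma> :: "'a \<Rightarrow> 'b"
  assumes iso: "\<sigma> \<in> algebra_iso A B"
begin

lemma ring_iso: "\<sigma> \<in> ring_iso A B"
  using iso by (simp add: algebra_iso_def)

sublocale H: ring_hom_ring A B \<sigma>
  by unfold_locales (use ring_iso in \<open>simp add: ring_iso_def\<close>)

lemma bij: "bij_betw \<sigma> (carrier A) (carrier B)"
  using ring_iso by (simp add: ring_iso_def)

lemma eq_iff: "x \<in> carrier A \<Longrightarrow> y \<in> carrier A \<Longrightarrow> \<sigma> x = \<sigma> y \<longleftrightarrow> x = y"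
  using bij by (auto simp: bij_betw_def inj_on_def)

lemma eq_zero_iff: "x \<in> carrier A \<Longrightarrow> \<sigma> x = \<zero>\<^bsub>B\<^esub> \<longleftrightarrow> x = \<zero>\<^bsub>A\<^esub>"
  using eq_iff[of x "\<zero>\<^bsub>A\<^esub>"] by simp

lemma smult: "x \<in> carrier A \<Longrightarrow> \<sigma> (c \<odot>\<^bsub>A\<^esub> x) = c \<odot>\<^bsub>B\<^esub> \<sigma> x"
  using iso by (simp add: algebra_iso_def)

lemma smult_carrier_A: "x \<in> carrier A \<Longrightarrow> c \<odot>\<^bsub>A\<^esub> x \<in> carrier A"
  using A.smult_closed[of c x] by simp

lemma smult_carrier_B: "x \<in> carrier B \<Longrightarrow> c \<odot>\<^bsub>B\<^esub> x \<in> carrier B"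
  using B.smult_closed[of c x] by simp

lemma poly_eval_closed:
  assumes x: "x \<in> carrier A"
  shows "poly_eval A p x \<in> carrier A"
  unfolding poly_eval_def by (rule A.finsum_closed) (use x smult_carrier_A in auto)

lemma poly_eval:
  assumes x: "x \<in> carrier A"
  shows "\<sigma> (poly_eval A p x) = poly_eval B p (\<sigma> x)"
proof -
  have "\<sigma> (\<Oplus>\<^bsub>A\<^esub>i\<in>{..n}. coeff p i \<odot>\<^bsub>A\<^esub> (x [^]\<^bsub>A\<^esub> i))
      = (\<Oplus>\<^bsub>B\<^esub>i\<in>{..n}. coeff p i \<odot>\<^bsub>B\<^esub> (\<sigma> x [^]\<^bsub>B\<^esub> i))" for n
  proof (induction n)
    case 0
    then show ?case using x smult_carrier_A[of "\<one>\<^bsub>A\<^esub>"] smult_carrier_B[of "\<one>\<^bsub>B\<^esub>"] by (simp add: smult)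
  next
    case (Suc n)
    have c: "(\<lambda>i. coeff p i \<odot>\<^bsub>A\<^esub> (x [^]\<^bsub>A\<^esub> i)) \<in> S \<rightarrow> carrier A"
      "(\<lambda>i. coeff p i \<odot>\<^bsub>B\<^esub> (\<sigma> x [^]\<^bsub>B\<^esub> i)) \<in> S \<rightarrow> carrier B" for S
      using x smult_carrier_A smult_carrier_B by auto
    show ?case unfolding A.finsum_Suc[OF c(1)] B.finsum_Suc[OF c(2)]
      using x smult_carrier_A[of "x [^]\<^bsub>A\<^esub> Suc n"] A.finsum_closed[OF c(1)] Suc
      by (simp add: smult H.hom_nat_pow del: A.nat_pow_Suc B.nat_pow_Suc)
  qed
  then show ?thesis by (simp add: poly_eval_def)
qed

lemma is_minimal_poly_iff:
  "x \<in> carrier A \<Longrightarrow> is_minimal_poly B (\<sigma> x) p \<longleftrightarrow> is_minimal_poly A x p"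
  by (simp add: is_minimal_poly_def poly_eval[symmetric] eq_zero_iff poly_eval_closed)

lemma eigenvalues: "x \<in> carrier A \<Longrightarrow> eigenvalues B (\<sigma> x) = eigenvalues A x"
  by (simp add: eigenvalues_def is_minimal_poly_iff)

lemma linear_factor_closed: "x \<in> carrier A \<Longrightarrow> linear_factor A x c \<mu> \<in> carrier A"
  by (simp add: linear_factor_def smult_carrier_A)

lemma linear_factor: "x \<in> carrier A \<Longrightarrow> \<sigma> (linear_factor A x c \<mu>) = linear_factor B (\<sigma> x) c \<mu>"
  by (simp add: linear_factor_def smult smult_carrier_A A.minus_eq B.minus_eq)

text \<open>The factors commute although the algebra need not, so the product is transported one
  factor at a time through \<open>finprod_linear_factors_insert\<close>.\<close>

lemma finprod_linear_factors:
  assumes x: "x \<in> carrier A" and S: "finite S"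
  shows "(\<Otimes>\<^bsub>A\<^esub>\<mu>\<in>S. linear_factor A x c \<mu>) \<in> carrier A \<and>
    \<sigma> (\<Otimes>\<^bsub>A\<^esub>\<mu>\<in>S. linear_factor A x c \<mu>) = (\<Otimes>\<^bsub>B\<^esub>\<mu>\<in>S. linear_factor B (\<sigma> x) c \<mu>)"
  using S
proof (induction S rule: finite_induct)
  case empty
  show ?case by (simp add: finprod_def foldD_empty)
next
  case (insert \<mu> S)
  then show ?case
    using finprod_linear_factors_insert[OF A.assoc_algebra_axioms x insert(1,2), of c]
      finprod_linear_factors_insert[OF B.assoc_algebra_axioms H.hom_closed[OF x] insert(1,2), of c]
      linear_factor_closed[OF x, of c \<mu>] linear_factor[OF x, of c \<mu>] by simp
qed

lemma primitive_idempotent_closed: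
  "x \<in> carrier A \<Longrightarrow> finite (eigenvalues A x) \<Longrightarrow> primitive_idempotent A x c \<in> carrier A"
  unfolding primitive_idempotent_def using finprod_linear_factors by blast

lemma primitive_idempotent:
  "x \<in> carrier A \<Longrightarrow> finite (eigenvalues A x) \<Longrightarrow>
    \<sigma> (primitive_idempotent A x c) = primitive_idempotent B (\<sigma> x) c"
  unfolding primitive_idempotent_def using finprod_linear_factors eigenvalues by simp

end

lemma algebra_iso_trans:
  assumes "\<sigma> \<in> algebra_iso A B" "\<tau> \<in> algebra_iso B C"
  shows "\<tau> \<circ> \<sigma> \<in> algebra_iso A C"
proof -
  have "\<tau> \<circ> \<sigma> \<in> ring_iso A C"
    using assms by (auto simp: algebra_iso_def intro: ring_iso_set_trans)
  moreover have "\<sigma> x \<in> carrier B" if "x \<in> carrier A" for x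
    using assms(1) that by (auto simp: algebra_iso_def ring_iso_def dest: bij_betwE)
  ultimately show ?thesis using assms by (simp add: algebra_iso_def)
qed

lemma algebra_iso_inv:
  fixes A :: "('f::field, 'a) module" and B :: "('f, 'b) module"
  assumes "assoc_algebra class_ring A" "assoc_algebra class_ring B" "\<sigma> \<in> algebra_iso A B"
  shows "inv_into (carrier A) \<sigma> \<in> algebra_iso B A"
proof -
  interpret algebra_isomorphism A B \<sigma>
    by (intro algebra_isomorphism.intro algebra_isomorphism_axioms.intro assms)
  let ?\<tau> = "inv_into (carrier A) \<sigma>"
  have inv: "\<sigma> (?\<tau> y) = y" "?\<tau> y \<in> carrier A" if "y \<in> carrier B" for y
    using bij that by (auto simp: bij_betw_inv_into_right bij_betw_def inv_into_into)
  have left: "?\<tau> (\<sigma> x) = x" if "x \<in> carrier A" for x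
    using bij that by (simp add: bij_betw_inv_into_left)
  have "?\<tau> \<in> ring_iso B A"
  proof (rule ring_iso_memI)
    fix x y assume xy: "x \<in> carrier B" "y \<in> carrier B"
    show "?\<tau> (x \<otimes>\<^bsub>B\<^esub> y) = ?\<tau> x \<otimes>\<^bsub>A\<^esub> ?\<tau> y"
      using left[of "?\<tau> x \<otimes>\<^bsub>A\<^esub> ?\<tau> y"] inv xy by simp
    show "?\<tau> (x \<oplus>\<^bsub>B\<^esub> y) = ?\<tau> x \<oplus>\<^bsub>A\<^esub> ?\<tau> y"
      using left[of "?\<tau> x \<oplus>\<^bsub>A\<^esub> ?\<tau> y"] inv xy by simp
  next
    show "?\<tau> \<one>\<^bsub>B\<^esub> = \<one>\<^bsub>A\<^esub>" using left[of "\<one>\<^bsub>A\<^esub>"] by simp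
  qed (use inv bij_betw_inv_into[OF bij] in auto)
  moreover have "?\<tau> (c \<odot>\<^bsub>B\<^esub> x) = c \<odot>\<^bsub>A\<^esub> ?\<tau> x" if "x \<in> carrier B" for c x
    using left[of "c \<odot>\<^bsub>A\<^esub> ?\<tau> x"] inv[OF that] smult smult_carrier_A by simp
  ultimately show ?thesis by (simp add: algebra_iso_def)
qed

lemma assoc_algebra_mat: "assoc_algebra (class_ring :: 'f::field ring) (mat_algebra n)"
proof -
  interpret V: vectorspace "class_ring :: 'f ring" "module_mat TYPE('f) n n" by (rule matrix_vs)
  have "ring (module_mat TYPE('f) n n)"
    by (rule ringI[OF V.abelian_group_axioms])
      (auto simp: module_mat_simps intro!: monoidI assoc_mult_mat add_mult_distrib_mat mult_add_distrib_mat)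
  then show ?thesis
    by (intro assoc_algebra.intro assoc_algebra_axioms.intro V.module_axioms)
      (auto simp: module_mat_simps mult_smult_distrib)
qed

lemma algebra_isomorphismI:
  "assoc_algebra class_ring A \<Longrightarrow> \<sigma> \<in> algebra_iso A (mat_algebra n) \<Longrightarrow>
    algebra_isomorphism A (mat_algebra n) \<sigma>"
  by (intro algebra_isomorphism.intro algebra_isomorphism_axioms.intro assoc_algebra_mat)

lemma algebra_iso_conjugate:
  fixes V W :: "'f::field mat"
  assumes V: "V \<in> carrier_mat n n" and W: "W \<in> carrier_mat n n" and VW: "V * W = 1\<^sub>m n"
  shows "(\<lambda>M. V * M * W) \<in> algebra_iso (mat_algebra n) (mat_algebra n)"
proof -
  have WV: "W * V = 1\<^sub>m n" by (rule mat_mult_left_right_inverse[OF V W VW])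
  have cancel: "W * (V * M * W) * V = M" "V * (W * M * V) * W = M" if M: "M \<in> carrier_mat n n" for M
  proof -
    have "W * (V * M * W) * V = (W * V) * M * (W * V)" using V W M
      by (simp add: assoc_mult_mat[of _ n n _ n _ n])
    then show "W * (V * M * W) * V = M" using M by (simp add: WV)
    have "V * (W * M * V) * W = (V * W) * M * (V * W)" using V W M
      by (simp add: assoc_mult_mat[of _ n n _ n _ n])
    then show "V * (W * M * V) * W = M" using M by (simp add: VW)
  qed
  have "(\<lambda>M. V * M * W) \<in> ring_iso (mat_algebra n) (mat_algebra n :: ('f, 'f mat) module)"
  proof (rule ring_iso_memI)
    show "bij_betw (\<lambda>M. V * M * W) (carrier (mat_algebra n)) (carrier (mat_algebra n :: ('f, 'f mat) module))"
      by (rule bij_betwI[where g = "\<lambda>M. W * M * V"]) (use V W cancel in \<open>auto simp: module_mat_simps\<close>)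
  next
    fix M N assume "M \<in> carrier (mat_algebra n :: ('f, 'f mat) module)" "N \<in> carrier (mat_algebra n :: ('f, 'f mat) module)"
    then have MN: "M \<in> carrier_mat n n" "N \<in> carrier_mat n n" by (auto simp: module_mat_simps)
    have "V * M * W * (V * N * W) = V * M * ((W * V) * (N * W))" using V W MN
      by (simp add: assoc_mult_mat[of _ n n _ n _ n])
    also have "\<dots> = V * (M * N) * W" using V W MN unfolding WV
      by (simp add: assoc_mult_mat[of _ n n _ n _ n])
    finally show "V * (M \<otimes>\<^bsub>mat_algebra n\<^esub> N) * W = (V * M * W) \<otimes>\<^bsub>mat_algebra n\<^esub> (V * N * W)"
      by (simp add: module_mat_simps)
    show "V * (M \<oplus>\<^bsub>mat_algebra n\<^esub> N) * W = (V * M * W) \<oplus>\<^bsub>mat_algebra n\<^esub> (V * N * W)"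
      using V W MN by (simp add: module_mat_simps mult_add_distrib_mat[of _ n n] add_mult_distrib_mat[of _ n n])
  qed (use V W VW in \<open>auto simp: module_mat_simps\<close>)
  moreover have "V * (c \<cdot>\<^sub>m M) * W = c \<cdot>\<^sub>m (V * M * W)" if "M \<in> carrier_mat n n" for c M
    using V W that by (simp add: mult_smult_distrib[of _ n n] mult_smult_assoc_mat[of _ n n])
  ultimately show ?thesis by (simp add: algebra_iso_def module_mat_simps)
qed

section \<open>Diagonal matrices\<close>

lemma mat_diag_eq_iff: "mat_diag n f = mat_diag n g \<longleftrightarrow> (\<forall>i<n. f i = g i)"
proof
  assume eq: "mat_diag n f = mat_diag n g"
  have "f i = g i" if "i < n" for i
    using arg_cong[OF eq, of "\<lambda>M. M $$ (i, i)"] that by (simp add: mat_diag_def)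
  then show "\<forall>i<n. f i = g i" by blast
next
  assume "\<forall>i<n. f i = g i"
  then show "mat_diag n f = mat_diag n g" by (intro eq_matI) (auto simp: mat_diag_def)
qed

lemma mat_diag_eq_zero_iff:
  fixes f :: "nat \<Rightarrow> 'a::zero"
  shows "mat_diag n f = 0\<^sub>m n n \<longleftrightarrow> (\<forall>i<n. f i = 0)"
proof -
  have "0\<^sub>m n n = mat_diag n (\<lambda>_. 0 :: 'a)" by (rule eq_matI) (auto simp: mat_diag_def)
  then show ?thesis by (simp add: mat_diag_eq_iff)
qed

lemma mat_diag_add: "mat_diag n f + mat_diag n g = mat_diag n (\<lambda>i. f i + g i :: 'a::monoid_add)"
  by (rule eq_matI) (auto simp: mat_diag_def)

lemma mat_diag_smult: "c \<cdot>\<^sub>m mat_diag n f = mat_diag n (\<lambda>i. c * f i :: 'a::semiring_0)"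
  by (rule eq_matI) (auto simp: mat_diag_def)

lemma poly_eval_mat_diag:
  fixes f :: "nat \<Rightarrow> 'f::field"
  shows "poly_eval (mat_algebra n) p (mat_diag n f) = mat_diag n (\<lambda>i. poly p (f i))"
proof -
  interpret assoc_algebra "class_ring :: 'f ring" "mat_algebra n" by (rule assoc_algebra_mat)
  have pow: "mat_diag n f [^]\<^bsub>mat_algebra n\<^esub> k = mat_diag n (\<lambda>i. f i ^ k)" for k
    by (induction k) (simp_all add: module_mat_simps mult.commute)
  have "(\<Oplus>\<^bsub>mat_algebra n\<^esub>k\<in>{..m}. coeff p k \<odot>\<^bsub>mat_algebra n\<^esub> (mat_diag n f [^]\<^bsub>mat_algebra n\<^esub> k))
      = mat_diag n (\<lambda>i. \<Sum>k\<le>m. coeff p k * f i ^ k)" for m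
  proof (induction m)
    case 0
    show ?case by (simp add: pow module_mat_simps mat_diag_smult)
  next
    case (Suc m)
    have "(\<lambda>k. coeff p k \<odot>\<^bsub>mat_algebra n\<^esub> (mat_diag n f [^]\<^bsub>mat_algebra n\<^esub> k)) \<in> {..Suc m} \<rightarrow> carrier (mat_algebra n)"
      by (simp add: pow module_mat_simps)
    from finsum_Suc[OF this] Suc show ?case
      by (simp add: pow module_mat_simps mat_diag_smult mat_diag_add add.commute)
  qed
  then show ?thesis by (simp add: poly_eval_def poly_altdef)
qed

lemma poly_eval_mat_diag_eq_zero_iff:
  "poly_eval (mat_algebra (d + 1)) p (mat_diag (d + 1) \<theta>) = \<zero>\<^bsub>mat_algebra (d + 1)\<^esub> \<longleftrightarrow> (\<forall>i\<le>d. poly p (\<theta> i) = 0)"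
  by (simp only: poly_eval_mat_diag module_mat_simps mat_diag_eq_zero_iff) (auto simp: less_Suc_eq_le)

text \<open>A polynomial annihilates a diagonal matrix iff it vanishes at all diagonal entries, so
  \<open>newton \<theta> (d + 1)\<close> is a minimal polynomial. Its uniqueness matters because
  \<open>eigenvalues\<close> collects the roots of every minimal polynomial.\<close>

lemma eigenvalues_mat_diag:
  fixes \<theta> :: "nat \<Rightarrow> 'f::field"
  assumes inj: "inj_on \<theta> {..d}"
  shows "eigenvalues (mat_algebra (d + 1)) (mat_diag (d + 1) \<theta>) = \<theta> ` {..d}"
proof -
  let ?t = "newton \<theta> (d + 1)"
  have card: "card (\<theta> ` {..d}) = d + 1" using card_image[OF inj] by simp
  have vanish: "poly ?t (\<theta> i) = 0" if "i \<le> d" for i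
    using poly_newton_eq_0_iff[OF inj that, of "d + 1"] that by simp
  have bound: "d + 1 \<le> degree q" if "q \<noteq> 0" "\<And>i. i \<le> d \<Longrightarrow> poly q (\<theta> i) = 0" for q
  proof -
    have "card (\<theta> ` {..d}) \<le> card {x. poly q x = 0}"
      using that by (intro card_mono poly_roots_finite) auto
    also have "\<dots> \<le> degree q" by (rule card_poly_roots_bound[OF that(1)])
    finally show ?thesis by (simp add: card)
  qed
  have min: "is_minimal_poly (mat_algebra (d + 1)) (mat_diag (d + 1) \<theta>) ?t"
    unfolding is_minimal_poly_def poly_eval_mat_diag_eq_zero_iff
    using lead_coeff_newton[of \<theta> "d + 1"] vanish bound by auto
  have uniq: "p = ?t" if p: "is_minimal_poly (mat_algebra (d + 1)) (mat_diag (d + 1) \<theta>) p" for p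
  proof -
    have van: "\<And>i. i \<le> d \<Longrightarrow> poly p (\<theta> i) = 0" and lc: "lead_coeff p = 1"
      using p unfolding is_minimal_poly_def poly_eval_mat_diag_eq_zero_iff by auto
    have p0: "p \<noteq> 0" using lc by auto
    have t0: "?t \<noteq> 0" by (metis coeff_newton_self coeff_0 zero_neq_one)
    have "degree p \<le> degree ?t"
      using p t0 vanish unfolding is_minimal_poly_def poly_eval_mat_diag_eq_zero_iff by blast
    with bound[OF p0 van] have dp: "degree p = d + 1" by simp
    show ?thesis
      by (rule poly_eqI_degree_lead_coeff[where n = "d + 1" and A = "\<theta> ` {..d}"])
        (use lc dp van vanish card in auto)
  qed
  have "eigenvalues (mat_algebra (d + 1)) (mat_diag (d + 1) \<theta>) = {c. poly ?t c = 0}"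
    unfolding eigenvalues_def by (rule Collect_cong) (use min uniq in metis)
  also have "\<dots> = \<theta> ` {..d}" unfolding poly_newton Suc_eq_plus1[symmetric] lessThan_Suc_atMost by auto
  finally show ?thesis .
qed

definition unit_diag :: "nat \<Rightarrow> nat \<Rightarrow> 'f::field mat" where
  "unit_diag d i = mat_diag (d + 1) (\<lambda>k. if k = i then 1 else 0)"

lemma unit_diag_carrier [simp]: "unit_diag d i \<in> carrier_mat (d + 1) (d + 1)"
  by (simp add: unit_diag_def)

text \<open>Entry by entry the product is a Lagrange basis polynomial evaluated on the grid.\<close>

lemma primitive_idempotent_mat_diag:
  fixes \<theta> :: "nat \<Rightarrow> 'f::field"
  assumes inj: "inj_on \<theta> {..d}" and i: "i \<le> d"
  shows "primitive_idempotent (mat_algebra (d + 1)) (mat_diag (d + 1) \<theta>) (\<theta> i) = unit_diag d i"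
proof -
  let ?B = "mat_algebra (d + 1) :: ('f, 'f mat) module" and ?x = "mat_diag (d + 1) \<theta>"
  interpret assoc_algebra "class_ring :: 'f ring" ?B by (rule assoc_algebra_mat)
  have factor: "linear_factor ?B ?x c \<mu> = mat_diag (d + 1) (\<lambda>k. (\<theta> k - \<mu>) / (c - \<mu>))" for c \<mu>
  proof -
    have "mat_diag (d + 1) (\<lambda>k. - \<mu>) \<oplus>\<^bsub>?B\<^esub> (\<mu> \<odot>\<^bsub>?B\<^esub> \<one>\<^bsub>?B\<^esub>) = \<zero>\<^bsub>?B\<^esub>"
      using mat_diag_eq_zero_iff[of "d + 1" "\<lambda>_. 0::'f"]
      by (simp add: module_mat_simps mat_diag_one[symmetric] mat_diag_smult mat_diag_add del: mat_diag_one)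
    then have neg: "\<ominus>\<^bsub>?B\<^esub> (\<mu> \<odot>\<^bsub>?B\<^esub> \<one>\<^bsub>?B\<^esub>) = mat_diag (d + 1) (\<lambda>k. - \<mu>)"
      by (rule minus_equality) (auto simp: module_mat_simps)
    show ?thesis unfolding linear_factor_def minus_eq neg
      by (simp add: module_mat_simps mat_diag_smult mat_diag_add divide_inverse mult.commute)
  qed
  have prod: "(\<Otimes>\<^bsub>?B\<^esub>\<mu>\<in>S. linear_factor ?B ?x c \<mu>) = mat_diag (d + 1) (\<lambda>k. \<Prod>\<mu>\<in>S. (\<theta> k - \<mu>) / (c - \<mu>))"
    if "finite S" for S c
    using that
  proof (induction S rule: finite_induct)
    case empty
    show ?case by (simp add: finprod_def foldD_empty module_mat_simps)
  next
    case (insert \<mu> S)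
    have x: "?x \<in> carrier ?B" by (simp add: module_mat_simps)
    show ?case
      unfolding finprod_linear_factors_insert[OF assoc_algebra_mat x insert(1,2)] insert(3) unfolding factor
      using insert(1,2) by (simp add: module_mat_simps)
  qed
  have "(\<Prod>\<mu>\<in>\<theta> ` {..d} - {\<theta> i}. (\<theta> k - \<mu>) / (\<theta> i - \<mu>)) = (if k = i then 1 else 0)" if k: "k < d + 1" for k
  proof (cases "k = i")
    case True
    then show ?thesis by (auto intro!: prod.neutral)
  next
    case False
    then have "\<theta> k \<in> \<theta> ` {..d} - {\<theta> i}" using k inj_on_grid_neq[OF inj, of k i] i by auto
    then show ?thesis using False by (auto intro!: prod_zero bexI[of _ "\<theta> k"])
  qed
  then show ?thesis
    by (simp add: primitive_idempotent_def eigenvalues_mat_diag[OF inj, simplified] prod[simplified] unit_diag_def mat_diag_eq_iff[of "Suc d", simplified])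
qed

lemma unit_diag_sandwich:
  fixes Y :: "'f::field mat"
  assumes "Y \<in> carrier_mat (d + 1) (d + 1)"
  shows "unit_diag d i * Y * unit_diag d j
    = mat (d + 1) (d + 1) (\<lambda>(a, b). if a = i \<and> b = j then Y $$ (a, b) else 0)"
proof -
  let ?Z = "mat (d + 1) (d + 1) (\<lambda>(a, b). (if a = i then 1 else 0) * Y $$ (a, b))"
  have "unit_diag d i * Y = ?Z"
    unfolding unit_diag_def by (rule mat_diag_mult_left[OF assms])
  moreover have "?Z * unit_diag d j = mat (d + 1) (d + 1) (\<lambda>(a, b). ?Z $$ (a, b) * (if b = j then 1 else 0))"
    unfolding unit_diag_def by (rule mat_diag_mult_right) simp
  ultimately show ?thesis by (auto intro!: eq_matI)
qed

lemma unit_diag_sandwich_eq_zero_iff: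
  fixes Y :: "'f::field mat"
  assumes "Y \<in> carrier_mat (d + 1) (d + 1)" "i \<le> d" "j \<le> d"
  shows "unit_diag d i * Y * unit_diag d j = 0\<^sub>m (d + 1) (d + 1) \<longleftrightarrow> Y $$ (i, j) = 0"
  unfolding unit_diag_sandwich[OF assms(1)]
proof
  assume "mat (d + 1) (d + 1) (\<lambda>(a, b). if a = i \<and> b = j then Y $$ (a, b) else 0) = 0\<^sub>m (d + 1) (d + 1)"
  from arg_cong[OF this, of "\<lambda>M. M $$ (i, j)"] assms show "Y $$ (i, j) = 0" by simp
next
  assume "Y $$ (i, j) = 0"
  then show "mat (d + 1) (d + 1) (\<lambda>(a, b). if a = i \<and> b = j then Y $$ (a, b) else 0) = 0\<^sub>m (d + 1) (d + 1)"
    by (intro eq_matI) auto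
qed

lemma unit_diag_sandwich_diagonal:
  fixes Y :: "'f::field mat"
  assumes "Y \<in> carrier_mat (d + 1) (d + 1)"
  shows "unit_diag d i * Y * unit_diag d i = Y $$ (i, i) \<cdot>\<^sub>m unit_diag d i"
proof (rule eq_matI)
  fix a b assume "a < dim_row (Y $$ (i, i) \<cdot>\<^sub>m unit_diag d i)" "b < dim_col (Y $$ (i, i) \<cdot>\<^sub>m unit_diag d i)"
  then have "a < d + 1" "b < d + 1" by (simp_all add: unit_diag_def mat_diag_def)
  then show "(unit_diag d i * Y * unit_diag d i) $$ (a, b) = (Y $$ (i, i) \<cdot>\<^sub>m unit_diag d i) $$ (a, b)"
    unfolding unit_diag_sandwich[OF assms] by (cases "a = i"; cases "b = i") (simp_all add: unit_diag_def mat_diag_def)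
next
  show "dim_row (unit_diag d i * Y * unit_diag d i) = dim_row (Y $$ (i, i) \<cdot>\<^sub>m unit_diag d i)"
    unfolding unit_diag_sandwich[OF assms] by (simp add: unit_diag_def mat_diag_def)
  show "dim_col (unit_diag d i * Y * unit_diag d i) = dim_col (Y $$ (i, i) \<cdot>\<^sub>m unit_diag d i)"
    unfolding unit_diag_sandwich[OF assms] by (simp add: unit_diag_def mat_diag_def)
qed

text \<open>Amounts to an eigenbasis of \<open>x\<close> with its eigenvalues in a given order. It
  serves A with its eigenvalues in either order, and also A*.\<close>

locale diagonalized =
  algebra_isomorphism A "mat_algebra (d + 1)" \<sigma>
  for d :: nat and A :: "('f::field, 'a) module" and \<sigma> :: "'a \<Rightarrow> 'f mat" +
  fixes x :: 'a and \<theta> :: "nat \<Rightarrow> 'f"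
  assumes x: "x \<in> carrier A" and diag: "\<sigma> x = mat_diag (d + 1) \<theta>" and inj: "inj_on \<theta> {..d}"
begin

abbreviation "E i \<equiv> primitive_idempotent A x (\<theta> i)"

lemma spectrum: "eigenvalues A x = \<theta> ` {..d}"
  using eigenvalues[OF x] eigenvalues_mat_diag[OF inj] diag by simp

lemma multiplicity_free: "multiplicity_free A d x"
  unfolding multiplicity_free_def spectrum using card_image[OF inj] x by simp

lemma E_closed: "E i \<in> carrier A"
  by (rule primitive_idempotent_closed[OF x]) (simp add: spectrum)

lemma E_image: "i \<le> d \<Longrightarrow> \<sigma> (E i) = unit_diag d i"
  using primitive_idempotent[OF x, of "\<theta> i"] primitive_idempotent_mat_diag[OF inj, of i] diag spectrum by simp

lemma carrier_image: "y \<in> carrier A \<Longrightarrow> \<sigma> y \<in> carrier_mat (d + 1) (d + 1)"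
  using H.hom_closed[of y] by (simp add: module_mat_simps)

lemma sandwich_image:
  "y \<in> carrier A \<Longrightarrow> i \<le> d \<Longrightarrow> j \<le> d \<Longrightarrow> \<sigma> (E i \<otimes>\<^bsub>A\<^esub> y \<otimes>\<^bsub>A\<^esub> E j) = unit_diag d i * \<sigma> y * unit_diag d j"
  using E_closed by (simp add: E_image module_mat_simps)

lemma sandwich_eq_zero_iff:
  assumes "y \<in> carrier A" "i \<le> d" "j \<le> d"
  shows "E i \<otimes>\<^bsub>A\<^esub> y \<otimes>\<^bsub>A\<^esub> E j = \<zero>\<^bsub>A\<^esub> \<longleftrightarrow> \<sigma> y $$ (i, j) = 0"
proof -
  have "E i \<otimes>\<^bsub>A\<^esub> y \<otimes>\<^bsub>A\<^esub> E j \<in> carrier A" using assms E_closed by simp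
  from eq_zero_iff[OF this] show ?thesis
    unfolding sandwich_image[OF assms]
    using unit_diag_sandwich_eq_zero_iff[OF carrier_image[OF assms(1)] assms(2,3)] by (simp add: module_mat_simps)
qed

text \<open>This describes the diagonal entry inside the algebra, so it does not depend on the
  diagonalizing isomorphism.\<close>

lemma sandwich_diagonal:
  assumes "y \<in> carrier A" "i \<le> d"
  shows "E i \<otimes>\<^bsub>A\<^esub> y \<otimes>\<^bsub>A\<^esub> E i = c \<odot>\<^bsub>A\<^esub> E i \<longleftrightarrow> c = \<sigma> y $$ (i, i)"
proof -
  have "E i \<otimes>\<^bsub>A\<^esub> y \<otimes>\<^bsub>A\<^esub> E i \<in> carrier A" using assms E_closed by simp
  from eq_iff[OF this smult_carrier_A[OF E_closed, of c i]]
  have "E i \<otimes>\<^bsub>A\<^esub> y \<otimes>\<^bsub>A\<^esub> E i = c \<odot>\<^bsub>A\<^esub> E i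
      \<longleftrightarrow> (\<sigma> y $$ (i, i)) \<cdot>\<^sub>m unit_diag d i = c \<cdot>\<^sub>m (unit_diag d i :: 'f mat)"
    unfolding sandwich_image[OF assms assms(2)] unit_diag_sandwich_diagonal[OF carrier_image[OF assms(1)]]
      smult[OF E_closed] E_image[OF assms(2)] by (auto simp: module_mat_simps)
  also have "\<dots> \<longleftrightarrow> c = \<sigma> y $$ (i, i)"
    unfolding unit_diag_def mat_diag_smult mat_diag_eq_iff using assms(2) by force
  finally show ?thesis .
qed

lemma E_inj: "inj_on E {..d}"
proof (rule inj_onI)
  fix i j assume ij: "i \<in> {..d}" "j \<in> {..d}" "E i = E j"
  then have "unit_diag d i = (unit_diag d j :: 'f mat)" using E_image[of i] E_image[of j] by simp
  then show "i = j" using ij(1) unfolding unit_diag_def mat_diag_eq_iff by (auto dest!: spec[of _ i] split: if_splits)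
qed

lemma idempotent_ordering:
  assumes "\<And>i. i \<le> d \<Longrightarrow> F i = E i"
  shows "idempotent_ordering A d x F"
proof -
  have "bij_betw E {..d} (primitive_idempotent A x ` eigenvalues A x)"
    unfolding spectrum image_image by (rule inj_on_imp_bij_betw[OF E_inj])
  then show ?thesis unfolding idempotent_ordering_def using bij_betw_cong[of "{..d}" F E] assms by simp
qed

end

section \<open>Bidiagonal matrices\<close>

lemma mult_mat_entry:
  assumes "A \<in> carrier_mat (d + 1) (d + 1)" "B \<in> carrier_mat (d + 1) (d + 1)" "i \<le> d" "j \<le> d"
  shows "(A * B) $$ (i, j) = (\<Sum>k\<le>d. A $$ (i, k) * B $$ (k, j))"
proof -
  have "{0..<d + 1} = {..d}" by auto
  then show ?thesis using assms by (simp add: scalar_prod_def)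
qed

lemma square_mat_eqI:
  assumes "A \<in> carrier_mat (d + 1) (d + 1)" "B \<in> carrier_mat (d + 1) (d + 1)"
    and "\<And>i j. i \<le> d \<Longrightarrow> j \<le> d \<Longrightarrow> A $$ (i, j) = B $$ (i, j)"
  shows "A = B"
  by (rule eq_matI) (use assms in auto)

lemma det_nonzero_inverse:
  fixes V :: "'f::field mat"
  assumes "V \<in> carrier_mat n n" "det V \<noteq> 0"
  obtains W where "W \<in> carrier_mat n n" "V * W = 1\<^sub>m n" "W * V = 1\<^sub>m n"
  using det_non_zero_imp_unit[OF assms, of "()"] unfolding Units_def by (auto simp: ring_mat_simps)

lemma lower_bidiagonal_carrier [simp]: "lower_bidiagonal d \<theta> \<in> carrier_mat (d + 1) (d + 1)"
  by (simp add: lower_bidiagonal_def)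

lemma upper_bidiagonal_carrier [simp]: "upper_bidiagonal d \<theta>s \<phi> \<in> carrier_mat (d + 1) (d + 1)"
  by (simp add: upper_bidiagonal_def)

lemma sum_two_deltas:
  fixes u v :: "nat \<Rightarrow> 'f::field"
  assumes "m \<noteq> n"
  shows "(\<Sum>k\<le>d. if k = m then u k else if k = n then v k else 0)
    = (if m \<le> d then u m else 0) + (if n \<le> d then v n else 0)"
proof -
  have "(\<Sum>k\<le>d. if k = m then u k else if k = n then v k else 0)
      = (\<Sum>k\<le>d. (if k = m then u k else 0) + (if k = n then v k else 0))"
    by (rule sum.cong) (use assms in auto)
  then show ?thesis by (simp add: sum.distrib)
qed

lemma mult_lower_bidiagonal_entry:
  assumes "V \<in> carrier_mat (d + 1) (d + 1)" "i \<le> d" "n \<le> d"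
  shows "(V * lower_bidiagonal d t) $$ (i, n) = V $$ (i, n) * t n + (if n < d then V $$ (i, n + 1) else 0)"
proof -
  have "(V * lower_bidiagonal d t) $$ (i, n)
      = (\<Sum>k\<le>d. if k = n then V $$ (i, k) * t k else if k = n + 1 then V $$ (i, k) else 0)"
    unfolding mult_mat_entry[OF assms(1) lower_bidiagonal_carrier assms(2,3)]
    by (rule sum.cong) (use assms(3) in \<open>auto simp: lower_bidiagonal_def\<close>)
  then show ?thesis using assms(3) sum_two_deltas[of n "n + 1" "\<lambda>k. V $$ (i, k) * t k" "\<lambda>k. V $$ (i, k)" d] by simp
qed

lemma lower_bidiagonal_mult_entry:
  assumes "V \<in> carrier_mat (d + 1) (d + 1)" "i \<le> d" "n \<le> d"
  shows "(lower_bidiagonal d t * V) $$ (i, n) = t i * V $$ (i, n) + (if i = 0 then 0 else V $$ (i - 1, n))"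
proof -
  \<comment> \<open>For \<open>i = 0\<close> the second index is set to \<open>d + 1\<close>,
    outside the range of summation, so that its term is absent.\<close>
  have "(lower_bidiagonal d t * V) $$ (i, n)
      = (\<Sum>k\<le>d. if k = i then t k * V $$ (k, n) else if k = (if i = 0 then d + 1 else i - 1) then V $$ (k, n) else 0)"
    unfolding mult_mat_entry[OF lower_bidiagonal_carrier assms]
    by (rule sum.cong) (use assms(2) in \<open>auto simp: lower_bidiagonal_def\<close>)
  then show ?thesis
    using assms(2) sum_two_deltas[of i "if i = 0 then d + 1 else i - 1" "\<lambda>k. t k * V $$ (k, n)" "\<lambda>k. V $$ (k, n)" d]
    by (cases "i = 0") auto
qed

lemma mult_upper_bidiagonal_entry:
  assumes "V \<in> carrier_mat (d + 1) (d + 1)" "i \<le> d" "n \<le> d"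
  shows "(V * upper_bidiagonal d \<theta>s \<phi>) $$ (i, n) = V $$ (i, n) * \<theta>s n + (if n = 0 then 0 else V $$ (i, n - 1) * \<phi> n)"
proof -
  have "(V * upper_bidiagonal d \<theta>s \<phi>) $$ (i, n)
      = (\<Sum>k\<le>d. if k = n then V $$ (i, k) * \<theta>s k else if k = (if n = 0 then d + 1 else n - 1) then V $$ (i, k) * \<phi> n else 0)"
    unfolding mult_mat_entry[OF assms(1) upper_bidiagonal_carrier assms(2,3)]
    by (rule sum.cong) (use assms(3) in \<open>auto simp: upper_bidiagonal_def\<close>)
  then show ?thesis
    using assms(3) sum_two_deltas[of n "if n = 0 then d + 1 else n - 1" "\<lambda>k. V $$ (i, k) * \<theta>s k" "\<lambda>k. V $$ (i, k) * \<phi> n" d]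
    by (cases "n = 0") auto
qed

lemma upper_bidiagonal_mult_entry:
  assumes "V \<in> carrier_mat (d + 1) (d + 1)" "i \<le> d" "n \<le> d"
  shows "(upper_bidiagonal d \<theta>s \<phi> * V) $$ (i, n) = \<theta>s i * V $$ (i, n) + (if i < d then \<phi> (i + 1) * V $$ (i + 1, n) else 0)"
proof -
  have "(upper_bidiagonal d \<theta>s \<phi> * V) $$ (i, n)
      = (\<Sum>k\<le>d. if k = i then \<theta>s k * V $$ (k, n) else if k = i + 1 then \<phi> k * V $$ (k, n) else 0)"
    unfolding mult_mat_entry[OF upper_bidiagonal_carrier assms]
    by (rule sum.cong) (use assms(2) in \<open>auto simp: upper_bidiagonal_def\<close>)
  then show ?thesis using assms(2) sum_two_deltas[of i "i + 1" "\<lambda>k. \<theta>s k * V $$ (k, n)" "\<lambda>k. \<phi> k * V $$ (k, n)" d] by simp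
qed

text \<open>The transition matrix between a split basis and an eigenbasis of A. Nodes and evaluation
  points are separate because the second split form has reversed nodes over the same
  eigenbasis.\<close>

definition newton_mat :: "nat \<Rightarrow> (nat \<Rightarrow> 'f::field) \<Rightarrow> (nat \<Rightarrow> 'f) \<Rightarrow> 'f mat" where
  "newton_mat d t \<theta> = mat (d + 1) (d + 1) (\<lambda>(i, n). poly (newton t n) (\<theta> i))"

lemma newton_mat_carrier [simp]: "newton_mat d t \<theta> \<in> carrier_mat (d + 1) (d + 1)"
  by (simp add: newton_mat_def)

lemma newton_mat_entry [simp]: "i \<le> d \<Longrightarrow> n \<le> d \<Longrightarrow> newton_mat d t \<theta> $$ (i, n) = poly (newton t n) (\<theta> i)"
  by (simp add: newton_mat_def)

lemma newton_independent:
  assumes "(\<Sum>n<N. Polynomial.smult (c n) (newton t n)) = 0" "n < N"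
  shows "c n = 0"
  using assms
proof (induction N)
  case (Suc N)
  have "coeff (\<Sum>n<Suc N. Polynomial.smult (c n) (newton t n)) N = (\<Sum>n<Suc N. c n * coeff (newton t n) N)"
    by (simp only: coeff_sum coeff_smult)
  also have "\<dots> = c N" by (simp add: coeff_eq_0)
  finally have "c N = 0" unfolding Suc.prems(1) by simp
  with Suc show ?case by (cases "n = N") auto
qed simp

text \<open>A kernel vector would be the coefficient vector of a polynomial of degree at most
  \<open>d\<close> that vanishes at \<open>d + 1\<close> points.\<close>

lemma det_newton_mat:
  fixes \<theta> :: "nat \<Rightarrow> 'f::field"
  assumes inj: "inj_on \<theta> {..d}"
  shows "det (newton_mat d t \<theta>) \<noteq> 0"
proof
  assume "det (newton_mat d t \<theta>) = 0"
  then obtain v where v: "v \<in> carrier_vec (d + 1)" "v \<noteq> 0\<^sub>v (d + 1)" "newton_mat d t \<theta> *\<^sub>v v = 0\<^sub>v (d + 1)"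
    using det_0_iff_vec_prod_zero_field[OF newton_mat_carrier] by blast
  define p where "p = (\<Sum>n<d + 1. Polynomial.smult (v $ n) (newton t n))"
  have "poly p (\<theta> i) = 0" if i: "i \<le> d" for i
  proof -
    have "(newton_mat d t \<theta> *\<^sub>v v) $ i = (\<Sum>n=0..<d + 1. newton_mat d t \<theta> $$ (i, n) * v $ n)"
      using i v(1) by (simp add: scalar_prod_def newton_mat_def)
    also have "\<dots> = poly p (\<theta> i)" unfolding p_def poly_sum atLeast0LessThan
      by (rule sum.cong) (use i in auto)
    finally show ?thesis using v(3) i by simp
  qed
  moreover have "degree p \<le> d" unfolding p_def
    by (rule degree_sum_le) (auto intro: order_trans[OF degree_smult_le])
  ultimately have "p = 0" using poly_eq_on_grid[OF inj, of p 0] by simp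
  then have "v $ n = 0" if "n < d + 1" for n
    using newton_independent[of "\<lambda>n. v $ n" t "d + 1" n] that by (simp add: p_def)
  then have "v = 0\<^sub>v (d + 1)" using v(1) by (intro eq_vecI) auto
  with v(2) show False ..
qed

text \<open>Column by column this is
  \<open>x * newton t n = newton t (n + 1) + t n * newton t n\<close>. The assumption closes the
  last column, where no column \<open>n + 1\<close> is available.\<close>

lemma mat_diag_newton_mat:
  assumes "\<And>i. i \<le> d \<Longrightarrow> poly (newton t (d + 1)) (\<theta> i) = 0"
  shows "mat_diag (d + 1) \<theta> * newton_mat d t \<theta> = newton_mat d t \<theta> * lower_bidiagonal d t"
proof (rule square_mat_eqI)
  fix i n assume i: "i \<le> d" and n: "n \<le> d"
  have "poly (newton t (n + 1)) (\<theta> i) = poly (newton t n) (\<theta> i) * (\<theta> i - t n)"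
    using poly_newton_pred[of "n + 1" t "\<theta> i"] by simp
  moreover have "n = d \<Longrightarrow> poly (newton t (n + 1)) (\<theta> i) = 0" using assms[OF i] by simp
  moreover have "(mat_diag (d + 1) \<theta> * newton_mat d t \<theta>) $$ (i, n) = \<theta> i * poly (newton t n) (\<theta> i)"
    using i n by (subst mat_diag_mult_left[OF newton_mat_carrier]) simp
  ultimately show "(mat_diag (d + 1) \<theta> * newton_mat d t \<theta>) $$ (i, n) = (newton_mat d t \<theta> * lower_bidiagonal d t) $$ (i, n)"
    unfolding mult_lower_bidiagonal_entry[OF newton_mat_carrier i n] using i n
    by (cases "n = d") (auto simp: algebra_simps)
qed (intro mult_carrier_mat[of _ _ "d + 1"] mat_diag_dim newton_mat_carrier lower_bidiagonal_carrier)+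

lemma mult_newton_mat_eq_iff:
  fixes X :: "'f::field mat"
  assumes X: "X \<in> carrier_mat (d + 1) (d + 1)"
  shows "X * newton_mat d t \<theta> = newton_mat d t \<theta> * upper_bidiagonal d \<theta>s \<phi> \<longleftrightarrow>
    (\<forall>i\<le>d. \<forall>n\<le>d. (\<Sum>j\<le>d. X $$ (i, j) * poly (newton t n) (\<theta> j)) = \<theta>s n * poly (newton t n) (\<theta> i)
      + (if n = 0 then 0 else \<phi> n * poly (newton t (n - 1)) (\<theta> i)))"
proof -
  let ?V = "newton_mat d t \<theta>" and ?U = "upper_bidiagonal d \<theta>s \<phi>"
  have "X * ?V = ?V * ?U \<longleftrightarrow> (\<forall>i\<le>d. \<forall>n\<le>d. (X * ?V) $$ (i, n) = (?V * ?U) $$ (i, n))"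
  proof
    assume "\<forall>i\<le>d. \<forall>n\<le>d. (X * ?V) $$ (i, n) = (?V * ?U) $$ (i, n)"
    then show "X * ?V = ?V * ?U"
      by (intro square_mat_eqI[of _ d] mult_carrier_mat[of _ _ "d + 1"] X newton_mat_carrier upper_bidiagonal_carrier) blast
  qed simp
  also have "\<dots> \<longleftrightarrow> (\<forall>i\<le>d. \<forall>n\<le>d. (\<Sum>j\<le>d. X $$ (i, j) * poly (newton t n) (\<theta> j))
      = \<theta>s n * poly (newton t n) (\<theta> i) + (if n = 0 then 0 else \<phi> n * poly (newton t (n - 1)) (\<theta> i)))"
  proof -
    have "(X * ?V) $$ (i, n) = (\<Sum>j\<le>d. X $$ (i, j) * poly (newton t n) (\<theta> j))"
      "(?V * ?U) $$ (i, n) = \<theta>s n * poly (newton t n) (\<theta> i) + (if n = 0 then 0 else \<phi> n * poly (newton t (n - 1)) (\<theta> i))"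
      if i: "i \<le> d" and n: "n \<le> d" for i n
    proof -
      show "(X * ?V) $$ (i, n) = (\<Sum>j\<le>d. X $$ (i, j) * poly (newton t n) (\<theta> j))"
        unfolding mult_mat_entry[OF X newton_mat_carrier i n] by (rule sum.cong) (use n in auto)
      show "(?V * ?U) $$ (i, n) = \<theta>s n * poly (newton t n) (\<theta> i) + (if n = 0 then 0 else \<phi> n * poly (newton t (n - 1)) (\<theta> i))"
        unfolding mult_upper_bidiagonal_entry[OF newton_mat_carrier i n] using i n by (simp add: mult.commute)
    qed
    then show ?thesis by auto
  qed
  finally show ?thesis .
qed

section \<open>The dual eigenbasis\<close>

text \<open>The eigenvector equation for \<open>\<theta>s n\<close> gives each coordinate from the
  one above: \<open>\<phi> (a + 1)\<close> times coordinate \<open>a + 1\<close> is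
  \<open>\<theta>s n - \<theta>s a\<close> times coordinate \<open>a\<close>. The solution starting
  with 1 is a Newton polynomial at \<open>\<theta>s n\<close> over a product of \<phi>. It stops
  after coordinate \<open>n\<close>, which makes \<open>R\<close> triangular.\<close>

lemma upper_bidiagonal_eigenbasis:
  fixes \<theta>s \<phi> :: "nat \<Rightarrow> 'f::field"
  assumes injs: "inj_on \<theta>s {..d}" and \<phi>: "\<And>i. 1 \<le> i \<Longrightarrow> i \<le> d \<Longrightarrow> \<phi> i \<noteq> 0"
  obtains R where "R \<in> carrier_mat (d + 1) (d + 1)"
    "upper_bidiagonal d \<theta>s \<phi> * R = R * mat_diag (d + 1) \<theta>s"
    "upper_triangular R" "\<And>i. i \<le> d \<Longrightarrow> R $$ (i, i) \<noteq> 0"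
proof -
  define R where "R = mat (d + 1) (d + 1) (\<lambda>(a, n). poly (newton \<theta>s a) (\<theta>s n) / (\<Prod>h<a. \<phi> (h + 1)))"
  have R: "R \<in> carrier_mat (d + 1) (d + 1)" by (simp add: R_def)
  have entry: "R $$ (a, n) = poly (newton \<theta>s a) (\<theta>s n) / (\<Prod>h<a. \<phi> (h + 1))" if "a \<le> d" "n \<le> d" for a n
    using that by (simp add: R_def)
  have nz: "(\<Prod>h<a. \<phi> (h + 1)) \<noteq> 0" if "a \<le> d" for a using that \<phi> by auto
  have "upper_bidiagonal d \<theta>s \<phi> * R = R * mat_diag (d + 1) \<theta>s"
  proof (rule square_mat_eqI)
    fix a n assume a: "a \<le> d" and n: "n \<le> d"
    have suc: "poly (newton \<theta>s (a + 1)) (\<theta>s n) = poly (newton \<theta>s a) (\<theta>s n) * (\<theta>s n - \<theta>s a)"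
      using poly_newton_pred[of "a + 1" \<theta>s "\<theta>s n"] by simp
    have rhs: "(R * mat_diag (d + 1) \<theta>s) $$ (a, n) = R $$ (a, n) * \<theta>s n"
      using a n by (subst mat_diag_mult_right[OF R]) simp
    show "(upper_bidiagonal d \<theta>s \<phi> * R) $$ (a, n) = (R * mat_diag (d + 1) \<theta>s) $$ (a, n)"
    proof (cases "a < d")
      case True
      then have "\<phi> (a + 1) * R $$ (a + 1, n) = R $$ (a, n) * (\<theta>s n - \<theta>s a)"
        using entry[of "a + 1" n] entry[OF a n] suc n \<phi>[of "a + 1"] by simp
      then show ?thesis unfolding rhs upper_bidiagonal_mult_entry[OF R a n] using True
        by (simp add: algebra_simps)
    next
      case False
      then have "poly (newton \<theta>s (a + 1)) (\<theta>s n) = 0"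
        using poly_newton_eq_0_iff[OF injs n, of "a + 1"] a n by simp
      then have "R $$ (a, n) * (\<theta>s n - \<theta>s a) = 0" using entry[OF a n] suc by auto
      then show ?thesis unfolding rhs upper_bidiagonal_mult_entry[OF R a n] using False
        by auto
    qed
  qed (intro mult_carrier_mat[of _ _ "d + 1"] R mat_diag_dim upper_bidiagonal_carrier)+
  moreover have "upper_triangular R"
  proof
    fix i j assume "j < i" "i < dim_row R"
    then show "R $$ (i, j) = 0"
      using entry[of i j] poly_newton_eq_0_iff[OF injs, of j i] R by simp
  qed
  moreover have "R $$ (i, i) \<noteq> 0" if "i \<le> d" for i
    unfolding entry[OF that that] using poly_newton_eq_0_iff[OF injs that, of i] nz[OF that] that by simp
  ultimately show ?thesis by (rule that[OF R])
qed

lemma det_upper_triangular_nonzero: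
  fixes R :: "'f::field mat"
  assumes R: "R \<in> carrier_mat (d + 1) (d + 1)" "upper_triangular R" and nz: "\<And>i. i \<le> d \<Longrightarrow> R $$ (i, i) \<noteq> 0"
  shows "det R \<noteq> 0"
  unfolding det_upper_triangular[OF R(2,1)] prod_list_zero_iff using R(1) nz
  by (auto simp: diag_mat_def less_Suc_eq_le)

text \<open>Conjugating a lower bidiagonal matrix by an upper triangular one creates nothing below
  the first subdiagonal, and there it only rescales the entries 1. The zeros are obtained from the
  last row upwards, since each row of the intertwining relation involves only rows of
  \<open>Y\<close> further down.\<close>

lemma upper_hessenberg_if_intertwined:
  fixes R Y :: "'f::field mat"
  assumes R: "R \<in> carrier_mat (d + 1) (d + 1)" "upper_triangular R" and nz: "\<And>i. i \<le> d \<Longrightarrow> R $$ (i, i) \<noteq> 0"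
    and Y: "Y \<in> carrier_mat (d + 1) (d + 1)" and RY: "R * Y = lower_bidiagonal d t * R"
  shows "\<And>i j. i \<le> d \<Longrightarrow> j + 1 < i \<Longrightarrow> Y $$ (i, j) = 0" "\<And>j. j < d \<Longrightarrow> Y $$ (j + 1, j) \<noteq> 0"
proof -
  have low: "R $$ (i, j) = 0" if "j < i" "i \<le> d" for i j
    using upper_triangularD[OF R(2) that(1)] that(2) R(1) by simp
  have row: "(\<Sum>m\<le>d. R $$ (i, m) * Y $$ (m, j)) = t i * R $$ (i, j) + (if i = 0 then 0 else R $$ (i - 1, j))"
    if "i \<le> d" "j \<le> d" for i j
    using mult_mat_entry[OF R(1) Y that] lower_bidiagonal_mult_entry[OF R(1) that, of t] RY by simp
  have single: "(\<Sum>m\<le>d. R $$ (i, m) * Y $$ (m, j)) = R $$ (i, i) * Y $$ (i, j)"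
    if i: "i \<le> d" and above: "\<And>m. i < m \<Longrightarrow> m \<le> d \<Longrightarrow> Y $$ (m, j) = 0" for i j
  proof -
    have "(\<Sum>m\<le>d. R $$ (i, m) * Y $$ (m, j)) = (\<Sum>m\<in>{i}. R $$ (i, m) * Y $$ (m, j))"
    proof (rule sum.mono_neutral_right)
      show "\<forall>m\<in>{..d} - {i}. R $$ (i, m) * Y $$ (m, j) = 0"
      proof
        fix m assume "m \<in> {..d} - {i}"
        then have "m < i \<or> i < m \<and> m \<le> d" by auto
        then show "R $$ (i, m) * Y $$ (m, j) = 0" using low[OF _ i] above by auto
      qed
    qed (use i in auto)
    then show ?thesis by simp
  qed
  show zero: "Y $$ (i, j) = 0" if "i \<le> d" "j + 1 < i" for i j
    using that
  proof (induction "d - i" arbitrary: i rule: less_induct)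
    case less
    have "Y $$ (m, j) = 0" if "i < m" "m \<le> d" for m
      by (rule less.hyps) (use that less.prems in auto)
    from single[OF less.prems(1) this] row[of i j] less.prems low[of j i] low[of j "i - 1"]
    have "R $$ (i, i) * Y $$ (i, j) = 0" by simp
    with nz[OF less.prems(1)] show ?case by simp
  qed
  fix j assume j: "j < d"
  have "R $$ (j + 1, j + 1) * Y $$ (j + 1, j) = R $$ (j, j)"
    using single[of "j + 1" j] zero[of _ j] row[of "j + 1" j] low[of j "j + 1"] j by simp
  with nz[of j] j show "Y $$ (j + 1, j) \<noteq> 0" by auto
qed

text \<open>\<open>W\<^sup>T K W\<close> commutes with the diagonal matrix of the dual eigenvalues and is therefore diagonal.\<close>

lemma dual_symmetrizer:
  fixes X W Y :: "'f::field mat"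
  assumes X: "X \<in> carrier_mat (d + 1) (d + 1)" and W: "W \<in> carrier_mat (d + 1) (d + 1)" "det W \<noteq> 0"
    and Y: "Y \<in> carrier_mat (d + 1) (d + 1)"
    and XW: "X * W = W * mat_diag (d + 1) \<theta>s" and WY: "W * Y = mat_diag (d + 1) \<theta> * W"
    and injs: "inj_on \<theta>s {..d}"
    and k: "\<And>i. i \<le> d \<Longrightarrow> k i \<noteq> 0" "\<And>i j. i \<le> d \<Longrightarrow> j \<le> d \<Longrightarrow> k i * X $$ (i, j) = k j * X $$ (j, i)"
  obtains h where "\<And>i. i \<le> d \<Longrightarrow> h i \<noteq> 0" "\<And>i j. i \<le> d \<Longrightarrow> j \<le> d \<Longrightarrow> h i * Y $$ (i, j) = h j * Y $$ (j, i)"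
proof -
  let ?n = "d + 1" and ?K = "mat_diag (d + 1) k" and ?D = "mat_diag (d + 1) \<theta>" and ?Ds = "mat_diag (d + 1) \<theta>s"
  let ?WT = "transpose_mat W"
  define H where "H = ?WT * (?K * W)"
  have c: "?K \<in> carrier_mat ?n ?n" "?D \<in> carrier_mat ?n ?n" "?Ds \<in> carrier_mat ?n ?n"
    "?WT \<in> carrier_mat ?n ?n" "transpose_mat X \<in> carrier_mat ?n ?n" "transpose_mat Y \<in> carrier_mat ?n ?n"
    using W(1) X Y by auto
  have H: "H \<in> carrier_mat ?n ?n" unfolding H_def by (intro mult_carrier_mat[of _ _ ?n] c W(1))
  have td: "transpose_mat (mat_diag ?n f) = mat_diag ?n f" for f :: "nat \<Rightarrow> 'f"
    by (rule eq_matI) (auto simp: mat_diag_def)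
  have KX: "?K * X = transpose_mat X * ?K"
    unfolding mat_diag_mult_left[OF X] mat_diag_mult_right[OF c(5)]
    by (rule eq_matI) (use X k(2) in \<open>auto simp: less_Suc_eq_le mult.commute\<close>)
  have assoc: "A * B * C = A * (B * C)" if "A \<in> carrier_mat ?n ?n" "B \<in> carrier_mat ?n ?n" "C \<in> carrier_mat ?n ?n"
    for A B C :: "'f mat" using that by (rule assoc_mult_mat)
  have WTDs: "?Ds * ?WT = ?WT * transpose_mat X"
    using arg_cong[OF XW, of transpose_mat] transpose_mult[OF X W(1)] transpose_mult[OF W(1) c(3)] by (simp only: td)
  have YTWT: "transpose_mat Y * ?WT = ?WT * ?D"
    using arg_cong[OF WY, of transpose_mat] transpose_mult[OF W(1) Y] transpose_mult[OF c(2) W(1)] by (simp only: td)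
  have m: "A * B \<in> carrier_mat ?n ?n" if "A \<in> carrier_mat ?n ?n" "B \<in> carrier_mat ?n ?n" for A B :: "'f mat"
    using that by (rule mult_carrier_mat)
  have "H * ?Ds = ?WT * (?K * (W * ?Ds))"
    unfolding H_def assoc[OF c(4) m[OF c(1) W(1)] c(3)] assoc[OF c(1) W(1) c(3)] ..
  also have "\<dots> = ?WT * (?K * X * W)" unfolding XW[symmetric] assoc[OF c(1) X W(1)] ..
  also have "\<dots> = ?WT * transpose_mat X * (?K * W)"
    unfolding KX assoc[OF c(5) c(1) W(1)] assoc[OF c(4) c(5) m[OF c(1) W(1)]] ..
  also have "\<dots> = ?Ds * H"
    unfolding WTDs[symmetric] H_def assoc[OF c(3) c(4) m[OF c(1) W(1)]] ..
  finally have comm: "H * ?Ds = ?Ds * H" .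
  have off: "H $$ (i, j) = 0" if "i \<le> d" "j \<le> d" "i \<noteq> j" for i j
  proof -
    have "H $$ (i, j) * \<theta>s j = \<theta>s i * H $$ (i, j)"
      using arg_cong[OF comm, of "\<lambda>M. M $$ (i, j)"] that(1,2)
      unfolding mat_diag_mult_left[OF H] mat_diag_mult_right[OF H] by simp
    then have "H $$ (i, j) * (\<theta>s j - \<theta>s i) = 0" by (simp add: algebra_simps)
    then show ?thesis using inj_on_grid_neq[OF injs that] by simp
  qed
  have ut: "upper_triangular M" if "M \<in> carrier_mat ?n ?n" "\<And>i j. i \<le> d \<Longrightarrow> j \<le> d \<Longrightarrow> i \<noteq> j \<Longrightarrow> M $$ (i, j) = 0" for M :: "'f mat"
    by (rule upper_triangularI) (use that in auto)
  have "det ?K \<noteq> 0"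
    by (rule det_upper_triangular_nonzero[OF c(1)]) (use k(1) in \<open>auto simp: mat_diag_def\<close>)
  then have "det H \<noteq> 0"
    unfolding H_def det_mult[OF c(4) m[OF c(1) W(1)]] det_mult[OF c(1) W(1)] det_transpose[OF W(1)]
    using W(2) by simp
  moreover have "det H = prod_list (diag_mat H)"
    by (rule det_upper_triangular[OF ut[OF H] H]) (rule off)
  ultimately have "0 \<notin> set (diag_mat H)" by (simp add: prod_list_zero_iff)
  then have diag: "H $$ (i, i) \<noteq> 0" if "i \<le> d" for i
    using H that by (auto simp: diag_mat_def less_Suc_eq_le image_iff)
  have KD: "?K * ?D = ?D * ?K" by (simp add: mult.commute)
  \<comment> \<open>As \<open>?K\<close> and \<open>?D\<close> are both diagonal they commute, and
    so \<open>H\<close> symmetrizes \<open>Y\<close> just as \<open>?K\<close> symmetrizes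
    \<open>X\<close>.\<close>
  have "H * Y = ?WT * (?K * (W * Y))"
    unfolding H_def assoc[OF c(4) m[OF c(1) W(1)] Y] assoc[OF c(1) W(1) Y] ..
  also have "\<dots> = ?WT * (?D * (?K * W))"
    unfolding WY assoc[OF c(1) c(2) W(1), symmetric] KD assoc[OF c(2) c(1) W(1)] ..
  also have "\<dots> = transpose_mat Y * H"
    unfolding H_def assoc[OF c(4) c(2) m[OF c(1) W(1)], symmetric] YTWT[symmetric]
      assoc[OF c(6) c(4) m[OF c(1) W(1)]] ..
  finally have HY: "H * Y = transpose_mat Y * H" .
  have "H $$ (i, i) * Y $$ (i, j) = H $$ (j, j) * Y $$ (j, i)" if ij: "i \<le> d" "j \<le> d" for i j
  proof -
    have "(H * Y) $$ (i, j) = H $$ (i, i) * Y $$ (i, j)"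
    proof -
      have "(\<Sum>m\<le>d. H $$ (i, m) * Y $$ (m, j)) = (\<Sum>m\<in>{i}. H $$ (i, m) * Y $$ (m, j))"
        by (rule sum.mono_neutral_right) (use off[OF ij(1)] ij in auto)
      then show ?thesis unfolding mult_mat_entry[OF H Y ij] by simp
    qed
    moreover have "(transpose_mat Y * H) $$ (i, j) = Y $$ (j, i) * H $$ (j, j)"
    proof -
      have "(\<Sum>m\<le>d. transpose_mat Y $$ (i, m) * H $$ (m, j)) = (\<Sum>m\<in>{j}. transpose_mat Y $$ (i, m) * H $$ (m, j))"
        by (rule sum.mono_neutral_right) (use off[OF _ ij(2)] ij in auto)
      then show ?thesis unfolding mult_mat_entry[OF c(6) H ij] using Y ij by simp
    qed
    ultimately show ?thesis using HY by (simp add: mult.commute)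
  qed
  with diag show ?thesis by (rule that)
qed

section \<open>Leonard systems\<close>

lemma eigenvalue_sequence_inj:
  assumes "idempotent_ordering A d (elt \<Phi>) (idem \<Phi>)" "eigenvalue_sequence A d \<Phi> \<theta>"
  shows "inj_on \<theta> {..d}"
proof (rule inj_onI)
  fix i j assume ij: "i \<in> {..d}" "j \<in> {..d}" "\<theta> i = \<theta> j"
  then have "idem \<Phi> i = idem \<Phi> j" using assms(2) by (simp add: eigenvalue_sequence_def)
  with ij assms(1) show "i = j" by (auto simp: idempotent_ordering_def bij_betw_def dest: inj_onD)
qed

text \<open>The \<open>d + 1\<close> eigenvalues are mapped onto \<open>d + 1\<close> idempotents,
  hence injectively. This identifies the eigenvalue sequences that
  \<open>first_split_sequence\<close> quantifies for itself with the given ones.\<close>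

lemma eigenvalue_sequence_unique:
  assumes mf: "multiplicity_free A d (elt \<Phi>)" and ord: "idempotent_ordering A d (elt \<Phi>) (idem \<Phi>)"
    and \<theta>: "eigenvalue_sequence A d \<Phi> \<theta>"
    and \<mu>: "\<mu> \<in> eigenvalues A (elt \<Phi>)" "idem \<Phi> i = primitive_idempotent A (elt \<Phi>) \<mu>" and i: "i \<le> d"
  shows "\<mu> = \<theta> i"
proof -
  let ?S = "eigenvalues A (elt \<Phi>)"
  have "card ?S = d + 1" using mf by (simp add: multiplicity_free_def)
  moreover from this have "finite ?S" by (intro card_ge_0_finite) simp
  moreover have "card (primitive_idempotent A (elt \<Phi>) ` ?S) = d + 1"
    using bij_betw_same_card[OF ord[unfolded idempotent_ordering_def]] by simp
  ultimately have "inj_on (primitive_idempotent A (elt \<Phi>)) ?S" by (intro eq_card_imp_inj_on) auto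
  moreover have "\<theta> i \<in> ?S" "idem \<Phi> i = primitive_idempotent A (elt \<Phi>) (\<theta> i)"
    using \<theta> i by (auto simp: eigenvalue_sequence_def)
  ultimately show ?thesis using \<mu> by (auto dest: inj_onD)
qed

definition dual :: "'a leonard \<Rightarrow> 'a leonard" where
  "dual \<Phi> = \<lparr>elt = dual_elt \<Phi>, idem = dual_idem \<Phi>, dual_elt = elt \<Phi>, dual_idem = idem \<Phi>\<rparr>"

lemma dual_simps [simp]:
  "elt (dual \<Phi>) = dual_elt \<Phi>" "idem (dual \<Phi>) = dual_idem \<Phi>"
  "dual_elt (dual \<Phi>) = elt \<Phi>" "dual_idem (dual \<Phi>) = idem \<Phi>"
  by (simp_all add: dual_def)

lemma dual_eigenvalue_sequence_eq: "dual_eigenvalue_sequence A d \<Phi> \<theta>s \<longleftrightarrow> eigenvalue_sequence A d (dual \<Phi>) \<theta>s"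
  by (simp add: dual_eigenvalue_sequence_def eigenvalue_sequence_def)

lemma lower_bidiagonal_cong: "(\<And>i. i \<le> d \<Longrightarrow> \<theta> i = \<theta>' i) \<Longrightarrow> lower_bidiagonal d \<theta> = lower_bidiagonal d \<theta>'"
  unfolding lower_bidiagonal_def by (rule eq_matI) auto

lemma upper_bidiagonal_cong: "(\<And>i. i \<le> d \<Longrightarrow> \<theta>s i = \<theta>s' i) \<Longrightarrow> upper_bidiagonal d \<theta>s \<phi> = upper_bidiagonal d \<theta>s' \<phi>"
  unfolding upper_bidiagonal_def by (rule eq_matI) auto

lemma first_split_sequenceD:
  assumes mf: "multiplicity_free A d (elt \<Phi>)" "multiplicity_free A d (dual_elt \<Phi>)"
    and ord: "idempotent_ordering A d (elt \<Phi>) (idem \<Phi>)" "idempotent_ordering A d (dual_elt \<Phi>) (dual_idem \<Phi>)"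
    and \<theta>: "eigenvalue_sequence A d \<Phi> \<theta>" and \<theta>s: "dual_eigenvalue_sequence A d \<Phi> \<theta>s"
    and s: "first_split_sequence A d \<Phi> \<phi>"
  obtains \<beta> where "\<beta> \<in> algebra_iso A (mat_algebra (d + 1))"
    "\<beta> (elt \<Phi>) = lower_bidiagonal d \<theta>" "\<beta> (dual_elt \<Phi>) = upper_bidiagonal d \<theta>s \<phi>"
proof -
  obtain t ts \<beta> where t: "eigenvalue_sequence A d \<Phi> t" "dual_eigenvalue_sequence A d \<Phi> ts"
    and \<beta>: "\<beta> \<in> algebra_iso A (mat_algebra (d + 1))"
      "\<beta> (elt \<Phi>) = lower_bidiagonal d t" "\<beta> (dual_elt \<Phi>) = upper_bidiagonal d ts \<phi>"
    using s unfolding first_split_sequence_def by blast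
  have "t i = \<theta> i" if "i \<le> d" for i
    using eigenvalue_sequence_unique[OF mf(1) ord(1) \<theta> _ _ that] t(1) that
    by (auto simp: eigenvalue_sequence_def)
  moreover have "ts i = \<theta>s i" if "i \<le> d" for i
    using eigenvalue_sequence_unique[of A d "dual \<Phi>" \<theta>s "ts i" i] mf(2) ord(2) \<theta>s t(2) that
    unfolding dual_eigenvalue_sequence_eq by (auto simp: eigenvalue_sequence_def)
  ultimately show ?thesis
    using that[OF \<beta>(1)] \<beta>(2,3) lower_bidiagonal_cong[of d t \<theta>] upper_bidiagonal_cong[of d ts \<theta>s \<phi>] by simp
qed

lemma reverse_idem_simps [simp]:
  "elt (reverse_idem d \<Phi>) = elt \<Phi>" "idem (reverse_idem d \<Phi>) i = idem \<Phi> (d - i)"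
  "dual_elt (reverse_idem d \<Phi>) = dual_elt \<Phi>" "dual_idem (reverse_idem d \<Phi>) = dual_idem \<Phi>"
  by (simp_all add: reverse_idem_def)

lemma idempotent_ordering_reverse:
  assumes "idempotent_ordering A d x E"
  shows "idempotent_ordering A d x (\<lambda>i. E (d - i))"
proof -
  have "bij_betw (\<lambda>i. d - i) {..d} {..d}" by (rule bij_betwI[where g = "\<lambda>i. d - i"]) auto
  from bij_betw_trans[OF this assms[unfolded idempotent_ordering_def]] show ?thesis
    by (simp add: idempotent_ordering_def comp_def)
qed

lemma second_split_sequenceD:
  assumes mf: "multiplicity_free A d (elt \<Phi>)" "multiplicity_free A d (dual_elt \<Phi>)"
    and ord: "idempotent_ordering A d (elt \<Phi>) (idem \<Phi>)" "idempotent_ordering A d (dual_elt \<Phi>) (dual_idem \<Phi>)"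
    and \<theta>: "eigenvalue_sequence A d \<Phi> \<theta>" and \<theta>s: "dual_eigenvalue_sequence A d \<Phi> \<theta>s"
    and s: "second_split_sequence A d \<Phi> \<psi>"
  obtains \<beta> where "\<beta> \<in> algebra_iso A (mat_algebra (d + 1))"
    "\<beta> (elt \<Phi>) = lower_bidiagonal d (\<lambda>i. \<theta> (d - i))" "\<beta> (dual_elt \<Phi>) = upper_bidiagonal d \<theta>s \<psi>"
proof (rule first_split_sequenceD[where \<Phi> = "reverse_idem d \<Phi>" and A = A and d = d and \<theta> = "\<lambda>i. \<theta> (d - i)" and \<theta>s = \<theta>s and \<phi> = \<psi>])
  show "idempotent_ordering A d (elt (reverse_idem d \<Phi>)) (idem (reverse_idem d \<Phi>))"
    using idempotent_ordering_reverse[OF ord(1)] by (simp add: reverse_idem_def)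
  show "eigenvalue_sequence A d (reverse_idem d \<Phi>) (\<lambda>i. \<theta> (d - i))"
    using \<theta> by (simp add: eigenvalue_sequence_def)
  show "dual_eigenvalue_sequence A d (reverse_idem d \<Phi>) \<theta>s"
    using \<theta>s by (simp add: dual_eigenvalue_sequence_def)
qed (use mf ord s that in \<open>auto simp: second_split_sequence_def\<close>)

section \<open>Diagonalization of split forms and necessity\<close>

text \<open>Conjugation by the Newton matrix makes the lower bidiagonal matrix diagonal; what it
  makes of the upper bidiagonal one is the operator on the grid.\<close>

lemma split_diagonalization:
  fixes A :: "('f::field, 'a) module"
  assumes A: "assoc_algebra class_ring A" and \<beta>: "\<beta> \<in> algebra_iso A (mat_algebra (d + 1))"
    and x: "x \<in> carrier A" "\<beta> x = lower_bidiagonal d \<theta>" and y: "y \<in> carrier A" "\<beta> y = upper_bidiagonal d \<theta>s \<phi>"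
    and inj: "inj_on \<theta> {..d}"
  obtains \<sigma> where "diagonalized d A \<sigma> x \<theta>" "split_form d \<theta> \<theta>s \<phi> (\<lambda>i j. \<sigma> y $$ (i, j))"
proof -
  let ?n = "d + 1" and ?V = "newton_mat d \<theta> \<theta>" and ?D = "mat_diag (d + 1) \<theta>"
  have V: "?V \<in> carrier_mat ?n ?n" by (rule newton_mat_carrier)
  obtain W where W: "W \<in> carrier_mat ?n ?n" "?V * W = 1\<^sub>m ?n" "W * ?V = 1\<^sub>m ?n"
    using det_nonzero_inverse[OF V det_newton_mat[OF inj]] by blast
  define \<sigma> where "\<sigma> = (\<lambda>M. ?V * M * W) \<circ> \<beta>"
  have iso: "\<sigma> \<in> algebra_iso A (mat_algebra ?n)"
    unfolding \<sigma>_def by (rule algebra_iso_trans[OF \<beta> algebra_iso_conjugate[OF V W(1,2)]])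
  interpret algebra_isomorphism A "mat_algebra ?n" \<sigma> by (rule algebra_isomorphismI[OF A iso])
  have D: "?D * ?V = ?V * lower_bidiagonal d \<theta>"
    by (rule mat_diag_newton_mat) (use poly_newton_eq_0_iff[OF inj, of _ "d + 1"] in simp)
  have "\<sigma> x = ?D * ?V * W" by (simp only: \<sigma>_def comp_apply x(2) D)
  also have "\<dots> = ?D" unfolding assoc_mult_mat[OF mat_diag_dim V W(1)] W(2) by (rule right_mult_one_mat[OF mat_diag_dim])
  finally have "\<sigma> x = ?D" .
  then have diag: "diagonalized d A \<sigma> x \<theta>"
    by unfold_locales (use x(1) inj in auto)
  have \<sigma>y: "\<sigma> y \<in> carrier_mat ?n ?n" using H.hom_closed[OF y(1)] by (simp add: module_mat_simps)
  have "\<sigma> y * ?V = ?V * upper_bidiagonal d \<theta>s \<phi> * (W * ?V)"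
    unfolding \<sigma>_def comp_apply y(2)
    by (rule assoc_mult_mat[OF mult_carrier_mat[OF V upper_bidiagonal_carrier] W(1) V])
  also have "\<dots> = ?V * upper_bidiagonal d \<theta>s \<phi>"
    unfolding W(3) by (rule right_mult_one_mat[OF mult_carrier_mat[OF V upper_bidiagonal_carrier]])
  finally have "split_form d \<theta> \<theta>s \<phi> (\<lambda>i j. \<sigma> y $$ (i, j))"
    unfolding mult_newton_mat_eq_iff[OF \<sigma>y] split_form_def .
  with diag show ?thesis by (rule that)
qed

lemma leonard_system_assoc_algebra: "leonard_system A d \<Phi> \<Longrightarrow> assoc_algebra class_ring A"
  by (simp add: leonard_system_def is_matrix_algebra_def)

theorem leonard_system_imp_parameter_conditions:
  fixes A :: "('f::field, 'a) module"
  assumes "leonard_system_with A d \<Phi> \<theta> \<theta>s \<phi> \<psi>"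
  shows "parameter_conditions d \<theta> \<theta>s \<phi> \<psi>"
proof -
  have L: "leonard_system A d \<Phi>" and \<theta>: "eigenvalue_sequence A d \<Phi> \<theta>"
    and \<theta>s: "dual_eigenvalue_sequence A d \<Phi> \<theta>s"
    and s: "first_split_sequence A d \<Phi> \<phi>" "second_split_sequence A d \<Phi> \<psi>"
    using assms by (auto simp: leonard_system_with_def)
  have mf: "multiplicity_free A d (elt \<Phi>)" "multiplicity_free A d (dual_elt \<Phi>)"
    and ord: "idempotent_ordering A d (elt \<Phi>) (idem \<Phi>)" "idempotent_ordering A d (dual_elt \<Phi>) (dual_idem \<Phi>)"
    using L by (auto simp: leonard_system_def)
  have A: "assoc_algebra class_ring A" by (rule leonard_system_assoc_algebra[OF L])
  have carrier: "elt \<Phi> \<in> carrier A" "dual_elt \<Phi> \<in> carrier A" using mf by (auto simp: multiplicity_free_def)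
  have inj: "inj_on \<theta> {..d}" by (rule eigenvalue_sequence_inj[OF ord(1) \<theta>])
  have injs: "inj_on \<theta>s {..d}"
    by (rule eigenvalue_sequence_inj[of A d "dual \<Phi>"]) (use ord \<theta>s in \<open>simp_all add: dual_eigenvalue_sequence_eq\<close>)
  obtain \<beta>\<^sub>1 where \<beta>1: "\<beta>\<^sub>1 \<in> algebra_iso A (mat_algebra (d + 1))"
    "\<beta>\<^sub>1 (elt \<Phi>) = lower_bidiagonal d \<theta>" "\<beta>\<^sub>1 (dual_elt \<Phi>) = upper_bidiagonal d \<theta>s \<phi>"
    by (rule first_split_sequenceD[OF mf ord \<theta> \<theta>s s(1)])
  obtain \<beta>\<^sub>2 where \<beta>2: "\<beta>\<^sub>2 \<in> algebra_iso A (mat_algebra (d + 1))"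
    "\<beta>\<^sub>2 (elt \<Phi>) = lower_bidiagonal d (\<lambda>i. \<theta> (d - i))" "\<beta>\<^sub>2 (dual_elt \<Phi>) = upper_bidiagonal d \<theta>s \<psi>"
    by (rule second_split_sequenceD[OF mf ord \<theta> \<theta>s s(2)])
  obtain \<sigma> where D1: "diagonalized d A \<sigma> (elt \<Phi>) \<theta>" and \<phi>: "split_form d \<theta> \<theta>s \<phi> (\<lambda>i j. \<sigma> (dual_elt \<Phi>) $$ (i, j))"
    by (rule split_diagonalization[OF A \<beta>1(1) carrier(1) \<beta>1(2) carrier(2) \<beta>1(3) inj])
  obtain \<tau> where D2: "diagonalized d A \<tau> (elt \<Phi>) (\<lambda>i. \<theta> (d - i))"
    and \<psi>: "split_form d (\<lambda>i. \<theta> (d - i)) \<theta>s \<psi> (\<lambda>i j. \<tau> (dual_elt \<Phi>) $$ (i, j))"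
    by (rule split_diagonalization[OF A \<beta>2(1) carrier(1) \<beta>2(2) carrier(2) \<beta>2(3) inj_on_reflect[OF inj]])
  interpret D1: diagonalized d A \<sigma> "elt \<Phi>" \<theta> by (rule D1)
  interpret D2: diagonalized d A \<tau> "elt \<Phi>" "\<lambda>i. \<theta> (d - i)" by (rule D2)
  let ?y = "dual_elt \<Phi>"
  have E: "idem \<Phi> i = D1.E i" if "i \<le> d" for i using \<theta> that by (simp add: eigenvalue_sequence_def)
  have far: "D1.E i \<otimes>\<^bsub>A\<^esub> ?y \<otimes>\<^bsub>A\<^esub> D1.E j = \<zero>\<^bsub>A\<^esub>" if "i \<le> d" "j \<le> d" "1 < \<bar>int i - int j\<bar>" for i j
    using L that E unfolding leonard_system_def by metis
  have near: "D1.E i \<otimes>\<^bsub>A\<^esub> ?y \<otimes>\<^bsub>A\<^esub> D1.E j \<noteq> \<zero>\<^bsub>A\<^esub>" if "i \<le> d" "j \<le> d" "\<bar>int i - int j\<bar> = 1" for i j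
    using L that E unfolding leonard_system_def by metis
  show ?thesis
  proof (rule parameter_conditions_if_split_forms[OF inj injs _ _ _ \<phi> _ \<psi>])
    show "tridiagonal d (\<lambda>i j. \<sigma> ?y $$ (i, j))"
      using far D1.sandwich_eq_zero_iff[OF carrier(2)] by (simp add: tridiagonal_def)
    show "\<sigma> ?y $$ (i, i + 1) \<noteq> 0" "\<sigma> ?y $$ (i + 1, i) \<noteq> 0" if "i < d" for i
      using near[of i "i + 1"] near[of "i + 1" i] D1.sandwich_eq_zero_iff[OF carrier(2)] that by simp_all
    show "tridiagonal d (\<lambda>i j. \<tau> ?y $$ (i, j))"
      unfolding tridiagonal_def
    proof (intro allI impI)
      fix i j assume ij: "i \<le> d" "j \<le> d" "1 < \<bar>int i - int j\<bar>"
      then have "1 < \<bar>int (d - i) - int (d - j)\<bar>" by linarith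
      with far[of "d - i" "d - j"] D2.sandwich_eq_zero_iff[OF carrier(2) ij(1,2)] show "\<tau> ?y $$ (i, j) = 0" by simp
    qed
    \<comment> \<open>Both entries are the scalar by which the same primitive idempotent is
      multiplied when it encloses \<open>?y\<close>; its index is \<open>i\<close> in one order and
      \<open>d - i\<close> in the other.\<close>
    show "\<tau> ?y $$ (i, i) = \<sigma> ?y $$ (d - i, d - i)" if "i \<le> d" for i
      using D1.sandwich_diagonal[OF carrier(2), of "d - i" "\<tau> ?y $$ (i, i)"]
        D2.sandwich_diagonal[OF carrier(2) that, of "\<tau> ?y $$ (i, i)"] by simp
  qed
qed

section \<open>Uniqueness up to isomorphism\<close>

lemma leonard_system_withD:
  fixes A :: "('f::field, 'a) module"
  assumes "leonard_system_with A d \<Phi> \<theta> \<theta>s \<phi> \<psi>"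
  shows "assoc_algebra class_ring A" "elt \<Phi> \<in> carrier A" "dual_elt \<Phi> \<in> carrier A"
    "finite (eigenvalues A (elt \<Phi>))" "finite (eigenvalues A (dual_elt \<Phi>))"
    "\<And>i. i \<le> d \<Longrightarrow> idem \<Phi> i = primitive_idempotent A (elt \<Phi>) (\<theta> i)"
    "\<And>i. i \<le> d \<Longrightarrow> dual_idem \<Phi> i = primitive_idempotent A (dual_elt \<Phi>) (\<theta>s i)"
    "\<exists>\<beta>\<in>algebra_iso A (mat_algebra (d + 1)).
      \<beta> (elt \<Phi>) = lower_bidiagonal d \<theta> \<and> \<beta> (dual_elt \<Phi>) = upper_bidiagonal d \<theta>s \<phi>"
proof -
  have L: "leonard_system A d \<Phi>" and s: "eigenvalue_sequence A d \<Phi> \<theta>" "dual_eigenvalue_sequence A d \<Phi> \<theta>s"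
    "first_split_sequence A d \<Phi> \<phi>" using assms by (auto simp: leonard_system_with_def)
  have mf: "multiplicity_free A d (elt \<Phi>)" "multiplicity_free A d (dual_elt \<Phi>)"
    and ord: "idempotent_ordering A d (elt \<Phi>) (idem \<Phi>)" "idempotent_ordering A d (dual_elt \<Phi>) (dual_idem \<Phi>)"
    using L by (auto simp: leonard_system_def)
  show "\<exists>\<beta>\<in>algebra_iso A (mat_algebra (d + 1)).
      \<beta> (elt \<Phi>) = lower_bidiagonal d \<theta> \<and> \<beta> (dual_elt \<Phi>) = upper_bidiagonal d \<theta>s \<phi>"
    using first_split_sequenceD[OF mf ord s] by blast
  show "assoc_algebra class_ring A" by (rule leonard_system_assoc_algebra[OF L])
  show "elt \<Phi> \<in> carrier A" "dual_elt \<Phi> \<in> carrier A"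
    "finite (eigenvalues A (elt \<Phi>))" "finite (eigenvalues A (dual_elt \<Phi>))"
    using mf by (auto simp: multiplicity_free_def intro: card_ge_0_finite)
  show "\<And>i. i \<le> d \<Longrightarrow> idem \<Phi> i = primitive_idempotent A (elt \<Phi>) (\<theta> i)"
    "\<And>i. i \<le> d \<Longrightarrow> dual_idem \<Phi> i = primitive_idempotent A (dual_elt \<Phi>) (\<theta>s i)"
    using s by (auto simp: eigenvalue_sequence_def dual_eigenvalue_sequence_def)
qed

text \<open>The split isomorphisms send both systems to the same pair of bidiagonal matrices, which
  involve only \<theta>, \<theta>s and \<phi>; so one isomorphism is composed with the inverse of
  the other. The idempotents follow because they are polynomials in A and in A*.\<close>

theorem leonard_system_unique:
  fixes A :: "('f::field, 'a) module" and B :: "('f, 'b) module"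
  assumes \<Phi>: "leonard_system_with A d \<Phi> \<theta> \<theta>s \<phi> \<psi>" and \<Psi>: "leonard_system_with B d \<Psi> \<theta> \<theta>s \<phi> \<psi>"
  shows "leonard_iso d A \<Phi> B \<Psi> \<noteq> {}"
proof -
  note A = leonard_system_withD[OF \<Phi>] and B = leonard_system_withD[OF \<Psi>]
  obtain \<beta>\<^sub>1 where \<beta>1: "\<beta>\<^sub>1 \<in> algebra_iso A (mat_algebra (d + 1))"
    "\<beta>\<^sub>1 (elt \<Phi>) = lower_bidiagonal d \<theta>" "\<beta>\<^sub>1 (dual_elt \<Phi>) = upper_bidiagonal d \<theta>s \<phi>" using A(8) by blast
  obtain \<beta>\<^sub>2 where \<beta>2: "\<beta>\<^sub>2 \<in> algebra_iso B (mat_algebra (d + 1))"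
    "\<beta>\<^sub>2 (elt \<Psi>) = lower_bidiagonal d \<theta>" "\<beta>\<^sub>2 (dual_elt \<Psi>) = upper_bidiagonal d \<theta>s \<phi>" using B(8) by blast
  interpret B: algebra_isomorphism B "mat_algebra (d + 1)" \<beta>\<^sub>2 by (rule algebra_isomorphismI[OF B(1) \<beta>2(1)])
  define \<sigma> where "\<sigma> = inv_into (carrier B) \<beta>\<^sub>2 \<circ> \<beta>\<^sub>1"
  have iso: "\<sigma> \<in> algebra_iso A B"
    unfolding \<sigma>_def by (rule algebra_iso_trans[OF \<beta>1(1) algebra_iso_inv[OF B(1) assoc_algebra_mat \<beta>2(1)]])
  interpret S: algebra_isomorphism A B \<sigma>
    by (intro algebra_isomorphism.intro algebra_isomorphism_axioms.intro A(1) B(1) iso)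
  have elt: "\<sigma> (elt \<Phi>) = elt \<Psi>" "\<sigma> (dual_elt \<Phi>) = dual_elt \<Psi>"
    using bij_betw_inv_into_left[OF B.bij B(2)] bij_betw_inv_into_left[OF B.bij B(3)] \<beta>1 \<beta>2
    by (simp_all add: \<sigma>_def)
  have "\<sigma> (idem \<Phi> i) = idem \<Psi> i \<and> \<sigma> (dual_idem \<Phi> i) = dual_idem \<Psi> i" if "i \<le> d" for i
    using S.primitive_idempotent[OF A(2,4)] S.primitive_idempotent[OF A(3,5)] A(6,7) B(6,7) elt that by simp
  with iso elt have "\<sigma> \<in> leonard_iso d A \<Phi> B \<Psi>" by (simp add: leonard_iso_def)
  then show ?thesis by blast
qed

section \<open>Existence\<close>

theorem leonard_system_exists:
  fixes \<theta> \<theta>s \<phi> \<psi> :: "nat \<Rightarrow> 'f::field"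
  assumes "parameter_conditions d \<theta> \<theta>s \<phi> \<psi>"
  shows "\<exists>\<Phi>. leonard_system_with (mat_algebra (d + 1)) d \<Phi> \<theta> \<theta>s \<phi> \<psi>"
proof -
  let ?n = "d + 1" and ?A = "mat_algebra (d + 1) :: ('f, 'f mat) module"
  have nz: "\<And>i. 1 \<le> i \<Longrightarrow> i \<le> d \<Longrightarrow> \<phi> i \<noteq> 0 \<and> \<psi> i \<noteq> 0" and inj: "inj_on \<theta> {..d}" and injs: "inj_on \<theta>s {..d}"
    and \<phi>: "\<And>i. 1 \<le> i \<Longrightarrow> i \<le> d \<Longrightarrow>
      \<phi> i = \<psi> 1 * (antisym_sum d \<theta> i / (\<theta> 0 - \<theta> d)) + (\<theta>s i - \<theta>s 0) * (\<theta> (i - 1) - \<theta> d)"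
    and \<psi>: "\<And>i. 1 \<le> i \<Longrightarrow> i \<le> d \<Longrightarrow>
      \<psi> i = \<phi> 1 * (antisym_sum d \<theta> i / (\<theta> 0 - \<theta> d)) + (\<theta>s i - \<theta>s 0) * (\<theta> (d - i + 1) - \<theta> 0)"
    and "\<exists>\<gamma>. common_ratio d \<theta> \<gamma> \<and> common_ratio d \<theta>s \<gamma>"
    using assms unfolding parameter_conditions_iff by blast+
  then obtain \<gamma> where \<gamma>: "common_ratio d \<theta> \<gamma>" "common_ratio d \<theta>s \<gamma>" by blast
  obtain f where grid: "tridiagonal_grid d \<theta> \<theta>s f" and f\<phi>: "split_form d \<theta> \<theta>s \<phi> f"
    and f\<psi>: "split_form d (\<lambda>i. \<theta> (d - i)) \<theta>s \<psi> (\<lambda>i j. f (d - i) (d - j))"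
    by (rule tridiagonal_grid_exists[OF inj recurrent_if_common_ratio[OF inj \<gamma>(1)]
          recurrent_if_common_ratio[OF injs \<gamma>(2)] \<phi> \<psi>]) auto
  interpret tridiagonal_grid d \<theta> \<theta>s f by (rule grid)
  define X where "X = mat ?n ?n (\<lambda>(i, j). f i j)"
  have X: "X \<in> carrier_mat ?n ?n" by (simp add: X_def)
  have entry: "X $$ (i, j) = f i j" if "i \<le> d" "j \<le> d" for i j using that by (simp add: X_def)
  have super: "f i (i + 1) \<noteq> 0" and sub: "f (i + 1) i \<noteq> 0" if "i < d" for i
    using split_form_superdiagonal_nonzero_iff[OF inj tri f\<phi> that] split_form_subdiagonal_nonzero_iff[OF inj tri f\<psi> that]
      nz[of "i + 1"] nz[of "d - i"] that by auto
  let ?D = "mat_diag ?n \<theta>" and ?Ds = "mat_diag ?n \<theta>s"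
  let ?V = "newton_mat d \<theta> \<theta>" and ?V' = "newton_mat d (\<lambda>i. \<theta> (d - i)) \<theta>"
  have XV: "X * ?V = ?V * upper_bidiagonal d \<theta>s \<phi>"
    unfolding mult_newton_mat_eq_iff[OF X] using f\<phi> by (simp add: split_form_def entry)
  \<comment> \<open>The second split form is rewritten over the unreversed eigenbasis: only the
    nodes stay reversed, the rows and columns of \<open>X\<close> do not.\<close>
  have XV': "X * ?V' = ?V' * upper_bidiagonal d \<theta>s \<psi>"
    unfolding mult_newton_mat_eq_iff[OF X]
  proof (intro allI impI)
    fix i n assume i: "i \<le> d" and n: "n \<le> d"
    let ?e = "\<lambda>n j. poly (newton (\<lambda>i. \<theta> (d - i)) n) (\<theta> j)"
    have "(\<Sum>j\<le>d. f i (d - j) * ?e n (d - j)) = \<theta>s n * ?e n i + (if n = 0 then 0 else \<psi> n * ?e (n - 1) i)"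
      using f\<psi>[unfolded split_form_def, rule_format, of "d - i" n] i n by simp
    then show "(\<Sum>j\<le>d. X $$ (i, j) * ?e n j) = \<theta>s n * ?e n i + (if n = 0 then 0 else \<psi> n * ?e (n - 1) i)"
      using sum_reflect[of "\<lambda>j. f i j * ?e n j" d] i by (simp add: entry)
  qed
  have DV: "?D * ?V = ?V * lower_bidiagonal d \<theta>"
    by (rule mat_diag_newton_mat) (use poly_newton_eq_0_iff[OF inj, of _ ?n] in simp)
  have DV': "?D * ?V' = ?V' * lower_bidiagonal d (\<lambda>i. \<theta> (d - i))"
  proof (rule mat_diag_newton_mat)
    show "poly (newton (\<lambda>i. \<theta> (d - i)) ?n) (\<theta> i) = 0" if "i \<le> d" for i
      using poly_newton_eq_0_iff[OF inj_on_reflect[OF inj], of "d - i" ?n] that by simp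
  qed
  define \<Phi> where "\<Phi> = \<lparr>elt = ?D, idem = (\<lambda>i. primitive_idempotent ?A ?D (\<theta> i)),
    dual_elt = X, dual_idem = (\<lambda>i. primitive_idempotent ?A X (\<theta>s i))\<rparr>"
  have \<Phi>: "elt \<Phi> = ?D" "idem \<Phi> i = primitive_idempotent ?A ?D (\<theta> i)"
    "dual_elt \<Phi> = X" "dual_idem \<Phi> i = primitive_idempotent ?A X (\<theta>s i)" for i by (simp_all add: \<Phi>_def)
  have carrier: "?D \<in> carrier ?A" "X \<in> carrier ?A" using X by (simp_all add: module_mat_simps)
  have id: "(\<lambda>M. M) \<in> algebra_iso ?A ?A"
    by (auto simp: algebra_iso_def ring_iso_def intro!: ring_hom_memI bij_betw_imageI)
  interpret D1: diagonalized d ?A "\<lambda>M. M" ?D \<theta>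
    by (intro diagonalized.intro diagonalized_axioms.intro algebra_isomorphismI assoc_algebra_mat id carrier(1) refl inj)
  obtain R where R: "R \<in> carrier_mat ?n ?n" and UR: "upper_bidiagonal d \<theta>s \<phi> * R = R * ?Ds"
    and R_upper: "upper_triangular R" "\<And>i. i \<le> d \<Longrightarrow> R $$ (i, i) \<noteq> 0"
    by (rule upper_bidiagonal_eigenbasis[OF injs, of \<phi>]) (use nz in auto)
  have V: "?V \<in> carrier_mat ?n ?n" by (rule newton_mat_carrier)
  \<comment> \<open>The columns of \<open>R\<close> are eigenvectors of the bidiagonal matrix; the
    Newton matrix carries them to eigenvectors of \<open>X\<close>.\<close>
  define W where "W = ?V * R"
  have W: "W \<in> carrier_mat ?n ?n" unfolding W_def by (rule mult_carrier_mat[OF V R])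
  have detW: "det W \<noteq> 0"
    unfolding W_def det_mult[OF V R] using det_newton_mat[OF inj] det_upper_triangular_nonzero[OF R R_upper] by simp
  obtain W' where W': "W' \<in> carrier_mat ?n ?n" "W * W' = 1\<^sub>m ?n" "W' * W = 1\<^sub>m ?n"
    using det_nonzero_inverse[OF W detW] by blast
  obtain V' where V': "V' \<in> carrier_mat ?n ?n" "?V * V' = 1\<^sub>m ?n" "V' * ?V = 1\<^sub>m ?n"
    using det_nonzero_inverse[OF V det_newton_mat[OF inj]] by blast
  have assoc: "P * Q * S = P * (Q * S)" if "P \<in> carrier_mat ?n ?n" "Q \<in> carrier_mat ?n ?n" "S \<in> carrier_mat ?n ?n"
    for P Q S :: "'f mat" using that by (rule assoc_mult_mat)
  have LB: "lower_bidiagonal d \<theta> \<in> carrier_mat ?n ?n" and UB: "upper_bidiagonal d \<theta>s \<phi> \<in> carrier_mat ?n ?n"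
    and D: "?D \<in> carrier_mat ?n ?n" "?Ds \<in> carrier_mat ?n ?n"
    by (rule lower_bidiagonal_carrier upper_bidiagonal_carrier mat_diag_dim)+
  have XW: "X * W = W * ?Ds"
    unfolding W_def assoc[OF X V R, symmetric] XV assoc[OF V UB R] UR assoc[OF V R D(2), symmetric] ..
  \<comment> \<open>The matrix of A in the eigenbasis of A*.\<close>
  define Y where "Y = W' * ?D * W"
  have Y: "Y \<in> carrier_mat ?n ?n" unfolding Y_def by (intro mult_carrier_mat[of _ _ ?n] W W' D)
  have WY: "W * Y = ?D * W"
    unfolding Y_def assoc[OF W'(1) D(1) W] assoc[OF W W'(1) mult_carrier_mat[OF D(1) W], symmetric] W'(2)
    by (rule left_mult_one_mat[OF mult_carrier_mat[OF D(1) W]])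
  \<comment> \<open>Cancelling the Newton matrix replaces the diagonal form of A by its lower
    bidiagonal form, which is what the Hessenberg argument takes.\<close>
  have "?V * (R * Y) = ?V * (lower_bidiagonal d \<theta> * R)"
    using WY unfolding W_def assoc[OF V R Y] assoc[OF D(1) V R, symmetric] DV assoc[OF V LB R] .
  then have "V' * (?V * (R * Y)) = V' * (?V * (lower_bidiagonal d \<theta> * R))" by simp
  then have RY: "R * Y = lower_bidiagonal d \<theta> * R"
    unfolding assoc[OF V'(1) V mult_carrier_mat[OF R Y], symmetric]
      assoc[OF V'(1) V mult_carrier_mat[OF LB R], symmetric] V'(3)
    using left_mult_one_mat[OF mult_carrier_mat[OF R Y]] left_mult_one_mat[OF mult_carrier_mat[OF LB R]] by simp
  have hessenberg: "\<And>i j. i \<le> d \<Longrightarrow> j + 1 < i \<Longrightarrow> Y $$ (i, j) = 0" "\<And>j. j < d \<Longrightarrow> Y $$ (j + 1, j) \<noteq> 0"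
    using upper_hessenberg_if_intertwined[OF R R_upper(1) _ Y RY] R_upper(2) by blast+
  obtain k where k: "\<And>i. i \<le> d \<Longrightarrow> k i \<noteq> 0" "\<And>i j. i \<le> d \<Longrightarrow> j \<le> d \<Longrightarrow> k i * f i j = k j * f j i"
    by (rule tridiagonal_symmetrizer[OF tri super sub]) auto
  obtain h where h: "\<And>i. i \<le> d \<Longrightarrow> h i \<noteq> 0" "\<And>i j. i \<le> d \<Longrightarrow> j \<le> d \<Longrightarrow> h i * Y $$ (i, j) = h j * Y $$ (j, i)"
    by (rule dual_symmetrizer[OF X W detW Y XW WY injs k(1)]) (use k(2) entry in auto)
  have Y_sym: "Y $$ (i, j) = 0 \<longleftrightarrow> Y $$ (j, i) = 0" if "i \<le> d" "j \<le> d" for i j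
    using h(2)[OF that] h(1)[of i] h(1)[of j] that by auto
  have dual_iso: "(\<lambda>M. W' * M * W) \<in> algebra_iso ?A ?A" by (rule algebra_iso_conjugate[OF W'(1) W W'(3)])
  have "W' * X * W = ?Ds"
    unfolding assoc[OF W'(1) X W] XW assoc[OF W'(1) W D(2), symmetric] W'(3) by (rule left_mult_one_mat[OF D(2)])
  then interpret D2: diagonalized d ?A "\<lambda>M. W' * M * W" X \<theta>s
    by (intro diagonalized.intro diagonalized_axioms.intro algebra_isomorphismI assoc_algebra_mat dual_iso carrier(2) injs)
  have "leonard_system ?A d \<Phi>"
    unfolding leonard_system_def
  proof (intro conjI allI impI)
    show "is_matrix_algebra (d + 1) ?A" using assoc_algebra_mat id by (auto simp: is_matrix_algebra_def)
    show "multiplicity_free ?A d (elt \<Phi>)" "multiplicity_free ?A d (dual_elt \<Phi>)"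
      unfolding \<Phi> by (rule D1.multiplicity_free, rule D2.multiplicity_free)
    show "idempotent_ordering ?A d (elt \<Phi>) (idem \<Phi>)" unfolding \<Phi>(1) by (rule D1.idempotent_ordering) (rule \<Phi>(2))
    show "idempotent_ordering ?A d (dual_elt \<Phi>) (dual_idem \<Phi>)" unfolding \<Phi>(3) by (rule D2.idempotent_ordering) (rule \<Phi>(4))
    fix i j assume ij: "i \<le> d" "j \<le> d"
    note zero1 = D1.sandwich_eq_zero_iff[OF carrier(2) ij] and zero2 = D2.sandwich_eq_zero_iff[OF carrier(1) ij, folded Y_def]
    { assume far: "1 < \<bar>int i - int j\<bar>"
      then show "idem \<Phi> i \<otimes>\<^bsub>?A\<^esub> dual_elt \<Phi> \<otimes>\<^bsub>?A\<^esub> idem \<Phi> j = \<zero>\<^bsub>?A\<^esub>"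
        unfolding \<Phi> zero1 entry[OF ij] using tri ij by (simp add: tridiagonal_def)
      from far have "j + 1 < i \<or> i + 1 < j" by linarith
      then have "Y $$ (i, j) = 0" using hessenberg(1)[OF ij(1), of j] hessenberg(1)[OF ij(2), of i] Y_sym[OF ij] by auto
      then show "dual_idem \<Phi> i \<otimes>\<^bsub>?A\<^esub> elt \<Phi> \<otimes>\<^bsub>?A\<^esub> dual_idem \<Phi> j = \<zero>\<^bsub>?A\<^esub>" unfolding \<Phi> zero2 . }
    { assume "\<bar>int i - int j\<bar> = 1"
      then have near: "j = i + 1 \<and> i < d \<or> i = j + 1 \<and> j < d" using ij by linarith
      then show "idem \<Phi> i \<otimes>\<^bsub>?A\<^esub> dual_elt \<Phi> \<otimes>\<^bsub>?A\<^esub> idem \<Phi> j \<noteq> \<zero>\<^bsub>?A\<^esub>"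
        unfolding \<Phi> zero1 entry[OF ij] using super sub by blast
      from near have "Y $$ (i, j) \<noteq> 0" using hessenberg(2) Y_sym[OF ij] by blast
      then show "dual_idem \<Phi> i \<otimes>\<^bsub>?A\<^esub> elt \<Phi> \<otimes>\<^bsub>?A\<^esub> dual_idem \<Phi> j \<noteq> \<zero>\<^bsub>?A\<^esub>" unfolding \<Phi> zero2 . }
  qed
  moreover have \<theta>: "eigenvalue_sequence ?A d \<Phi> \<theta>"
    unfolding eigenvalue_sequence_def \<Phi> D1.spectrum by simp
  moreover have \<theta>s: "dual_eigenvalue_sequence ?A d \<Phi> \<theta>s"
    unfolding dual_eigenvalue_sequence_def \<Phi> D2.spectrum by simp
  \<comment> \<open>Both split isomorphisms are conjugations by a Newton matrix, with the nodes
    \<open>t\<close> in the given order or reversed.\<close>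
  have conj: "\<exists>\<beta>\<in>algebra_iso ?A ?A. \<beta> ?D = lower_bidiagonal d t \<and> \<beta> X = upper_bidiagonal d \<theta>s \<omega>"
    if "?D * newton_mat d t \<theta> = newton_mat d t \<theta> * lower_bidiagonal d t"
      "X * newton_mat d t \<theta> = newton_mat d t \<theta> * upper_bidiagonal d \<theta>s \<omega>" for t \<omega>
  proof -
    let ?U = "newton_mat d t \<theta>"
    have U: "?U \<in> carrier_mat ?n ?n" by (rule newton_mat_carrier)
    obtain U' where U': "U' \<in> carrier_mat ?n ?n" "U' * ?U = 1\<^sub>m ?n"
      using det_nonzero_inverse[OF U det_newton_mat[OF inj]] by blast
    have cancel: "U' * M * ?U = N" if "M * ?U = ?U * N" "M \<in> carrier_mat ?n ?n" "N \<in> carrier_mat ?n ?n" for M N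
      unfolding assoc[OF U'(1) that(2) U] that(1) assoc[OF U'(1) U that(3), symmetric] U'(2)
      by (rule left_mult_one_mat[OF that(3)])
    show ?thesis
      by (rule bexI[OF _ algebra_iso_conjugate[OF U'(1) U U'(2)]])
        (intro conjI cancel that X D lower_bidiagonal_carrier upper_bidiagonal_carrier)
  qed
  have "first_split_sequence ?A d \<Phi> \<phi>"
    unfolding first_split_sequence_def using \<theta> \<theta>s conj[OF DV XV] unfolding \<Phi> by blast
  moreover have "second_split_sequence ?A d \<Phi> \<psi>"
  proof -
    have "eigenvalue_sequence ?A d (reverse_idem d \<Phi>) (\<lambda>i. \<theta> (d - i))"
      using \<theta> by (simp add: eigenvalue_sequence_def)
    moreover have "dual_eigenvalue_sequence ?A d (reverse_idem d \<Phi>) \<theta>s"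
      using \<theta>s by (simp add: dual_eigenvalue_sequence_def)
    ultimately show ?thesis
      unfolding second_split_sequence_def first_split_sequence_def reverse_idem_simps \<Phi> using conj[OF DV' XV'] by blast
  qed
  ultimately show ?thesis using \<theta>s unfolding leonard_system_with_def by blast
qed

theorem theorem1p9:
  fixes d :: nat and \<theta> \<theta>s \<phi> \<psi> :: "nat \<Rightarrow> 'f::field"
  shows
    "((\<exists>(A :: ('f, 'f mat) module) \<Phi>. leonard_system_with A d \<Phi> \<theta> \<theta>s \<phi> \<psi>)
        \<longleftrightarrow> parameter_conditions d \<theta> \<theta>s \<phi> \<psi>) \<and>
     (\<forall>(A :: ('f, 'a) module) \<Phi>.
        leonard_system_with A d \<Phi> \<theta> \<theta>s \<phi> \<psi> \<longrightarrow> parameter_conditions d \<theta> \<theta>s \<phi> \<psi>) \<and>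
     (parameter_conditions d \<theta> \<theta>s \<phi> \<psi> \<longrightarrow>
        (\<forall>(A :: ('f, 'a) module) \<Phi> (B :: ('f, 'b) module) \<Psi>.
           leonard_system_with A d \<Phi> \<theta> \<theta>s \<phi> \<psi> \<and> leonard_system_with B d \<Psi> \<theta> \<theta>s \<phi> \<psi>
             \<longrightarrow> leonard_iso d A \<Phi> B \<Psi> \<noteq> {}))"
proof (intro conjI iffI allI impI)
  assume "\<exists>(A :: ('f, 'f mat) module) \<Phi>. leonard_system_with A d \<Phi> \<theta> \<theta>s \<phi> \<psi>"
  then show "parameter_conditions d \<theta> \<theta>s \<phi> \<psi>"
    by (elim exE) (rule leonard_system_imp_parameter_conditions)
next
  assume "parameter_conditions d \<theta> \<theta>s \<phi> \<psi>"
  from leonard_system_exists[OF this]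
  show "\<exists>(A :: ('f, 'f mat) module) \<Phi>. leonard_system_with A d \<Phi> \<theta> \<theta>s \<phi> \<psi>" by (rule exI)
next
  fix A :: "('f, 'a) module" and \<Phi>
  assume "leonard_system_with A d \<Phi> \<theta> \<theta>s \<phi> \<psi>"
  then show "parameter_conditions d \<theta> \<theta>s \<phi> \<psi>" by (rule leonard_system_imp_parameter_conditions)
next
  fix A :: "('f, 'a) module" and \<Phi> and B :: "('f, 'b) module" and \<Psi>
  assume "leonard_system_with A d \<Phi> \<theta> \<theta>s \<phi> \<psi> \<and> leonard_system_with B d \<Psi> \<theta> \<theta>s \<phi> \<psi>"
  then show "leonard_iso d A \<Phi> B \<Psi> \<noteq> {}" by (elim conjE) (rule leonard_system_unique)
qed

end
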